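(* The blocks $\widehat{\mathfrak B}_1^r(\lambda)$ with $\lambda\in\boldsymbol{\mathcal I}$ are precisely all the semisimple non-Steinberg blocks of $s_k(2,r)$; that is, each $\widehat{\mathfrak B}_1^r(\lambda)$ with $\lambda\in\boldsymbol{\mathcal I}$ is a semisimple non-Steinberg block of $s_k(2,r)$, and every semisimple non-Steinberg block of $s_k(2,r)$ is of this form.
   Context: Setting. $k$ is a field containing a primitive $l$-th root of unity $\varepsilon$, with $l\geq 3$ odd; $r\geq1$ is an integer. Let $\mathbf U(2)$ be the quantum enveloping algebra of $\mathfrak{gl}_2$ over $\mathbb Q(\upsilon)$, generated by $E,F,K_1^{\pm1},K_2^{\pm1}$ with relations $K_1K_2=K_2K_1$, $K_iK_i^{-1}=1$, $K_1E=\upsilon EK_1$, $K_2E=\upsilon^{-1}EK_2$, $K_1F=\upsilon^{-1}FK_1$, $K_2F=\upsilon FK_2$, $EF-FE=\frac{K-K^{-1}}{\upsilon-\upsilon^{-1}}$ where $K=K_1K_2^{-1}$; its comultiplication is $\Delta(E)=E\otimes K+1\otimes E$, $\Delta(F)=F\otimes1+K^{-1}\otimes F$, $\Delta(K_i)=K_i\otimes K_i$. Put $\mathcal Z=\mathbb Z[\upsilon,\upsilon^{-1}]$, $[i]=\frac{\upsilon^i-\upsilon^{-i}}{\upsilon-\upsilon^{-1}}$, $[m]^!=[1]\cdots[m]$. $U_{\mathcal Z}(2)$ is the $\mathcal Z$-subalgebra generated by all $E^{(m)}=E^m/[m]^!$, $F^{(m)}=F^m/[m]^!$, $K_i^{\pm1}$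 and $\left[{K_i;0\atop t}\right]=\prod_{s=1}^t\frac{K_i\upsilon^{-s+1}-K_i^{-1}\upsilon^{s-1}}{\upsilon^s-\upsilon^{-s}}$ ($m,t\in\mathbb N$), and $U_k(2)=U_{\mathcal Z}(2)\otimes_{\mathcal Z}k$ with $\upsilon\mapsto\varepsilon$. $\tilde u_k(2)$ is the $k$-subalgebra of $U_k(2)$ generated by $E,F,K_1^{\pm1},K_2^{\pm1}$. Let $\Omega_k$ be the $U_k(2)$-module with basis $\omega_1,\omega_2$ and $K_a\omega_b=\varepsilon^{\delta_{a,b}}\omega_b$, $E\omega_2=\omega_1$, $E\omega_1=0$, $F\omega_1=\omega_2$, $F\omega_2=0$. Via $\Delta$ one gets $\zeta_r:U_k(2)\to\mathrm{End}(\Omega_k^{\otimes r})$. The little $q$-Schur algebra is $u_k(2,r)=\zeta_r(\tilde u_k(2))$, and the infinitesimal $q$-Schur algebra $s_k(2,r)$ is the subalgebra of $\zeta_r(U_k(2))$ generated by $u_k(2,r)$ and all $\zeta_r(\left[{K_i;0\atop t}\right])$, $i=1,2$, $t\in\mathbb N$. Weights and simple modules. $P(D)=\mathbb N^2$ (with $0\in\mathbb N$), $P_1(D)=\{\lambda\in\mathbb N^2\mid 0\leq\lambda_1-\lambda_2\leq l-1,\ 0\leq\lambda_2\leq l-1\}$, $\Gamma_1^r(D)=\{\lambda\in P_1(D)+lP(D)\mid\lambda_1+\lambda_2=r\}$. For $\lambda\in\Gamma_1^r(D)$, $\widehat L_1(\lambda)$ is the simple $s_k(2,r)$-module of highest weight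 $\lambda$ (generated by a nonzero vector $v$ with $Ev=0$, $K_iv=\varepsilon^{\lambda_i}v$ and $\left[{K_i;0\atop t}\right]v=\left[{\lambda_i\atop t}\right]_\varepsilon v$, the Gaussian binomial evaluated at $\upsilon=\varepsilon$); these form a complete set of non-isomorphic simple $s_k(2,r)$-modules. $\widehat{\mathfrak B}_1^r(\lambda)$ is the block of $s_k(2,r)$ containing $\widehat L_1(\lambda)$. Steinberg weights: $\mathrm{St}=\{\lambda\in\Gamma_1^r(D)\mid\lambda_1-\lambda_2+1=ml\text{ for some }m\in\mathbb Z\}$. A Steinberg block is a block $\widehat{\mathfrak B}_1^r(\lambda)$ with $\lambda\in\mathrm{St}$ (such blocks are semisimple). $\boldsymbol{\mathcal I}=\{(\frac{r+i}2,\frac{r-i}2)\mid 0\leq i\leq l-2,\ i<2l-r-2,\ r-i\geq0\text{ is even}\}$. *)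

theory Defs
  imports
    "Jordan_Normal_Form.Matrix"
    "HOL-Algebra.Generated_Groups"
    "HOL-Algebra.Generated_Rings"
    "HOL-Algebra.QuotRing"
    "HOL-Library.Poly_Mapping"
    "HOL-Computational_Algebra.Fraction_Field"
    "HOL-Computational_Algebra.Polynomial"
begin

section \<open>Monoid algebras\<close>

text \<open>
  The algebra of finite formal sums of elements of a monoid. It serves twice: for the free
  algebra (monoid of words) and for the base change of an algebra along a ring homomorphism.
\<close>

definition monoid_algebra :: "('m, 'b) monoid_scheme \<Rightarrow> ('m \<Rightarrow>\<^sub>0 'c::comm_ring_1) ring" where
  "monoid_algebra M = \<lparr>
     carrier = {p. Poly_Mapping.keys p \<subseteq> carrier M},
     mult = (\<lambda>p q. \<Sum>a\<in>Poly_Mapping.keys p. \<Sum>b\<in>Poly_Mapping.keys q.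
               Poly_Mapping.single (a \<otimes>\<^bsub>M\<^esub> b) (Poly_Mapping.lookup p a * Poly_Mapping.lookup q b)),
     one = Poly_Mapping.single \<one>\<^bsub>M\<^esub> 1,
     zero = 0,
     add = (+)\<rparr>"

text \<open>It is a ring, so that the ideals and quotients formed below are the intended ones.\<close>

lemma monoid_algebra_mult_eq:
  fixes p q :: "'m \<Rightarrow>\<^sub>0 'c::comm_ring_1"
  assumes "finite S" "Poly_Mapping.keys p \<subseteq> S" "finite T" "Poly_Mapping.keys q \<subseteq> T"
  shows "p \<otimes>\<^bsub>monoid_algebra M\<^esub> q = (\<Sum>a\<in>S. \<Sum>b\<in>T.
           Poly_Mapping.single (a \<otimes>\<^bsub>M\<^esub> b) (Poly_Mapping.lookup p a * Poly_Mapping.lookup q b))"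
proof -
  have "p \<otimes>\<^bsub>monoid_algebra M\<^esub> q = (\<Sum>a\<in>Poly_Mapping.keys p. \<Sum>b\<in>T.
           Poly_Mapping.single (a \<otimes>\<^bsub>M\<^esub> b) (Poly_Mapping.lookup p a * Poly_Mapping.lookup q b))"
    unfolding monoid_algebra_def monoid.simps
    by (intro sum.cong refl sum.mono_neutral_left) (use assms in \<open>auto simp: in_keys_iff\<close>)
  also have "\<dots> = (\<Sum>a\<in>S. \<Sum>b\<in>T.
           Poly_Mapping.single (a \<otimes>\<^bsub>M\<^esub> b) (Poly_Mapping.lookup p a * Poly_Mapping.lookup q b))"
    by (intro sum.mono_neutral_left) (use assms in \<open>auto simp: in_keys_iff\<close>)
  finally show ?thesis .
qed

lemma monoid_algebra_mult_single:
  "Poly_Mapping.single a c \<otimes>\<^bsub>monoid_algebra M\<^esub> Poly_Mapping.single b d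
     = Poly_Mapping.single (a \<otimes>\<^bsub>M\<^esub> b) (c * d :: 'c::comm_ring_1)"
  by (subst monoid_algebra_mult_eq[of "{a}" _ "{b}"]) auto

lemma monoid_algebra_distrib:
  fixes p q s :: "'m \<Rightarrow>\<^sub>0 'c::comm_ring_1"
  shows "(p + q) \<otimes>\<^bsub>monoid_algebra M\<^esub> s
            = p \<otimes>\<^bsub>monoid_algebra M\<^esub> s + q \<otimes>\<^bsub>monoid_algebra M\<^esub> s"
    and "s \<otimes>\<^bsub>monoid_algebra M\<^esub> (p + q)
            = s \<otimes>\<^bsub>monoid_algebra M\<^esub> p + s \<otimes>\<^bsub>monoid_algebra M\<^esub> q"
proof -
  let ?S = "Poly_Mapping.keys p \<union> Poly_Mapping.keys q" and ?T = "Poly_Mapping.keys s"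
  have k: "Poly_Mapping.keys (p + q) \<subseteq> ?S" by (rule Poly_Mapping.keys_add)
  show "(p + q) \<otimes>\<^bsub>monoid_algebra M\<^esub> s
          = p \<otimes>\<^bsub>monoid_algebra M\<^esub> s + q \<otimes>\<^bsub>monoid_algebra M\<^esub> s"
    using k by (subst (1 2 3) monoid_algebra_mult_eq[of ?S _ ?T])
      (auto simp: lookup_add single_add algebra_simps sum.distrib)
  show "s \<otimes>\<^bsub>monoid_algebra M\<^esub> (p + q)
          = s \<otimes>\<^bsub>monoid_algebra M\<^esub> p + s \<otimes>\<^bsub>monoid_algebra M\<^esub> q"
    using k by (subst (1 2 3) monoid_algebra_mult_eq[of ?T _ ?S])
      (auto simp: lookup_add single_add algebra_simps sum.distrib)
qed

lemma monoid_algebra_sum: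
  fixes f :: "'i \<Rightarrow> ('m \<Rightarrow>\<^sub>0 'c::comm_ring_1)"
  shows "sum f I \<otimes>\<^bsub>monoid_algebra M\<^esub> s = (\<Sum>i\<in>I. f i \<otimes>\<^bsub>monoid_algebra M\<^esub> s)"
    and "s \<otimes>\<^bsub>monoid_algebra M\<^esub> sum f I = (\<Sum>i\<in>I. s \<otimes>\<^bsub>monoid_algebra M\<^esub> f i)"
proof -
  have z: "0 \<otimes>\<^bsub>monoid_algebra M\<^esub> s = 0" "s \<otimes>\<^bsub>monoid_algebra M\<^esub> 0 = 0"
    by (simp_all add: monoid_algebra_def)
  show "sum f I \<otimes>\<^bsub>monoid_algebra M\<^esub> s = (\<Sum>i\<in>I. f i \<otimes>\<^bsub>monoid_algebra M\<^esub> s)"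
    by (induction I rule: infinite_finite_induct) (simp_all add: z monoid_algebra_distrib)
  show "s \<otimes>\<^bsub>monoid_algebra M\<^esub> sum f I = (\<Sum>i\<in>I. s \<otimes>\<^bsub>monoid_algebra M\<^esub> f i)"
    by (induction I rule: infinite_finite_induct) (simp_all add: z monoid_algebra_distrib)
qed

lemma poly_mapping_sum_single:
  fixes p :: "'m \<Rightarrow>\<^sub>0 'c::comm_ring_1"
  shows "p = (\<Sum>a\<in>Poly_Mapping.keys p. Poly_Mapping.single a (Poly_Mapping.lookup p a))"
  by (rule poly_mapping_eqI)
    (auto simp: lookup_sum lookup_single when_def in_keys_iff sum.delta' cong: if_cong)

lemma (in monoid) monoid_algebra_ring:
  "ring (monoid_algebra G :: ('a \<Rightarrow>\<^sub>0 'c::comm_ring_1) ring)"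
proof -
  let ?A = "monoid_algebra G :: ('a \<Rightarrow>\<^sub>0 'c) ring"
  have car: "p \<in> carrier ?A \<longleftrightarrow> Poly_Mapping.keys p \<subseteq> carrier G" for p
    by (simp add: monoid_algebra_def)
  have add[simp]: "p \<oplus>\<^bsub>?A\<^esub> q = p + q" for p q by (simp add: monoid_algebra_def)
  have zero[simp]: "\<zero>\<^bsub>?A\<^esub> = 0" by (simp add: monoid_algebra_def)
  have one: "\<one>\<^bsub>?A\<^esub> = Poly_Mapping.single \<one> 1" by (simp add: monoid_algebra_def)
  have csum: "sum f I \<in> carrier ?A" if "\<And>i. i \<in> I \<Longrightarrow> f i \<in> carrier ?A" for f and I :: "'a set"
    using that
    by (induction I rule: infinite_finite_induct)
       (auto simp: car dest!: set_mp[OF Poly_Mapping.keys_add])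
  have mclosed: "p \<otimes>\<^bsub>?A\<^esub> q \<in> carrier ?A" if "p \<in> carrier ?A" "q \<in> carrier ?A" for p q
    unfolding monoid_algebra_mult_eq[OF finite_keys order_refl finite_keys order_refl]
    by (intro csum) (use that in \<open>auto simp: car\<close>)
  have assoc: "(p \<otimes>\<^bsub>?A\<^esub> q) \<otimes>\<^bsub>?A\<^esub> s = p \<otimes>\<^bsub>?A\<^esub> (q \<otimes>\<^bsub>?A\<^esub> s)"
    if "p \<in> carrier ?A" "q \<in> carrier ?A" "s \<in> carrier ?A" for p q s
    using that unfolding car
    by (subst (1 2) poly_mapping_sum_single[of p], subst (1 2) poly_mapping_sum_single[of q],
        subst (1 2) poly_mapping_sum_single[of s])
       (auto simp: monoid_algebra_sum monoid_algebra_mult_single subset_iff m_assoc mult.assoc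
             intro!: sum.cong)
  have unit: "\<one>\<^bsub>?A\<^esub> \<otimes>\<^bsub>?A\<^esub> p = p" "p \<otimes>\<^bsub>?A\<^esub> \<one>\<^bsub>?A\<^esub> = p"
    if "p \<in> carrier ?A" for p
  proof -
    have "\<one>\<^bsub>?A\<^esub> \<otimes>\<^bsub>?A\<^esub> p
        = (\<Sum>a\<in>Poly_Mapping.keys p. Poly_Mapping.single a (Poly_Mapping.lookup p a))"
      using that unfolding car one
      by (subst (1) poly_mapping_sum_single[of p])
         (auto simp: monoid_algebra_sum monoid_algebra_mult_single subset_iff intro!: sum.cong)
    then show "\<one>\<^bsub>?A\<^esub> \<otimes>\<^bsub>?A\<^esub> p = p" using poly_mapping_sum_single[of p] by simp
    have "p \<otimes>\<^bsub>?A\<^esub> \<one>\<^bsub>?A\<^esub>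
        = (\<Sum>a\<in>Poly_Mapping.keys p. Poly_Mapping.single a (Poly_Mapping.lookup p a))"
      using that unfolding car one
      by (subst (1) poly_mapping_sum_single[of p])
         (auto simp: monoid_algebra_sum monoid_algebra_mult_single subset_iff intro!: sum.cong)
    then show "p \<otimes>\<^bsub>?A\<^esub> \<one>\<^bsub>?A\<^esub> = p" using poly_mapping_sum_single[of p] by simp
  qed
  have neg: "\<exists>q\<in>carrier ?A. q + p = 0" if "p \<in> carrier ?A" for p
    by (rule bexI[of _ "- p"]) (use that in \<open>auto simp: car in_keys_iff subset_iff\<close>)
  show ?thesis
    by (rule ringI[OF abelian_groupI monoidI])
       (use neg mclosed in \<open>auto simp: assoc unit unit[unfolded one car] monoid_algebra_distrib add.assoc add.commute car
          one dest!: set_mp[OF Poly_Mapping.keys_add]\<close>)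
qed

section \<open>The ground rings\<close>

type_synonym qv = "rat poly fract"

definition upsilon :: qv ("\<upsilon>") where
  "\<upsilon> = Fract [:0, 1:] 1"

text \<open>
  \<open>laurent_eval x p n\<close> is the value at \<open>x\<close> of the integral Laurent polynomial \<open>p(X) / X\<^sup>n\<close>;
  every integral Laurent polynomial has this form.
\<close>

definition laurent_eval :: "'c::field \<Rightarrow> int poly \<Rightarrow> nat \<Rightarrow> 'c" where
  "laurent_eval x p n = poly (map_poly of_int p) x / x ^ n"

definition ZZ :: "qv set" ("\<Z>") where
  "\<Z> = {laurent_eval \<upsilon> p n | p n. True}"

text \<open>The ring homomorphism from \<open>\<int>[\<upsilon>, \<upsilon>\<^sup>-\<^sup>1]\<close> to \<open>k\<close> sending \<open>\<upsilon>\<close> to \<open>\<epsilon> \<noteq> 0\<close>.\<close>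

definition spec :: "'k::field \<Rightarrow> qv \<Rightarrow> 'k" where
  "spec \<epsilon> z = (THE c. \<exists>p n. z = laurent_eval \<upsilon> p n \<and> c = laurent_eval \<epsilon> p n)"

definition qint :: "nat \<Rightarrow> qv" where
  "qint i = (\<upsilon> powi int i - \<upsilon> powi (- int i)) / (\<upsilon> - \<upsilon> powi (-1))"

definition qfact :: "nat \<Rightarrow> qv" where
  "qfact m = (\<Prod>i=1..m. qint i)"

definition qbinom :: "nat \<Rightarrow> nat \<Rightarrow> qv" where
  "qbinom c t = (\<Prod>s=1..t. (\<upsilon> powi (int c - int s + 1) - \<upsilon> powi (- (int c - int s + 1)))
                           / (\<upsilon> powi int s - \<upsilon> powi (- int s)))"

definition primitive_root_of_unity :: "nat \<Rightarrow> 'k::field \<Rightarrow> bool" where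
  "primitive_root_of_unity l \<epsilon> \<longleftrightarrow> l > 0 \<and> \<epsilon> ^ l = 1 \<and> (\<forall>m. 0 < m \<and> m < l \<longrightarrow> \<epsilon> ^ m \<noteq> 1)"

section \<open>The quantum enveloping algebra of \<open>gl\<^sub>2\<close>\<close>

datatype idx = I1 | I2

datatype gen = GE | GF | GK idx | GKi idx  \<comment> \<open>\<open>E\<close>, \<open>F\<close>, \<open>K\<^sub>i\<close>, \<open>K\<^sub>i\<^sup>-\<^sup>1\<close>\<close>

definition words :: "gen list monoid" where
  "words = \<lparr>carrier = UNIV, mult = (@), one = []\<rparr>"

lemma monoid_words: "monoid words"
  by unfold_locales (auto simp: words_def)

abbreviation free_alg :: "(gen list \<Rightarrow>\<^sub>0 qv) ring" where
  "free_alg \<equiv> monoid_algebra words"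

abbreviation wd :: "gen list \<Rightarrow> (gen list \<Rightarrow>\<^sub>0 qv)" where
  "wd w \<equiv> Poly_Mapping.single w 1"

abbreviation cwd :: "qv \<Rightarrow> gen list \<Rightarrow> (gen list \<Rightarrow>\<^sub>0 qv)" where
  "cwd c w \<equiv> Poly_Mapping.single w c"

text \<open>The elements \<open>lhs - rhs\<close> for the defining relations \<open>lhs = rhs\<close>.\<close>

definition U_relations :: "(gen list \<Rightarrow>\<^sub>0 qv) set" where
  "U_relations =
     {wd [GK I1, GK I2] - wd [GK I2, GK I1]}
   \<union> (\<Union>i. {wd [GK i, GKi i] - wd [], wd [GKi i, GK i] - wd []})
   \<union> {wd [GK I1, GE] - cwd \<upsilon> [GE, GK I1],
      wd [GK I2, GE] - cwd (\<upsilon> powi (-1)) [GE, GK I2],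
      wd [GK I1, GF] - cwd (\<upsilon> powi (-1)) [GF, GK I1],
      wd [GK I2, GF] - cwd \<upsilon> [GF, GK I2]}
   \<union> {wd [GE, GF] - wd [GF, GE]
       - (cwd (1 / (\<upsilon> - \<upsilon> powi (-1))) [GK I1, GKi I2]
          - cwd (1 / (\<upsilon> - \<upsilon> powi (-1))) [GK I2, GKi I1])}"

type_synonym U_elem = "(gen list \<Rightarrow>\<^sub>0 qv) set"

definition U_ideal :: U_elem where
  "U_ideal = genideal free_alg U_relations"

definition U :: "U_elem ring" where
  "U = free_alg Quot U_ideal"

definition U_scal :: "qv \<Rightarrow> U_elem" where
  "U_scal c = U_ideal +>\<^bsub>free_alg\<^esub> cwd c []"

definition U_gen :: "gen \<Rightarrow> U_elem" where
  "U_gen g = U_ideal +>\<^bsub>free_alg\<^esub> wd [g]"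

definition U_divpow :: "gen \<Rightarrow> nat \<Rightarrow> U_elem" where
  "U_divpow g m = U_scal (1 / qfact m) \<otimes>\<^bsub>U\<^esub> (U_gen g [^]\<^bsub>U\<^esub> m)"

text \<open>The element \<open>[K\<^sub>i; 0 / t]\<close>; the factor with index \<open>s = t + 1\<close> is split off.\<close>

primrec U_Kbinom :: "idx \<Rightarrow> nat \<Rightarrow> U_elem" where
  "U_Kbinom i 0 = \<one>\<^bsub>U\<^esub>"
| "U_Kbinom i (Suc t) = U_Kbinom i t \<otimes>\<^bsub>U\<^esub>
     (U_scal (1 / (\<upsilon> powi int (Suc t) - \<upsilon> powi (- int (Suc t)))) \<otimes>\<^bsub>U\<^esub>
       (U_scal (\<upsilon> powi (- int t)) \<otimes>\<^bsub>U\<^esub> U_gen (GK i)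
         \<ominus>\<^bsub>U\<^esub> U_scal (\<upsilon> powi int t) \<otimes>\<^bsub>U\<^esub> U_gen (GKi i)))"

definition UZ :: "U_elem set" where
  "UZ = generate_ring U
     (U_scal ` \<Z>
      \<union> {U_divpow GE m | m. True} \<union> {U_divpow GF m | m. True}
      \<union> {U_gen (GK i) | i. True} \<union> {U_gen (GKi i) | i. True}
      \<union> {U_Kbinom i t | i t. True})"

section \<open>Base change to \<open>k\<close>\<close>

text \<open>
  \<open>U\<^sub>k = U\<^sub>\<Z> \<otimes>\<^sub>\<Z> k\<close> is the \<open>k\<close>-space of formal sums of symbols \<open>u \<otimes> c\<close>, which are additive in \<open>c\<close>,
  modulo additivity in \<open>u\<close> and \<open>z u \<otimes> c = u \<otimes> z(\<epsilon>) c\<close>. The span of these relations is an ideal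
  of the monoid algebra of the multiplicative monoid of \<open>U\<^sub>\<Z>\<close>.
\<close>

abbreviation UZ_alg :: "(U_elem \<Rightarrow>\<^sub>0 'k::field) ring" where
  "UZ_alg \<equiv> monoid_algebra (U\<lparr>carrier := UZ\<rparr>)"

definition Uk_relations :: "'k::field \<Rightarrow> (U_elem \<Rightarrow>\<^sub>0 'k) set" where
  "Uk_relations \<epsilon> =
     {Poly_Mapping.single (u \<oplus>\<^bsub>U\<^esub> u') 1 - Poly_Mapping.single u 1 - Poly_Mapping.single u' 1
        | u u'. u \<in> UZ \<and> u' \<in> UZ}
   \<union> {Poly_Mapping.single (U_scal z \<otimes>\<^bsub>U\<^esub> u) 1 - Poly_Mapping.single u (spec \<epsilon> z)
        | z u. z \<in> \<Z> \<and> u \<in> UZ}"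

type_synonym 'k Uk_elem = "(U_elem \<Rightarrow>\<^sub>0 'k) set"

definition Uk_ideal :: "'k::field \<Rightarrow> 'k Uk_elem" where
  "Uk_ideal \<epsilon> = genideal UZ_alg (Uk_relations \<epsilon>)"

definition Uk :: "'k::field \<Rightarrow> 'k Uk_elem ring" where
  "Uk \<epsilon> = UZ_alg Quot Uk_ideal \<epsilon>"

definition Uk_tensor :: "'k::field \<Rightarrow> U_elem \<Rightarrow> 'k \<Rightarrow> 'k Uk_elem" where
  "Uk_tensor \<epsilon> u c = Uk_ideal \<epsilon> +>\<^bsub>UZ_alg\<^esub> Poly_Mapping.single u c"

text \<open>The \<open>k\<close>-subalgebra generated by \<open>E\<close>, \<open>F\<close>, \<open>K\<^sub>1\<^sup>\<plusminus>\<^sup>1\<close>, \<open>K\<^sub>2\<^sup>\<plusminus>\<^sup>1\<close>.\<close>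

definition Uk_small :: "'k::field \<Rightarrow> 'k Uk_elem set" where
  "Uk_small \<epsilon> = generate_ring (Uk \<epsilon>)
     ({Uk_tensor \<epsilon> \<one>\<^bsub>U\<^esub> c | c. True} \<union> {Uk_tensor \<epsilon> (U_gen g) 1 | g. True})"

section \<open>The representation on the tensor space\<close>

text \<open>
  The action of the generators on the natural module over \<open>\<rat>(\<upsilon>)\<close> with basis \<open>\<omega>\<^sub>1, \<omega>\<^sub>2\<close>.
\<close>

fun Omega :: "gen \<Rightarrow> qv mat" where
  "Omega GE = mat_of_rows_list 2 [[0, 1], [0, 0]]"
| "Omega GF = mat_of_rows_list 2 [[0, 0], [1, 0]]"
| "Omega (GK I1) = mat_of_rows_list 2 [[\<upsilon>, 0], [0, 1]]"
| "Omega (GK I2) = mat_of_rows_list 2 [[1, 0], [0, \<upsilon>]]"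
| "Omega (GKi I1) = mat_of_rows_list 2 [[\<upsilon> powi (-1), 0], [0, 1]]"
| "Omega (GKi I2) = mat_of_rows_list 2 [[1, 0], [0, \<upsilon> powi (-1)]]"

definition word_mat :: "nat \<Rightarrow> (gen \<Rightarrow> qv mat) \<Rightarrow> gen list \<Rightarrow> qv mat" where
  "word_mat d \<rho> w = foldr (\<lambda>g A. \<rho> g * A) w (1\<^sub>m d)"

text \<open>The matrix of \<open>A \<otimes> B\<close> in the lexicographically ordered product basis.\<close>

definition kron :: "'c::semiring_1 mat \<Rightarrow> 'c mat \<Rightarrow> 'c mat" where
  "kron A B = mat (dim_row A * dim_row B) (dim_col A * dim_col B)
     (\<lambda>(i, j). A $$ (i div dim_row B, j div dim_col B) * B $$ (i mod dim_row B, j mod dim_col B))"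

text \<open>The comultiplication on generators, as a list of the summands \<open>a \<otimes> b\<close>, with \<open>a\<close>, \<open>b\<close> words.\<close>

fun Delta :: "gen \<Rightarrow> (gen list \<times> gen list) list" where
  "Delta GE = [([GE], [GK I1, GKi I2]), ([], [GE])]"
| "Delta GF = [([GF], []), ([GK I2, GKi I1], [GF])]"
| "Delta (GK i) = [([GK i], [GK i])]"
| "Delta (GKi i) = [([GKi i], [GKi i])]"

text \<open>
  The action of the generators on the \<open>r\<close>-th tensor power. The case \<open>r = 0\<close> (the counit) only
  serves to start the recursion.
\<close>

primrec tensor_rep :: "nat \<Rightarrow> gen \<Rightarrow> qv mat" where
  "tensor_rep 0 g = (case g of GE \<Rightarrow> 0\<^sub>m 1 1 | GF \<Rightarrow> 0\<^sub>m 1 1 | GK i \<Rightarrow> 1\<^sub>m 1 | GKi i \<Rightarrow> 1\<^sub>m 1)"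
| "tensor_rep (Suc r) g =
     foldr (\<lambda>(a, b) S. kron (word_mat (2 ^ r) (tensor_rep r) a) (word_mat 2 Omega b) + S)
       (Delta g) (0\<^sub>m (2 ^ Suc r) (2 ^ Suc r))"

definition zeta_free :: "nat \<Rightarrow> (gen list \<Rightarrow>\<^sub>0 qv) \<Rightarrow> qv mat" where
  "zeta_free r p = mat (2 ^ r) (2 ^ r)
     (\<lambda>ij. \<Sum>w\<in>Poly_Mapping.keys p. Poly_Mapping.lookup p w * word_mat (2 ^ r) (tensor_rep r) w $$ ij)"

definition zeta_U :: "nat \<Rightarrow> U_elem \<Rightarrow> qv mat" where
  "zeta_U r X = the_elem (zeta_free r ` X)"

text \<open>
  The action of \<open>U\<^sub>\<Z>\<close> on the tensor space stabilises the \<open>\<Z>\<close>-lattice spanned by the product basis;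
  \<open>\<zeta>\<^sub>r\<close> is obtained from the action on this lattice by base change. This is what specifies the
  action on \<open>\<Omega>\<^sub>k\<^sup>\<otimes>\<^sup>r\<close> of those divided powers and \<open>[K\<^sub>i; 0 / t]\<close> that are not polynomials in
  \<open>E\<close>, \<open>F\<close>, \<open>K\<^sub>i\<close> over \<open>k\<close>.
\<close>

definition zeta_UZ :: "'k::field \<Rightarrow> nat \<Rightarrow> (U_elem \<Rightarrow>\<^sub>0 'k) \<Rightarrow> 'k mat" where
  "zeta_UZ \<epsilon> r p = mat (2 ^ r) (2 ^ r)
     (\<lambda>ij. \<Sum>u\<in>Poly_Mapping.keys p. Poly_Mapping.lookup p u * spec \<epsilon> (zeta_U r u $$ ij))"

definition zeta :: "'k::field \<Rightarrow> nat \<Rightarrow> 'k Uk_elem \<Rightarrow> 'k mat" where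
  "zeta \<epsilon> r X = the_elem (zeta_UZ \<epsilon> r ` X)"

definition zeta_gen :: "'k::field \<Rightarrow> nat \<Rightarrow> gen \<Rightarrow> 'k mat" where
  "zeta_gen \<epsilon> r g = zeta \<epsilon> r (Uk_tensor \<epsilon> (U_gen g) 1)"

definition zeta_Kbinom :: "'k::field \<Rightarrow> nat \<Rightarrow> idx \<Rightarrow> nat \<Rightarrow> 'k mat" where
  "zeta_Kbinom \<epsilon> r i t = zeta \<epsilon> r (Uk_tensor \<epsilon> (U_Kbinom i t) 1)"

section \<open>Little and infinitesimal \<open>q\<close>-Schur algebras\<close>

definition little_schur :: "'k::field \<Rightarrow> nat \<Rightarrow> 'k mat set" where
  "little_schur \<epsilon> r = zeta \<epsilon> r ` Uk_small \<epsilon>"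

text \<open>As \<open>little_schur\<close> contains the scalars, the subring generated here is a \<open>k\<close>-subalgebra.\<close>

definition inf_schur :: "'k::field \<Rightarrow> nat \<Rightarrow> 'k mat ring" where
  "inf_schur \<epsilon> r = (ring_mat TYPE('k) (2 ^ r) ())
     \<lparr>carrier := generate_ring (ring_mat TYPE('k) (2 ^ r) ())
        (little_schur \<epsilon> r \<union> {zeta_Kbinom \<epsilon> r i t | i t. True})\<rparr>"

section \<open>Blocks and semisimplicity\<close>

text \<open>The blocks of \<open>A\<close> are its ideals \<open>eA\<close> with \<open>e\<close> a primitive central idempotent.\<close>

definition central_idempotent :: "('a, 'b) ring_scheme \<Rightarrow> 'a \<Rightarrow> bool" where
  "central_idempotent A e \<longleftrightarrow> e \<in> carrier A \<and> e \<otimes>\<^bsub>A\<^esub> e = e \<and>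
     (\<forall>a\<in>carrier A. e \<otimes>\<^bsub>A\<^esub> a = a \<otimes>\<^bsub>A\<^esub> e)"

definition block_idempotent :: "('a, 'b) ring_scheme \<Rightarrow> 'a \<Rightarrow> bool" where
  "block_idempotent A e \<longleftrightarrow> central_idempotent A e \<and> e \<noteq> \<zero>\<^bsub>A\<^esub> \<and>
     (\<forall>f. central_idempotent A f \<and> e \<otimes>\<^bsub>A\<^esub> f = f \<longrightarrow> f = \<zero>\<^bsub>A\<^esub> \<or> f = e)"

definition is_block :: "('a, 'b) ring_scheme \<Rightarrow> 'a set \<Rightarrow> bool" where
  "is_block A B \<longleftrightarrow> (\<exists>e. block_idempotent A e \<and> B = (\<lambda>a. e \<otimes>\<^bsub>A\<^esub> a) ` carrier A)"

definition left_ideal :: "'a set \<Rightarrow> ('a, 'b) ring_scheme \<Rightarrow> bool" where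
  "left_ideal J R \<longleftrightarrow> additive_subgroup J R \<and> (\<forall>a\<in>carrier R. \<forall>x\<in>J. a \<otimes>\<^bsub>R\<^esub> x \<in> J)"

definition minimal_left_ideal :: "'a set \<Rightarrow> ('a, 'b) ring_scheme \<Rightarrow> bool" where
  "minimal_left_ideal J R \<longleftrightarrow> left_ideal J R \<and> J \<noteq> {\<zero>\<^bsub>R\<^esub>} \<and>
     (\<forall>J'. left_ideal J' R \<and> J' \<subseteq> J \<longrightarrow> J' = {\<zero>\<^bsub>R\<^esub>} \<or> J' = J)"

text \<open>The left regular module is the sum of its simple submodules.\<close>

definition semisimple_ring :: "('a, 'b) ring_scheme \<Rightarrow> bool" where
  "semisimple_ring R \<longleftrightarrow> generate (add_monoid R) (\<Union>{J. minimal_left_ideal J R}) = carrier R"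

definition semisimple_block :: "('a, 'b) ring_scheme \<Rightarrow> 'a set \<Rightarrow> bool" where
  "semisimple_block A B \<longleftrightarrow>
     (\<exists>e. block_idempotent A e \<and> B = (\<lambda>a. e \<otimes>\<^bsub>A\<^esub> a) ` carrier A
          \<and> semisimple_ring (A\<lparr>carrier := B, one := e\<rparr>))"

section \<open>Simple modules\<close>

text \<open>
  Modules are given as matrix representations. This is no restriction for simple modules, as
  \<open>inf_schur \<epsilon> r\<close> is finite-dimensional.
\<close>

definition is_rep :: "'k::field \<Rightarrow> nat \<Rightarrow> nat \<Rightarrow> ('k mat \<Rightarrow> 'k mat) \<Rightarrow> bool" where
  "is_rep \<epsilon> r n \<rho> \<longleftrightarrow> \<rho> \<in> ring_hom (inf_schur \<epsilon> r) (ring_mat TYPE('k) n ()) \<and>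
     (\<forall>c. \<rho> (c \<cdot>\<^sub>m 1\<^sub>m (2 ^ r)) = c \<cdot>\<^sub>m 1\<^sub>m n)"

text \<open>Closure under scalars is included, since \<open>inf_schur \<epsilon> r\<close> contains the scalar matrices.\<close>

definition submodule_of_rep ::
  "'k::field \<Rightarrow> nat \<Rightarrow> nat \<Rightarrow> ('k mat \<Rightarrow> 'k mat) \<Rightarrow> 'k vec set \<Rightarrow> bool" where
  "submodule_of_rep \<epsilon> r n \<rho> W \<longleftrightarrow> W \<subseteq> carrier_vec n \<and> 0\<^sub>v n \<in> W \<and>
     (\<forall>x\<in>W. \<forall>y\<in>W. x + y \<in> W) \<and>
     (\<forall>a\<in>carrier (inf_schur \<epsilon> r). \<forall>x\<in>W. \<rho> a *\<^sub>v x \<in> W)"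

definition simple_rep :: "'k::field \<Rightarrow> nat \<Rightarrow> nat \<Rightarrow> ('k mat \<Rightarrow> 'k mat) \<Rightarrow> bool" where
  "simple_rep \<epsilon> r n \<rho> \<longleftrightarrow> is_rep \<epsilon> r n \<rho> \<and> n > 0 \<and>
     (\<forall>W. submodule_of_rep \<epsilon> r n \<rho> W \<longrightarrow> W = {0\<^sub>v n} \<or> W = carrier_vec n)"

type_synonym weight = "nat \<times> nat"

fun weight_comp :: "weight \<Rightarrow> idx \<Rightarrow> nat" where
  "weight_comp (a, b) I1 = a"
| "weight_comp (a, b) I2 = b"

definition highest_weight_vector ::
  "'k::field \<Rightarrow> nat \<Rightarrow> weight \<Rightarrow> nat \<Rightarrow> ('k mat \<Rightarrow> 'k mat) \<Rightarrow> 'k vec \<Rightarrow> bool" where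
  "highest_weight_vector \<epsilon> r \<mu> n \<rho> v \<longleftrightarrow> v \<in> carrier_vec n \<and> v \<noteq> 0\<^sub>v n \<and>
     \<rho> (zeta_gen \<epsilon> r GE) *\<^sub>v v = 0\<^sub>v n \<and>
     (\<forall>i. \<rho> (zeta_gen \<epsilon> r (GK i)) *\<^sub>v v = \<epsilon> ^ weight_comp \<mu> i \<cdot>\<^sub>v v) \<and>
     (\<forall>i t. \<rho> (zeta_Kbinom \<epsilon> r i t) *\<^sub>v v = spec \<epsilon> (qbinom (weight_comp \<mu> i) t) \<cdot>\<^sub>v v)"

text \<open>\<open>(n, \<rho>)\<close> is a matrix form of the simple module of highest weight \<open>\<mu>\<close>.\<close>

definition is_L1hat :: "'k::field \<Rightarrow> nat \<Rightarrow> weight \<Rightarrow> nat \<Rightarrow> ('k mat \<Rightarrow> 'k mat) \<Rightarrow> bool" where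
  "is_L1hat \<epsilon> r \<mu> n \<rho> \<longleftrightarrow> simple_rep \<epsilon> r n \<rho> \<and>
     (\<exists>v. highest_weight_vector \<epsilon> r \<mu> n \<rho> v \<and>
          carrier_vec n = {\<rho> a *\<^sub>v v | a. a \<in> carrier (inf_schur \<epsilon> r)})"

text \<open>A module belongs to the block \<open>eA\<close> if \<open>e\<close> acts on it as the identity.\<close>

definition rep_in_block ::
  "'k::field \<Rightarrow> nat \<Rightarrow> nat \<Rightarrow> ('k mat \<Rightarrow> 'k mat) \<Rightarrow> 'k mat set \<Rightarrow> bool" where
  "rep_in_block \<epsilon> r n \<rho> B \<longleftrightarrow>
     (\<exists>e. block_idempotent (inf_schur \<epsilon> r) e \<and>
          B = (\<lambda>a. e \<otimes>\<^bsub>inf_schur \<epsilon> r\<^esub> a) ` carrier (inf_schur \<epsilon> r) \<and> \<rho> e = 1\<^sub>m n)"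

definition block_of :: "'k::field \<Rightarrow> nat \<Rightarrow> weight \<Rightarrow> 'k mat set" where
  "block_of \<epsilon> r \<mu> = (THE B. \<exists>n \<rho>. is_L1hat \<epsilon> r \<mu> n \<rho> \<and> rep_in_block \<epsilon> r n \<rho> B)"

section \<open>Weights\<close>

definition P1 :: "nat \<Rightarrow> weight set" where
  "P1 l = {(a, b). b \<le> a \<and> a - b \<le> l - 1 \<and> b \<le> l - 1}"

definition Gamma1 :: "nat \<Rightarrow> nat \<Rightarrow> weight set" where
  "Gamma1 l r = {(a + l * c, b + l * d) | a b c d. (a, b) \<in> P1 l \<and> (a + l * c) + (b + l * d) = r}"

definition Steinberg_weights :: "nat \<Rightarrow> nat \<Rightarrow> weight set" where
  "Steinberg_weights l r = {\<mu> \<in> Gamma1 l r. \<exists>m::int. int (fst \<mu>) - int (snd \<mu>) + 1 = m * int l}"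

definition Steinberg_block :: "'k::field \<Rightarrow> nat \<Rightarrow> nat \<Rightarrow> 'k mat set \<Rightarrow> bool" where
  "Steinberg_block \<epsilon> l r B \<longleftrightarrow> (\<exists>\<mu>\<in>Steinberg_weights l r. B = block_of \<epsilon> r \<mu>)"

definition I_weights :: "nat \<Rightarrow> nat \<Rightarrow> weight set" where
  "I_weights l r = {((r + i) div 2, (r - i) div 2) | i.
     i \<le> l - 2 \<and> int i < 2 * int l - int r - 2 \<and> i \<le> r \<and> even (r - i)}"

end

theory Submission
  imports Defs
begin

text \<open>
  On tensor space the infinitesimal \<open>q\<close>-Schur algebra is the algebra \<open>A\<close> of operators generated by \<open>E\<close>, \<open>F\<close>
  and the projections \<open>P\<^sub>m\<close> onto the weight spaces. A central idempotent \<open>e\<close> satisfies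
  \<open>e P\<^sub>m \<in> k P\<^sub>m + F A E\<close>, so it acts on all highest weight vectors of weight \<open>m\<close> by one scalar, and blocks
  correspond to classes of highest weights.

  Let \<open>\<lambda> = (a, b)\<close> with \<open>b \<le> a \<le> l - 2\<close>. All quantum integers up to \<open>a + 1\<close> are invertible, so the
  extremal projector \<open>z = P\<^sub>a + \<dots>\<close>, with \<open>E z = 0 = z F\<close>, is defined in \<open>A\<close>. Then \<open>A z\<close> is simple, and a
  combination of the \<open>F\<^sup>i z E\<^sup>i\<close> is a primitive central idempotent whose block is a matrix algebra
  with \<open>\<lambda>\<close> as its only highest weight.

  For any other non-Steinberg weight, the block contains a weight vector \<open>w\<close> of a Weyl module, twisted by a
  power of the determinant, such that some nonzero image \<open>T w\<close> lies in a submodule avoiding \<open>w\<close>. In a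
  semisimple block \<open>w\<close> could be recovered from \<open>T w\<close>.
\<close>

section \<open>Operators with weight projections\<close>

text \<open>The bound \<open>a \<le> l - 2\<close> has two faces. It keeps all quantum integers in
  the denominators of \<open>z\<close> below index \<open>l\<close>; and it says that the mirror
  image \<open>(b + l - 1, a + 1 - l)\<close> of \<open>(a, b)\<close> in the Steinberg wall is no
  weight, having a negative entry. As soon as the mirror image exists, its Weyl module links the two
  weights, and this is the source of non-semisimplicity for
  \<open>l - 1 \<le> a \<le> b + l - 2\<close>. Two obstacles shape the development.
  \<open>inf_schur\<close> is given by quotient rings, \<open>the_elem\<close> and the
  specialisation of a lattice, so nothing can be read off before the defining relations, the
  integrality of divided powers and binomials, and the independence of \<open>spec\<close> of
  representatives are settled. And \<open>block_of\<close> is a definite description over simple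
  modules, which says nothing until a simple module of the given highest weight is constructed; it
  is found inside the tensor space as a span of vectors \<open>F^i x\<close>. The scalar argument
  for central idempotents is therefore carried out both for tensor vectors and for abstract
  representations.\<close>

definition qbr :: "'k::field \<Rightarrow> int \<Rightarrow> 'k" where
  "qbr q k = (q powi k - q powi (- k)) / (q - inverse q)"

lemma qbr_0 [simp]: "qbr q 0 = 0"
  by (simp add: qbr_def)

lemma qbr_1:
  assumes "q \<noteq> 0" "q * q \<noteq> 1"
  shows "qbr q 1 = 1"
proof -
  have "q \<noteq> inverse q" using assms by (auto simp: field_simps)
  then show ?thesis by (simp add: qbr_def power_int_minus)
qed

lemma qbr_minus: "qbr q (- k) = - qbr q k"
  by (simp add: qbr_def minus_divide_left)

lemma qbr_Suc:
  assumes "q \<noteq> 0" "q * q \<noteq> 1"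
  shows "qbr q (m + 1) = q * qbr q m + q powi (- m)"
    and "qbr q (m + 1) = inverse q * qbr q m + q powi m"
proof -
  define x where "x = q powi m"
  have x: "x \<noteq> 0" using assms by (simp add: x_def)
  have d: "q - inverse q \<noteq> 0" using assms by (auto simp: field_simps)
  have e: "q powi (m + 1) = x * q" "q powi m = x" "q powi (- m) = inverse x"
    "q powi (- (m + 1)) = inverse x * inverse q"
    using assms by (simp_all add: x_def power_int_add power_int_minus power_int_diff field_simps)
  have 1: "x * q - inverse x * inverse q = q * (x - inverse x) + inverse x * (q - inverse q)"
    and 2: "x * q - inverse x * inverse q = inverse q * (x - inverse x) + x * (q - inverse q)"
    by (simp_all add: algebra_simps)
  show "qbr q (m + 1) = q * qbr q m + q powi (- m)"
    unfolding qbr_def e 1 using d by (simp add: add_divide_distrib)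
  show "qbr q (m + 1) = inverse q * qbr q m + q powi m"
    unfolding qbr_def e 2 using d by (simp add: add_divide_distrib)
qed

text \<open>With \<open>h\<close> the sl2-weight, this is the bookkeeping for carrying
  \<open>E\<close> past one more \<open>F\<close>: the coefficient \<open>[i][h - i + 1]\<close> has
  been collected from \<open>i\<close> factors, and the next factor contributes
  \<open>[h - 2i]\<close>.\<close>

lemma qbr_step:
  assumes "q \<noteq> 0" "q * q \<noteq> 1"
  shows "qbr q i * qbr q (h - i + 1) + qbr q (h - 2 * i) = qbr q (i + 1) * qbr q (h - i)"
proof -
  define x y where "x = q powi i" and "y = q powi h"
  have x: "x \<noteq> 0" "y \<noteq> 0" using assms by (simp_all add: x_def y_def)
  have d: "q * q - 1 \<noteq> 0" "q - inverse q \<noteq> 0" using assms by (auto simp: field_simps)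
  have p: "q powi (a + b) = q powi a * q powi b" "q powi (- a) = inverse (q powi a)" for a b
    using assms by (simp_all add: power_int_add power_int_minus)
  have e: "q powi i = x" "q powi (- i) = inverse x" "q powi (h - i + 1) = y * inverse x * q"
    "q powi (- (h - i + 1)) = inverse y * x * inverse q" "q powi (h - 2 * i) = y * (inverse x * inverse x)"
    "q powi (- (h - 2 * i)) = inverse y * (x * x)" "q powi (i + 1) = x * q" "q powi (- (i + 1)) = inverse x * inverse q"
    "q powi (h - i) = y * inverse x" "q powi (- (h - i)) = inverse y * x"
    using p(1)[of h "- i"] p(1)[of "h + - i" 1] p(1)[of "- h" "i"] p(1)[of "- h + i" "- 1"] p(1)[of i 1] p(1)[of "- i" "- 1"]
      p(1)[of h "- i + - i"] p(1)[of "- i" "- i"] p(1)[of "- h" "i + i"] p(1)[of i i] p(2)[of h] p(2)[of i] p(2)[of 1]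
    by (simp_all add: x_def y_def)
  have id: "(x - inverse x) * (y * inverse x * q - inverse y * x * inverse q)
      + (y * (inverse x * inverse x) - inverse y * (x * x)) * (q - inverse q)
    = (x * q - inverse x * inverse q) * (y * inverse x - inverse y * x)"
    by (simp add: algebra_simps)
  have div: "a / D * (b / D) + c / D = f / D * (g / D)" if "a * b + c * D = f * g" "D \<noteq> 0" for a b c f g D :: 'a
    using that by (simp add: add_divide_distrib[symmetric] divide_simps)
  show ?thesis
    unfolding qbr_def e by (rule div[OF id d(2)])
qed

text \<open>The idempotented form of quantum \<open>gl_2\<close> in degree \<open>r\<close>: the
  projection \<open>P m\<close> onto the weight \<open>(m, r - m)\<close> takes the place of
  \<open>K_1\<close> and \<open>K_2\<close>, which at a root of unity would not separate the
  weights. The number \<open>2 * m - int r\<close> is the sl2-weight. Scalars enter through the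
  central homomorphism \<open>sc\<close>, since the ring is a mere \<open>ring_1\<close>
  type.\<close>

locale weight_algebra =
  fixes sc :: "'k::field \<Rightarrow> 'a::ring_1" and E F :: 'a and P :: "int \<Rightarrow> 'a" and q :: 'k and r :: nat
  assumes sc_add: "sc (a + b) = sc a + sc b"
    and sc_mult: "sc (a * b) = sc a * sc b"
    and sc_1: "sc 1 = 1"
    and sc_comm: "x * sc c = sc c * x"
    and q0: "q \<noteq> 0" and q2: "q * q \<noteq> 1"
    and P_mult: "P m * P n = (if m = n then P m else 0)"
    and P_out: "m < 0 \<or> m > int r \<Longrightarrow> P m = 0"
    and P_sum: "(\<Sum>m\<in>{0..int r}. P m) = 1"
    and E_P: "E * P m = P (m + 1) * E"
    and F_P: "F * P m = P (m - 1) * F"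
    and E_F: "E * F * P m = F * E * P m + sc (qbr q (2 * m - int r)) * P m"
begin

abbreviation br :: "int \<Rightarrow> 'k" where "br \<equiv> qbr q"

lemmas br_step = qbr_step[OF q0 q2]

lemma sc_0: "sc 0 = 0"
  using sc_add[of 0 0] by simp

lemma sc_minus: "sc (- a) = - sc a"
  using sc_add[of a "- a"] sc_0 by (simp add: eq_neg_iff_add_eq_0 add.commute)

lemma sc_eq_0: "sc c * x = 0 \<longleftrightarrow> c = 0 \<or> x = 0"
proof
  assume a: "sc c * x = 0"
  show "c = 0 \<or> x = 0"
  proof (rule disjCI)
    assume "x \<noteq> 0"
    show "c = 0"
    proof (rule ccontr)
      assume "c \<noteq> 0"
      then have "sc (inverse c) * (sc c * x) = x"
        by (simp add: mult.assoc[symmetric] sc_mult[symmetric] sc_1)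
      then show False using a \<open>x \<noteq> 0\<close> by simp
    qed
  qed
qed (auto simp: sc_0)

lemma sc_inverse: "c \<noteq> 0 \<Longrightarrow> sc (inverse c) * (sc c * x) = x"
  by (simp add: mult.assoc[symmetric] sc_mult[symmetric] sc_1)

lemma sc_left_comm: "x * (sc c * y) = sc c * (x * y)"
  by (metis mult.assoc sc_comm)

lemma P_P_left: "P m * (P n * x) = (if m = n then P m * x else 0)"
  by (simp add: mult.assoc[symmetric] P_mult)

section \<open>Commutation of powers of \<open>E\<close>, \<open>F\<close> and weight
  projections\<close>

lemma E_pow_P: "E ^ j * P m = P (m + int j) * E ^ j"
  by (induction j arbitrary: m) (simp_all add: mult.assoc E_P power_Suc2 del: power_Suc,
    metis (no_types, opaque_lifting) add.assoc add.commute mult.assoc)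

lemma F_pow_P: "F ^ j * P m = P (m - int j) * F ^ j"
proof (induction j arbitrary: m)
  case (Suc j)
  have "F ^ Suc j * P m = F ^ j * P (m - 1) * F" by (simp only: power_Suc2 mult.assoc F_P)
  also have "\<dots> = P (m - int (Suc j)) * F ^ Suc j"
    by (simp add: Suc power_Suc2 mult.assoc algebra_simps del: power_Suc)
  finally show ?case .
qed simp

lemma E_F_pow:
  "E * F ^ Suc i * P m = F ^ Suc i * E * P m + sc (br (int i + 1) * br (2 * m - int r - int i)) * F ^ i * P m"
proof (induction i)
  case 0
  show ?case using E_F[of m] by (simp add: qbr_1[OF q0 q2])
next
  case (Suc i)
  let ?h = "2 * m - int r"
  have "E * F ^ Suc (Suc i) * P m = (E * F * P (m - int (Suc i))) * F ^ Suc i"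
    by (simp only: power_Suc[of F "Suc i"] mult.assoc F_pow_P)
  also have "\<dots> = F * (E * F ^ Suc i * P m) + sc (br (?h - 2 * (int i + 1))) * F ^ Suc i * P m"
    unfolding E_F by (simp only: distrib_right mult.assoc F_pow_P) (simp add: algebra_simps)
  also have "F * (E * F ^ Suc i * P m) = F ^ Suc (Suc i) * E * P m
      + sc (br (int i + 1) * br (?h - int i)) * F ^ Suc i * P m"
    unfolding Suc by (simp add: distrib_left mult.assoc sc_left_comm)
  finally show ?case
    using br_step(1)[of "int i + 1" ?h]
    by (simp add: add.assoc mult.assoc flip: distrib_right sc_add) (simp add: algebra_simps)
qed

lemma E_pow_F:
  "E ^ Suc i * F * P m = F * E ^ Suc i * P m + sc (br (int i + 1) * br (2 * m - int r + int i)) * E ^ i * P m"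
proof (induction i)
  case 0
  show ?case using E_F[of m] by (simp add: qbr_1[OF q0 q2])
next
  case (Suc i)
  let ?h = "2 * m - int r"
  \<comment> \<open>The identity \<open>br_step\<close> at the weight \<open>-h\<close>, turned
    around by the oddness of \<open>qbr\<close>.\<close>
  have s: "br (int i + 1) * br (?h + int i) + br (?h + 2 * (int i + 1)) = br (int i + 2) * br (?h + int i + 1)"
  proof -
    have "- (br (int i + 1) * br (- (?h + int i))) - br (- (?h + 2 * (int i + 1))) = - (br (int i + 2) * br (- (?h + int i + 1)))"
      using br_step(1)[of "int i + 1" "- ?h"] by (simp add: algebra_simps)
    then show ?thesis unfolding qbr_minus by simp
  qed
  have "E ^ Suc (Suc i) * F * P m = E * (E ^ Suc i * F * P m)"
    by (simp only: power_Suc[of E "Suc i"] mult.assoc)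
  also have "\<dots> = E * F * P (m + int (Suc i)) * E ^ Suc i + sc (br (int i + 1) * br (?h + int i)) * E ^ Suc i * P m"
    unfolding Suc by (simp only: distrib_left mult.assoc E_pow_P[symmetric]) (simp add: sc_left_comm mult.assoc)
  also have "E * F * P (m + int (Suc i)) * E ^ Suc i = F * E ^ Suc (Suc i) * P m + sc (br (?h + 2 * (int i + 1))) * E ^ Suc i * P m"
    unfolding E_F by (simp only: distrib_right mult.assoc E_pow_P[symmetric] power_Suc[of E "Suc i"])
      (simp add: algebra_simps)
  finally show ?case
    using s
    by (simp add: add.assoc mult.assoc flip: distrib_right sc_add) (simp add: algebra_simps)
qed

section \<open>The generated algebra and its weight components\<close>

inductive_set A :: "'a set" where
  A_sc: "sc c \<in> A"
| A_E: "E \<in> A"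
| A_F: "F \<in> A"
| A_P: "P m \<in> A"
| A_add: "x \<in> A \<Longrightarrow> y \<in> A \<Longrightarrow> x + y \<in> A"
| A_mult: "x \<in> A \<Longrightarrow> y \<in> A \<Longrightarrow> x * y \<in> A"

lemma A_0: "0 \<in> A" and A_1: "1 \<in> A"
  using A_sc[of 0] A_sc[of 1] by (simp_all add: sc_0 sc_1)

lemma A_minus: "x \<in> A \<Longrightarrow> - x \<in> A"
  using A_mult[OF A_sc[of "-1"], of x] by (simp add: sc_minus sc_1)

lemma A_diff: "x \<in> A \<Longrightarrow> y \<in> A \<Longrightarrow> x - y \<in> A"
  using A_add[OF _ A_minus, of x y] by simp

lemma A_pow: "x \<in> A \<Longrightarrow> x ^ n \<in> A"
  by (induction n) (auto simp: A_1 A_mult)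

lemma A_sum: "(\<And>i. i \<in> I \<Longrightarrow> f i \<in> A) \<Longrightarrow> sum f I \<in> A"
  by (induction I rule: infinite_finite_induct) (auto simp: A_0 A_add)

lemmas A_intros = A_0 A_1 A_sc A_E A_F A_P A_add A_mult A_minus A_diff A_pow A_sum

text \<open>The PBW-type span of the elements \<open>F^i E^j P m\<close>. Closure under left
  multiplication by the generators is enough for it to contain \<open>A\<close>, because it contains
  \<open>1\<close>, the sum of the \<open>P m\<close>.\<close>

inductive_set PB :: "'a set" where
  PB_0: "0 \<in> PB"
| PB_mono: "sc c * (F ^ i * E ^ j * P m) \<in> PB"
| PB_add: "x \<in> PB \<Longrightarrow> y \<in> PB \<Longrightarrow> x + y \<in> PB"

lemma PB_sc: "x \<in> PB \<Longrightarrow> sc c * x \<in> PB"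
  by (induction rule: PB.induct)
     (auto simp: PB_0 distrib_left mult.assoc[symmetric] sc_mult[symmetric] intro: PB_add PB_mono[unfolded mult.assoc[symmetric]])

lemma PB_sum: "(\<And>i. i \<in> I \<Longrightarrow> f i \<in> PB) \<Longrightarrow> sum f I \<in> PB"
  by (induction I rule: infinite_finite_induct) (auto simp: PB_0 PB_add)

lemma PB_F: "x \<in> PB \<Longrightarrow> F * x \<in> PB"
proof (induction rule: PB.induct)
  case (PB_mono c i j m)
  show ?case using PB.PB_mono[of c "Suc i" j m] by (simp add: sc_left_comm mult.assoc)
qed (auto simp: distrib_left PB_0 PB_add)

text \<open>Only an \<open>E\<close> in front of a power of \<open>F\<close> has to be reordered;
  \<open>E_F_pow\<close> does this at the weight \<open>m + j\<close> reached after
  \<open>E ^ j\<close>.\<close>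

lemma PB_E: "x \<in> PB \<Longrightarrow> E * x \<in> PB"
proof (induction rule: PB.induct)
  case (PB_mono c i j m)
  show ?case
  proof (cases i)
    case 0
    then show ?thesis using PB.PB_mono[of c 0 "Suc j" m] by (simp add: sc_left_comm mult.assoc)
  next
    case (Suc k)
    have "E * (sc c * (F ^ i * E ^ j * P m)) = sc c * (E * F ^ Suc k * P (m + int j) * E ^ j)"
      by (simp add: Suc sc_left_comm mult.assoc E_pow_P)
    also have "\<dots> = sc c * (F ^ Suc k * E ^ Suc j * P m)
        + sc c * (sc (br (int k + 1) * br (2 * (m + int j) - int r - int k)) * (F ^ k * E ^ j * P m))"
      unfolding E_F_pow by (simp add: distrib_left distrib_right mult.assoc E_pow_P[symmetric])
    also have "\<dots> \<in> PB"
      by (intro PB_add PB.PB_mono PB_sc)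
    finally show ?thesis .
  qed
qed (auto simp: distrib_left PB_0 PB_add)

lemma PB_P: "x \<in> PB \<Longrightarrow> P n * x \<in> PB"
proof (induction rule: PB.induct)
  case (PB_mono c i j m)
  have "P n * (sc c * (F ^ i * E ^ j * P m)) = sc c * (P n * P (m + int j - int i) * (F ^ i * E ^ j))"
    by (simp add: sc_left_comm mult.assoc E_pow_P) (simp add: mult.assoc[symmetric] F_pow_P)
  also have "\<dots> = (if n = m + int j - int i then sc c * (F ^ i * E ^ j * P m) else 0)"
    by (simp add: P_mult mult.assoc E_pow_P) (simp add: mult.assoc[symmetric] F_pow_P)
  finally show ?case using PB.PB_mono PB_0 by simp
qed (auto simp: distrib_left PB_0 PB_add)

lemma A_PB: assumes "a \<in> A" shows "a \<in> PB"
proof -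
  have "a * x \<in> PB" if "x \<in> PB" for x
    using assms that
    by (induction arbitrary: x rule: A.induct)
       (auto simp: distrib_right mult.assoc intro: PB_sc PB_E PB_F PB_P PB_add)
  moreover have "1 \<in> PB"
    unfolding P_sum[symmetric] using PB_mono[of 1 0 0] by (intro PB_sum) (simp add: sc_1)
  ultimately show ?thesis by fastforce
qed

text \<open>A monomial \<open>F^i E^j P n\<close> survives between two copies of \<open>P m\<close>
  only for \<open>n = m\<close> and \<open>i = j\<close>. For \<open>i = 0\<close> it is a multiple
  of \<open>P m\<close>; otherwise an \<open>F\<close> stands on the left and an \<open>E\<close>
  can be brought to the right.\<close>

lemma A_weight_part:
  assumes "a \<in> A"
  shows "\<exists>c. \<exists>y\<in>A. P m * a * P m = sc c * P m + F * y * E"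
  using A_PB[OF assms]
proof (induction rule: PB.induct)
  case PB_0
  show ?case by (rule exI[of _ 0], rule bexI[of _ 0]) (auto simp: sc_0 A_0)
next
  case (PB_mono c i j n)
  have e: "P m * (sc c * (F ^ i * E ^ j * P n)) * P m = sc c * ((P m * P (n + int j - int i)) * (F ^ i * E ^ j * P m))
     * (if n = m then 1 else 0)"
  proof -
    have "P m * (sc c * (F ^ i * E ^ j * P n)) * P m = sc c * (P m * (F ^ i * E ^ j * (P n * P n * P m)))"
      by (simp add: sc_left_comm mult.assoc P_mult)
    also have "F ^ i * E ^ j * (P n * P n * P m) = F ^ i * (E ^ j * P n) * (P n * P m)"
      by (simp only: mult.assoc)
    also have "\<dots> = (F ^ i * P (n + int j)) * E ^ j * (P n * P m)"
      by (simp only: mult.assoc E_pow_P)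
    also have "\<dots> = P (n + int j - int i) * (F ^ i * E ^ j * (P n * P m))"
      by (simp only: mult.assoc F_pow_P)
    finally show ?thesis by (auto simp: P_mult mult.assoc P_P_left)
  qed
  show ?case
  proof (cases "n = m \<and> i = j")
    case True
    have e2: "P m * (sc c * (F ^ i * E ^ j * P n)) * P m = sc c * (F ^ i * E ^ i * P m)"
      unfolding e using True by (simp add: P_mult mult.assoc E_pow_P) (simp add: mult.assoc[symmetric] F_pow_P P_mult)
    show ?thesis
    proof (cases i)
      case 0
      then show ?thesis unfolding e2 by (intro exI[of _ c] bexI[of _ 0]) (auto simp: A_0)
    next
      case (Suc k)
      have "sc c * (F ^ i * E ^ i * P m) = F * (sc c * F ^ k * E ^ k * P (m + 1)) * E"
        unfolding Suc by (simp add: mult.assoc sc_left_comm E_P[symmetric])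
          (simp add: mult.assoc[symmetric] power_commutes)
      then show ?thesis unfolding e2
        by (intro exI[of _ 0] bexI[of _ "sc c * F ^ k * E ^ k * P (m + 1)"]) (auto simp: sc_0 intro!: A_intros)
    qed
  next
    case False
    then have "P m * (sc c * (F ^ i * E ^ j * P n)) * P m = 0" unfolding e by (auto simp: P_mult)
    then show ?thesis by (intro exI[of _ 0] bexI[of _ 0]) (auto simp: A_0 sc_0)
  qed
next
  case (PB_add x y)
  then obtain c u d v where "u \<in> A" "v \<in> A" "P m * x * P m = sc c * P m + F * u * E" "P m * y * P m = sc d * P m + F * v * E"
    by auto
  then show ?case
    by (intro exI[of _ "c + d"] bexI[of _ "u + v"]) (auto simp: distrib_left distrib_right sc_add A_add)
qed

end

text \<open>The product \<open>[1] ... [i] [h] [h - 1] ... [h - i + 1]\<close>, by which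
  \<open>E^i F^i\<close> acts on a highest weight vector of sl2-weight \<open>h\<close>.\<close>

definition qnorm :: "'k::field \<Rightarrow> nat \<Rightarrow> int \<Rightarrow> 'k" where
  "qnorm q i h = (\<Prod>t<i. qbr q (int t + 1) * qbr q (h - int t))"

lemma qnorm_nonzero:
  assumes "\<And>t. t < i \<Longrightarrow> qbr q (int t + 1) \<noteq> 0" "\<And>t. t < i \<Longrightarrow> qbr q (h - int t) \<noteq> 0"
  shows "qnorm q i h \<noteq> 0"
  using assms by (simp add: qnorm_def)

section \<open>Powers of \<open>E\<close> against powers of \<open>F\<close>, modulo
  \<open>F A E\<close>\<close>

context weight_algebra
begin

text \<open>Instances of \<open>sc_left_comm\<close> that do not permute two scalars, which would loop.\<close>

lemmas sc_left = sc_left_comm[of E] sc_left_comm[of F] sc_left_comm[of "P m" for m]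
  sc_left_comm[of "E ^ i" for i] sc_left_comm[of "F ^ i" for i]

text \<open>There is one \<open>F\<close> more than there are \<open>E\<close>, so that after
  reordering at least one \<open>F\<close> remains on the left.\<close>

lemma E_pow_F_pow_Suc: "\<exists>y\<in>A. E ^ i * F ^ Suc i * P m = F * y"
proof (induction i arbitrary: m)
  case 0
  show ?case by (rule bexI[of _ "P m"]) (auto intro: A_intros)
next
  case (Suc i)
  obtain y where y: "y \<in> A" "E ^ i * F ^ Suc i * P m = F * y" using Suc by blast
  let ?c = "br (int (Suc i) + 1) * br (2 * m - int r - int (Suc i))"
  have "E ^ Suc i * F ^ Suc (Suc i) * P m = E ^ i * (E * F ^ Suc (Suc i) * P m)"
    by (simp only: power_Suc2[of E i] mult.assoc)
  also have "\<dots> = E ^ i * F ^ Suc i * (F * P (m + 1) * E) + sc ?c * (E ^ i * F ^ Suc i * P m)"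
    unfolding E_F_pow by (simp only: distrib_left sc_left mult.assoc power_Suc2 E_P)
  also have "F * P (m + 1) * E = P m * F * E"
    using F_P[of "m + 1"] by simp
  also have "E ^ i * F ^ Suc i * (P m * F * E) = F * (y * F * E)"
    using y by (simp add: mult.assoc[symmetric])
  finally have "E ^ Suc i * F ^ Suc (Suc i) * P m = F * (y * F * E + sc ?c * y)"
    using y by (simp only: distrib_left sc_left)
  then show ?case using y by (intro bexI[of _ "y * F * E + sc ?c * y"]) (auto intro!: A_intros)
qed

text \<open>Each step of \<open>E_F_pow\<close> splits off one factor of \<open>qnorm\<close>. Its
  other term ends with \<open>E\<close> and, having a surplus \<open>F\<close>, starts with
  \<open>F\<close> by \<open>E_pow_F_pow_Suc\<close>.\<close>

lemma E_pow_F_pow: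
  "\<exists>y\<in>A. E ^ i * F ^ i * P m = sc (qnorm q i (2 * m - int r)) * P m + F * y * E"
proof (induction i)
  case 0
  show ?case by (rule bexI[of _ 0]) (auto simp: qnorm_def sc_1 A_0)
next
  case (Suc i)
  obtain y where y: "y \<in> A" "E ^ i * F ^ i * P m = sc (qnorm q i (2 * m - int r)) * P m + F * y * E"
    using Suc by blast
  obtain y' where y': "y' \<in> A" "E ^ i * F ^ Suc i * P (m + 1) = F * y'"
    using E_pow_F_pow_Suc by blast
  let ?c = "br (int i + 1) * br (2 * m - int r - int i)"
  have "E ^ Suc i * F ^ Suc i * P m = E ^ i * (E * F ^ Suc i * P m)"
    by (simp only: power_Suc2[of E i] mult.assoc)
  also have "\<dots> = E ^ i * F ^ Suc i * P (m + 1) * E + sc ?c * (E ^ i * F ^ i * P m)"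
    unfolding E_F_pow by (simp only: distrib_left sc_left mult.assoc E_P)
  also have "\<dots> = sc (qnorm q (Suc i) (2 * m - int r)) * P m + F * (y' + sc ?c * y) * E"
  proof -
    have "qnorm q (Suc i) (2 * m - int r) = ?c * qnorm q i (2 * m - int r)" by (simp add: qnorm_def)
    then show ?thesis
      unfolding y y' sc_mult[of ?c, symmetric] distrib_left distrib_right mult.assoc[symmetric]
      by (simp only: sc_mult[of ?c]) (simp add: distrib_left sc_comm[of F] mult.assoc[symmetric])
  qed
  finally show ?case using y y' by (intro bexI[of _ "y' + sc ?c * y"]) (auto intro!: A_intros)
qed

text \<open>Such a weight supports no highest weight vector.\<close>

lemma P_factor:
  assumes "m \<ge> 0 \<Longrightarrow> qnorm q (nat (m + 1)) (2 * m - int r) \<noteq> 0"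
  shows "\<exists>y\<in>A. P m = F * y * E"
proof (cases "m \<ge> 0")
  case False
  then show ?thesis by (intro bexI[of _ 0]) (auto simp: P_out A_0)
next
  case True
  let ?N = "qnorm q (nat (m + 1)) (2 * m - int r)"
  obtain y where y: "y \<in> A" "E ^ nat (m + 1) * F ^ nat (m + 1) * P m = sc ?N * P m + F * y * E"
    using E_pow_F_pow by blast
  \<comment> \<open>The exponent \<open>m + 1\<close> leads from the weight \<open>m\<close> to
    \<open>-1\<close>, just outside the range, so the scalar part of \<open>E^i F^i P m\<close> has
    to cancel against \<open>F y E\<close>.\<close>
  have "F ^ nat (m + 1) * P m = 0"
    unfolding F_pow_P using True P_out[of "m - int (nat (m + 1))"] by simp
  then have "sc ?N * P m = - (F * y * E)" using y by (simp add: mult.assoc eq_neg_iff_add_eq_0)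
  then have "P m = - (sc (inverse ?N) * (F * y * E))"
    using sc_inverse[OF assms[OF True], of "P m"] by simp
  then have "P m = F * (- (sc (inverse ?N) * y)) * E"
    by (simp add: mult.assoc sc_left)
  then show ?thesis using y by (intro bexI[of _ "- (sc (inverse ?N) * y)"]) (auto intro!: A_intros)
qed

end

section \<open>The extremal projector of an interior weight\<close>

locale interior_weight = weight_algebra sc E F P q r
  for sc :: "'k::field \<Rightarrow> 'a::ring_1" and E F P q r +
  fixes a b :: nat
  assumes r_eq: "r = a + b" and b_le: "b \<le> a"
    and br_nz: "1 \<le> k \<Longrightarrow> k \<le> int a + 1 \<Longrightarrow> qbr q k \<noteq> 0"
begin

abbreviation "s \<equiv> a - b"

text \<open>The solution of the recursion \<open>alpha_Suc\<close> with \<open>alpha 0 = 1\<close>,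
  which makes consecutive terms of \<open>zsum\<close> cancel under \<open>E\<close> from the left
  and under \<open>F\<close> from the right. For indices up to \<open>b\<close> the denominators run
  up to \<open>[s + b + 1] = [a + 1]\<close>.\<close>

definition alpha :: "nat \<Rightarrow> 'k" where
  "alpha j = (\<Prod>t<j. - inverse (br (int t + 1) * br (int s + int t + 2)))"

text \<open>Partial sums, so that the telescoping can be proved by induction. Stopping at
  \<open>b\<close> is right because \<open>E ^ Suc b\<close> raises the weight \<open>a\<close>
  beyond \<open>r\<close>.\<close>

definition zsum :: "nat \<Rightarrow> 'a" where
  "zsum n = (\<Sum>j\<le>n. sc (alpha j) * (F ^ j * E ^ j * P (int a)))"

text \<open>The extremal projector onto the highest weight vectors of weight \<open>a\<close>.\<close>

definition z :: 'a where "z = zsum b"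

lemma alpha_Suc:
  assumes "n < b"
  shows "alpha (Suc n) * (br (int n + 1) * br (int s + int n + 2)) = - alpha n"
proof -
  have "br (int n + 1) \<noteq> 0" "br (int s + int n + 2) \<noteq> 0"
    by (rule br_nz; use assms b_le in simp)+
  then show ?thesis by (simp add: alpha_def field_simps)
qed

text \<open>Telescoping: \<open>E\<close> applied to the term with index \<open>n + 1\<close>
  produces the new last term and cancels the last term left by the previous partial sum.\<close>

lemma E_zsum: "n \<le> b \<Longrightarrow> E * zsum n = sc (alpha n) * (F ^ n * E ^ Suc n * P (int a))"
proof (induction n)
  case 0
  then show ?case by (simp add: zsum_def mult.assoc sc_left)
next
  case (Suc n)
  have "E * zsum (Suc n) = E * zsum n + E * (sc (alpha (Suc n)) * (F ^ Suc n * E ^ Suc n * P (int a)))"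
    unfolding zsum_def sum.atMost_Suc distrib_left ..
  also have "E * (sc (alpha (Suc n)) * (F ^ Suc n * E ^ Suc n * P (int a)))
     = sc (alpha (Suc n)) * ((E * F ^ Suc n * P (int a + int (Suc n))) * E ^ Suc n)"
    by (simp only: sc_left mult.assoc E_pow_P)
  also have "\<dots> = sc (alpha (Suc n)) * (F ^ Suc n * E ^ Suc (Suc n) * P (int a))
     + sc (alpha (Suc n) * (br (int n + 1) * br (2 * (int a + int (Suc n)) - int r - int n))) * (F ^ n * E ^ Suc n * P (int a))"
    unfolding E_F_pow sc_mult[of "alpha (Suc n)"]
    by (simp only: distrib_left distrib_right mult.assoc E_pow_P[symmetric] power_Suc[of E "Suc n"])
  also have "2 * (int a + int (Suc n)) - int r - int n = int s + int n + 2"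
    using r_eq b_le by simp
  also have "alpha (Suc n) * (br (int n + 1) * br (int s + int n + 2)) = - alpha n"
    using Suc.prems by (intro alpha_Suc) auto
  finally show ?case using Suc by (simp add: sc_minus)
qed

lemma zsum_F: "n \<le> b \<Longrightarrow> zsum n * F = sc (alpha n) * (F ^ Suc n * E ^ n * P (int a + 1))"
proof (induction n)
  case 0
  then show ?case using F_P[of "int a + 1"] by (simp add: zsum_def mult.assoc)
next
  case (Suc n)
  have PF: "P (int a) * F = F * P (int a + 1)" using F_P[of "int a + 1"] by simp
  have "zsum (Suc n) * F = zsum n * F + sc (alpha (Suc n)) * (F ^ Suc n * E ^ Suc n * P (int a)) * F"
    unfolding zsum_def sum.atMost_Suc distrib_right ..
  also have "sc (alpha (Suc n)) * (F ^ Suc n * E ^ Suc n * P (int a)) * F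
     = sc (alpha (Suc n)) * (F ^ Suc n * (E ^ Suc n * F * P (int a + 1)))"
    by (simp only: mult.assoc PF)
  also have "\<dots> = sc (alpha (Suc n)) * (F ^ Suc (Suc n) * E ^ Suc n * P (int a + 1))
     + sc (alpha (Suc n) * (br (int n + 1) * br (2 * (int a + 1) - int r + int n))) * (F ^ Suc n * E ^ n * P (int a + 1))"
    unfolding E_pow_F sc_mult[of "alpha (Suc n)"]
    by (simp only: distrib_left mult.assoc power_Suc2[of F "Suc n"] sc_left)
  also have "2 * (int a + 1) - int r + int n = int s + int n + 2"
    using r_eq b_le by simp
  also have "alpha (Suc n) * (br (int n + 1) * br (int s + int n + 2)) = - alpha n"
    using Suc.prems by (intro alpha_Suc) auto
  finally show ?case using Suc by (simp add: sc_minus)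
qed

lemma E_z: "E * z = 0"
proof -
  have "E ^ Suc b * P (int a) = 0"
    unfolding E_pow_P using P_out[of "int a + int (Suc b)"] r_eq by simp
  then show ?thesis unfolding z_def using E_zsum[of b] by (simp only: mult.assoc) simp
qed

lemma z_F: "z * F = 0"
proof -
  have "E ^ b * P (int a + 1) = 0"
    unfolding E_pow_P using P_out[of "int a + 1 + int b"] r_eq by simp
  then show ?thesis unfolding z_def using zsum_F[of b] by (simp only: mult.assoc) simp
qed

lemma z_A: "z \<in> A"
  unfolding z_def zsum_def by (intro A_intros)

lemma P_FE: "P (int a) * (F ^ j * E ^ j * x) = F ^ j * E ^ j * (P (int a) * x)"
proof -
  have "P (int a) * F ^ j = F ^ j * P (int a + int j)" using F_pow_P[of j "int a + int j"] by simp
  then have "P (int a) * (F ^ j * E ^ j * x) = F ^ j * (P (int a + int j) * E ^ j) * x"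
    by (simp only: mult.assoc[symmetric])
  then show ?thesis by (simp only: E_pow_P[symmetric] mult.assoc)
qed

lemma z_P: "z * P (int a) = z" "P (int a) * z = z"
proof -
  show "z * P (int a) = z"
    unfolding z_def zsum_def sum_distrib_right by (simp add: mult.assoc P_mult)
  show "P (int a) * z = z"
    unfolding z_def zsum_def sum_distrib_left sc_left P_FE P_mult by simp
qed

text \<open>This shape makes \<open>z\<close> act as the identity on highest weight vectors of
  weight \<open>a\<close>, and together with \<open>E z = 0\<close> it yields idempotency.\<close>

lemma z_form: "\<exists>y\<in>A. z = P (int a) + F * y * E"
proof -
  have "\<exists>y\<in>A. zsum n = P (int a) + F * y * E" for n
  proof (induction n)
    case 0
    show ?case by (rule bexI[of _ 0]) (auto simp: zsum_def alpha_def sc_1 A_0)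
  next
    case (Suc n)
    then obtain y where y: "y \<in> A" "zsum n = P (int a) + F * y * E" by blast
    have "sc (alpha (Suc n)) * (F ^ Suc n * E ^ Suc n * P (int a))
      = F * (sc (alpha (Suc n)) * F ^ n * E ^ n * P (int a + 1)) * E"
      by (simp only: mult.assoc sc_left_comm E_P[symmetric] power_Suc2[of E n] power_Suc[of F n])
    moreover have "zsum (Suc n) = zsum n + sc (alpha (Suc n)) * (F ^ Suc n * E ^ Suc n * P (int a))"
      unfolding zsum_def sum.atMost_Suc ..
    ultimately have "zsum (Suc n) = P (int a) + F * (y + sc (alpha (Suc n)) * F ^ n * E ^ n * P (int a + 1)) * E"
      by (simp only: y distrib_left distrib_right add.assoc)
    then show ?case using y
      by (intro bexI[of _ "y + sc (alpha (Suc n)) * F ^ n * E ^ n * P (int a + 1)"]) (auto intro!: A_intros)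
  qed
  then show ?thesis unfolding z_def .
qed

lemma z_idem: "z * z = z"
proof -
  obtain y where "z = P (int a) + F * y * E" using z_form by blast
  then have "z * z = P (int a) * z + F * y * (E * z)" by (metis distrib_right mult.assoc)
  then show ?thesis by (simp add: E_z z_P)
qed

lemma z_left: "z * (P (int a) * x) = z * x" "P (int a) * (z * x) = z * x"
    "z * (z * x) = z * x" "z * (F * x) = 0" "E * (z * x) = 0"
  by (simp_all add: mult.assoc[symmetric] z_P z_idem z_F E_z)

lemmas z_simps = z_left z_P z_idem z_F E_z

text \<open>The part \<open>F y E\<close> in \<open>A_weight_part\<close> dies between two copies of
  \<open>z\<close>, since \<open>z F = 0 = E z\<close>; only the scalar part is left.\<close>

lemma z_A_z:
  assumes "x \<in> A"
  shows "\<exists>c. z * x * z = sc c * z"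
proof -
  obtain c y where y: "P (int a) * x * P (int a) = sc c * P (int a) + F * y * E"
    using A_weight_part[OF assms] by blast
  have "z * x * z = z * (P (int a) * x * P (int a)) * z"
    by (simp only: mult.assoc z_simps)
  also have "\<dots> = sc c * z * P (int a) * z + (z * F) * y * (E * z)"
    unfolding y by (simp only: distrib_left distrib_right mult.assoc sc_left sc_left_comm[of z])
  also have "\<dots> = sc c * z" by (simp only: mult.assoc z_simps mult_zero_left mult_zero_right add_0_right)
  finally show ?thesis by blast
qed

section \<open>The finite ladders \<open>F^i z\<close> and \<open>z E^i\<close>\<close>

lemma z_E_pow_F: "z * E ^ Suc i * F = sc (br (int i + 1) * br (int s - int i)) * (z * E ^ i)"
proof -
  have PE: "P (int a) * E ^ Suc i * F = E ^ Suc i * F * P (int a - int i)"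
  proof -
    have "E ^ Suc i * F * P (int a - int i) = E ^ Suc i * P (int a - int (Suc i)) * F"
      using F_P[of "int a - int i"] by (simp only: mult.assoc) (simp add: algebra_simps)
    then show ?thesis unfolding E_pow_P by simp
  qed
  have PE': "P (int a) * E ^ i = E ^ i * P (int a - int i)"
    using E_pow_P[of "i" "int a - int i"] by simp
  have "z * E ^ Suc i * F = z * (P (int a) * E ^ Suc i * F)"
    by (simp only: mult.assoc z_simps)
  also have "\<dots> = z * F * E ^ Suc i * P (int a - int i)
      + sc (br (int i + 1) * br (2 * (int a - int i) - int r + int i)) * (z * (E ^ i * P (int a - int i)))"
    unfolding PE E_pow_F by (simp only: distrib_left mult.assoc sc_left sc_left_comm[of z])
  also have "2 * (int a - int i) - int r + int i = int s - int i" using r_eq b_le by simp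
  also have "z * (E ^ i * P (int a - int i)) = z * E ^ i"
    unfolding PE'[symmetric] by (simp add: mult.assoc[symmetric] z_P)
  finally show ?thesis by (simp add: z_F)
qed

lemma E_F_pow_z: "E * F ^ Suc i * z = sc (br (int i + 1) * br (int s - int i)) * (F ^ i * z)"
proof -
  have "E * F ^ Suc i * z = E * F ^ Suc i * P (int a) * z"
    by (simp only: mult.assoc z_simps)
  also have "\<dots> = F ^ Suc i * (E * z) + sc (br (int i + 1) * br (2 * int a - int r - int i)) * (F ^ i * z)"
    unfolding E_F_pow by (simp only: distrib_right mult.assoc z_simps)
  also have "2 * int a - int r - int i = int s - int i" using r_eq b_le by simp
  finally show ?thesis by (simp add: E_z)
qed

text \<open>At the weight \<open>b - 1\<close> the sl2-weight is \<open>-(s + 2)\<close>, so the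
  second factors of \<open>qnorm\<close> are \<open>[-(s + 2 + t)]\<close> with
  \<open>t < b\<close>; once more no index beyond \<open>a + 1\<close> occurs.\<close>

lemma P_below: "\<exists>y\<in>A. P (int b - 1) = F * y * E"
proof (rule P_factor)
  assume "0 \<le> int b - 1"
  have "qnorm q b (2 * (int b - 1) - int r) \<noteq> 0"
  proof (rule qnorm_nonzero)
    fix t assume "t < b"
    then show "br (int t + 1) \<noteq> 0" using b_le by (intro br_nz) linarith+
    have "br (int s + 2 + int t) \<noteq> 0" using \<open>t < b\<close> b_le by (intro br_nz) linarith+
    then have "br (- (int s + 2 + int t)) \<noteq> 0" by (simp only: qbr_minus) simp
    also have "- (int s + 2 + int t) = 2 * (int b - 1) - int r - int t" using r_eq b_le by simp
    finally show "br (2 * (int b - 1) - int r - int t) \<noteq> 0" .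
  qed
  then show "qnorm q (nat (int b - 1 + 1)) (2 * (int b - 1) - int r) \<noteq> 0" by simp
qed

text \<open>The element \<open>F ^ Suc s * z\<close> has weight \<open>b - 1\<close> and is killed
  by \<open>E\<close>, since its coefficient contains \<open>[s - s] = 0\<close>; by
  \<open>P_below\<close> that weight leaves no room for such an element.\<close>

lemma F_pow_z_0: "F ^ Suc s * z = 0"
proof -
  obtain y where y: "P (int b - 1) = F * y * E" using P_below by blast
  have "F ^ Suc s * z = F ^ Suc s * P (int a) * z" by (simp add: mult.assoc z_P)
  also have "\<dots> = P (int b - 1) * (F ^ Suc s * z)"
    unfolding F_pow_P using b_le by (simp add: of_nat_diff algebra_simps)
  also have "\<dots> = F * y * (E * F ^ Suc s * z)" unfolding y by (simp add: mult.assoc)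
  also have "\<dots> = 0" unfolding E_F_pow_z by (simp add: sc_0)
  finally show ?thesis .
qed

lemma z_E_pow_0: "z * E ^ Suc s = 0"
proof -
  obtain y where y: "P (int b - 1) = F * y * E" using P_below by blast
  have "z * E ^ Suc s = z * (P (int a) * E ^ Suc s)" by (simp add: mult.assoc[symmetric] z_P)
  also have "P (int a) * E ^ Suc s = E ^ Suc s * P (int b - 1)"
    unfolding E_pow_P using b_le by (simp add: of_nat_diff algebra_simps)
  also have "z * (E ^ Suc s * P (int b - 1)) = (z * E ^ Suc s * F) * y * E" unfolding y by (simp add: mult.assoc)
  also have "\<dots> = 0" unfolding z_E_pow_F by (simp add: sc_0)
  finally show ?thesis .
qed

section \<open>The primitive central idempotent built from \<open>z\<close>\<close>

definition nu :: "nat \<Rightarrow> 'k" where "nu i = inverse (qnorm q i (int s))"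

text \<open>The summands are the diagonal matrix units belonging to the ladder \<open>F^i z\<close>
  with \<open>i \<le> s\<close>; the factor \<open>nu i\<close> inverts the scalar by which
  \<open>E^i F^i\<close> acts on \<open>z\<close>.\<close>

definition e :: 'a where "e = (\<Sum>i\<le>s. sc (nu i) * (F ^ i * z * E ^ i))"

lemma nu_Suc: "i < s \<Longrightarrow> nu (Suc i) * (br (int i + 1) * br (int s - int i)) = nu i"
proof -
  assume "i < s"
  then have "br (int i + 1) * br (int s - int i) \<noteq> 0" by (intro no_zero_divisors br_nz) linarith+
  then show ?thesis by (simp add: nu_def qnorm_def field_simps)
qed

lemma e_A: "e \<in> A"
  unfolding e_def by (intro A_intros z_A)

text \<open>The two sides differ by an index shift: \<open>nu_Suc\<close> absorbs the coefficient of
  \<open>z_E_pow_F\<close>, and the terms at the two ends vanish by \<open>F_pow_z_0\<close> and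
  \<open>z F = 0\<close>.\<close>

lemma F_e: "F * e = e * F"
proof -
  have "F * e = (\<Sum>i\<le>s. sc (nu i) * (F ^ Suc i * z * E ^ i))"
    unfolding e_def sum_distrib_left by (simp add: sc_left sc_left_comm[of z] mult.assoc)
  also have "\<dots> = (\<Sum>i<s. sc (nu i) * (F ^ Suc i * z * E ^ i))"
    using F_pow_z_0 by (simp add: lessThan_Suc_atMost[symmetric])
  also have "\<dots> = (\<Sum>i<s. sc (nu (Suc i)) * (F ^ Suc i * (z * E ^ Suc i * F)))"
  proof (rule sum.cong)
    fix i assume "i \<in> {..<s}"
    then have "sc (nu i) = sc (nu (Suc i)) * sc (br (int i + 1) * br (int s - int i))"
      by (simp only: sc_mult[symmetric] nu_Suc lessThan_iff)
    then show "sc (nu i) * (F ^ Suc i * z * E ^ i) = sc (nu (Suc i)) * (F ^ Suc i * (z * E ^ Suc i * F))"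
      unfolding z_E_pow_F by (simp only: mult.assoc sc_left sc_left_comm[of z])
  qed simp
  also have "\<dots> = (\<Sum>i\<le>s. sc (nu i) * (F ^ i * (z * E ^ i * F)))"
    by (simp add: lessThan_Suc_atMost[symmetric] sum.lessThan_Suc_shift z_F del: sum.lessThan_Suc power_Suc)
  also have "\<dots> = e * F"
    unfolding e_def sum_distrib_right by (simp add: mult.assoc)
  finally show ?thesis .
qed

lemma E_e: "E * e = e * E"
proof -
  have "e * E = (\<Sum>i\<le>s. sc (nu i) * (F ^ i * (z * E ^ Suc i)))"
    unfolding e_def sum_distrib_right by (simp only: power_Suc2 mult.assoc)
  also have "\<dots> = (\<Sum>i<s. sc (nu i) * (F ^ i * (z * E ^ Suc i)))"
    using z_E_pow_0 by (simp add: lessThan_Suc_atMost[symmetric] del: power_Suc)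
  also have "\<dots> = (\<Sum>i<s. sc (nu (Suc i)) * ((E * F ^ Suc i * z) * E ^ Suc i))"
  proof (rule sum.cong)
    fix i assume "i \<in> {..<s}"
    then have "sc (nu i) = sc (nu (Suc i)) * sc (br (int i + 1) * br (int s - int i))"
      by (simp only: sc_mult[symmetric] nu_Suc lessThan_iff)
    then show "sc (nu i) * (F ^ i * (z * E ^ Suc i)) = sc (nu (Suc i)) * ((E * F ^ Suc i * z) * E ^ Suc i)"
      unfolding E_F_pow_z by (simp only: mult.assoc sc_left sc_left_comm[of z])
  qed simp
  also have "\<dots> = (\<Sum>i\<le>s. sc (nu i) * ((E * F ^ i * z) * E ^ i))"
    by (simp add: lessThan_Suc_atMost[symmetric] sum.lessThan_Suc_shift E_z del: sum.lessThan_Suc power_Suc)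
  also have "\<dots> = E * e"
    unfolding e_def sum_distrib_left by (simp only: mult.assoc sc_left sc_left_comm[of z])
  finally show ?thesis by simp
qed

lemma P_e: "P m * e = e * P m"
proof -
  have "P m * (F ^ i * z * E ^ i) = F ^ i * z * E ^ i * P m" for i
  proof -
    have "P m * F ^ i = F ^ i * P (m + int i)" using F_pow_P[of i "m + int i"] by simp
    then have "P m * (F ^ i * z * E ^ i) = F ^ i * (P (m + int i) * P (int a)) * z * E ^ i"
      by (simp only: mult.assoc z_simps) (simp only: mult.assoc[symmetric])
    also have "\<dots> = F ^ i * z * (P (int a) * P (m + int i)) * E ^ i"
      by (cases "m + int i = int a") (simp_all add: P_mult mult.assoc z_simps)
    also have "\<dots> = F ^ i * z * E ^ i * P m"
      by (simp only: mult.assoc E_pow_P[symmetric] z_simps)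
    finally show ?thesis .
  qed
  then show ?thesis unfolding e_def by (simp add: sum_distrib_left sum_distrib_right sc_left sc_left_comm[of z] mult.assoc)
qed

lemma e_central: "x \<in> A \<Longrightarrow> e * x = x * e"
proof (induction rule: A.induct)
  case (A_mult x y)
  then show ?case by (metis mult.assoc)
qed (auto simp: distrib_left distrib_right F_e E_e P_e sc_comm[of e])

lemma e_z: "e * z = z"
proof -
  have "E ^ Suc i * z = 0" for i by (simp only: power_Suc2 mult.assoc E_z) simp
  then have "e * z = (\<Sum>i\<le>s. if i = 0 then z else 0)"
    unfolding e_def sum_distrib_right
    by (intro sum.cong) (auto simp: mult.assoc z_idem nu_def qnorm_def sc_1 gr0_conv_Suc simp del: power_Suc)
  then show ?thesis by simp
qed

text \<open>Centrality reduces the claim to \<open>e_z\<close>: each summand starts with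
  \<open>F^i z\<close>, and \<open>e F^i z = F^i e z = F^i z\<close>.\<close>

lemma e_idem: "e * e = e"
proof -
  have "e * (sc (nu i) * (F ^ i * z * E ^ i)) = sc (nu i) * (F ^ i * z * E ^ i)" for i
  proof -
    have "e * (sc (nu i) * (F ^ i * z * E ^ i)) = sc (nu i) * (e * F ^ i * z * E ^ i)"
      by (simp only: sc_left_comm[of e] mult.assoc)
    also have "e * F ^ i * z = F ^ i * (e * z)"
      using e_central[of "F ^ i"] by (simp add: A_intros mult.assoc[symmetric])
    finally show ?thesis by (simp add: e_z)
  qed
  then show ?thesis by (subst (2) e_def, subst (2) e_def) (simp add: sum_distrib_left)
qed

text \<open>Expanding \<open>x z = e x z\<close> gives a combination of terms
  \<open>F^i (z E^i x z)\<close>. One of the brackets is nonzero, and by \<open>z_A_z\<close> it is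
  an invertible multiple of \<open>z\<close>.\<close>

lemma z_simple_module:
  assumes x: "x \<in> A" and nz: "x * z \<noteq> 0"
  shows "\<exists>y\<in>A. y * x * z = z"
proof -
  have "x * z = e * (x * z)"
    using e_central[OF x] e_z by (simp add: mult.assoc[symmetric]) (simp add: mult.assoc)
  also have "\<dots> = (\<Sum>i\<le>s. sc (nu i) * (F ^ i * (z * (E ^ i * x) * z)))"
    unfolding e_def sum_distrib_right by (simp add: mult.assoc)
  finally obtain i where "z * (E ^ i * x) * z \<noteq> 0"
    using nz by (metis (no_types, lifting) mult_zero_right sum.neutral)
  moreover obtain c where "z * (E ^ i * x) * z = sc c * z"
    using z_A_z[of "E ^ i * x"] x by (auto intro: A_intros)
  moreover from calculation have "c \<noteq> 0" by (auto simp: sc_0)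
  ultimately have "sc (inverse c) * (z * (E ^ i * x) * z) = z"
    by (simp add: sc_inverse)
  then show ?thesis using x z_A
    by (intro bexI[of _ "sc (inverse c) * z * E ^ i"]) (auto simp: mult.assoc intro!: A_intros)
qed

text \<open>By \<open>z_A_z\<close> a central idempotent acts on \<open>z\<close> through one
  scalar, which must be 0 or 1; centrality carries the scalar along the ladder to all of
  \<open>e\<close>.\<close>

lemma e_primitive:
  assumes f: "f \<in> A" "f * f = f" "\<And>x. x \<in> A \<Longrightarrow> f * x = x * f" "e * f = f"
  shows "f = 0 \<or> f = e"
proof (cases "z = 0")
  case True
  then show ?thesis using f(4) by (simp add: e_def)
next
  case False
  obtain c where c: "z * f * z = sc c * z" using z_A_z[OF f(1)] by blast
  have fz: "f * z = sc c * z"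
    using c f(3)[OF z_A] by (simp add: mult.assoc z_simps)
  have "sc c * z = f * f * z" by (simp only: f(2) fz)
  also have "\<dots> = sc c * (sc c * z)" by (simp only: mult.assoc fz sc_left_comm[of f])
  finally have "sc (c * c + - c) * z = 0"
    by (simp only: sc_add sc_minus sc_mult distrib_right mult.assoc) simp
  then have "c = 0 \<or> c = 1" using False by (auto simp: sc_eq_0)
  moreover have "f = sc c * e"
  proof -
    have "f * (sc (nu i) * (F ^ i * z * E ^ i)) = sc c * (sc (nu i) * (F ^ i * z * E ^ i))" for i
    proof -
      have "f * (sc (nu i) * (F ^ i * z * E ^ i)) = sc (nu i) * (f * F ^ i * z * E ^ i)"
        by (simp only: sc_left_comm[of f] mult.assoc)
      also have "f * F ^ i * z = F ^ i * (f * z)"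
        using f(3)[of "F ^ i"] by (simp add: A_intros mult.assoc[symmetric])
      finally show ?thesis by (simp add: fz sc_left mult.assoc) (simp add: sc_comm[of "sc c"] flip: mult.assoc)
    qed
    then have "f * e = sc c * e" by (simp add: e_def sum_distrib_left)
    then show ?thesis using f(3)[OF e_A] f(4) by simp
  qed
  ultimately show ?thesis by (auto simp: sc_0 sc_1)
qed

end

section \<open>Linear operators on functions of a natural number\<close>

text \<open>Linear endomorphisms of one fixed function space form a type of class
  \<open>ring_1\<close>, as \<open>weight_algebra\<close> requires; matrices of the variable size
  \<open>2 ^ r\<close> form no such type.\<close>

typedef (overloaded) 'k op = "{T :: (nat \<Rightarrow> 'k::field) \<Rightarrow> nat \<Rightarrow> 'k.
    (\<forall>x y. T (\<lambda>i. x i + y i) = (\<lambda>i. T x i + T y i)) \<and> (\<forall>c x. T (\<lambda>i. c * x i) = (\<lambda>i. c * T x i))}"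
  morphisms act Op
  by (rule exI[of _ "\<lambda>x. x"]) auto

setup_lifting type_definition_op

lemma act_add: "act T (\<lambda>i. x i + y i) = (\<lambda>i. act T x i + act T y i)"
  by transfer auto

lemma act_cmult: "act T (\<lambda>i. c * x i) = (\<lambda>i. c * act T x i)"
  by transfer auto

lemma act_zero: "act T (\<lambda>i. 0) = (\<lambda>i. 0)"
  using act_cmult[of T 0 "\<lambda>i. 0"] by simp

lemma op_eqI: "(\<And>x. act S x = act T x) \<Longrightarrow> S = T"
  by (simp add: act_inject[symmetric] fun_eq_iff)

instantiation op :: (field) ring_1
begin

lift_definition zero_op :: "'a op" is "\<lambda>x i. 0" by auto
lift_definition one_op :: "'a op" is "\<lambda>x. x" by auto
lift_definition plus_op :: "'a op \<Rightarrow> 'a op \<Rightarrow> 'a op" is "\<lambda>S T x i. S x i + T x i"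
  by (auto simp: algebra_simps fun_eq_iff)
lift_definition uminus_op :: "'a op \<Rightarrow> 'a op" is "\<lambda>T x i. - T x i"
  by (auto simp: algebra_simps fun_eq_iff)
lift_definition minus_op :: "'a op \<Rightarrow> 'a op \<Rightarrow> 'a op" is "\<lambda>S T x i. S x i - T x i"
  by (auto simp: algebra_simps fun_eq_iff)
lift_definition times_op :: "'a op \<Rightarrow> 'a op \<Rightarrow> 'a op" is "\<lambda>S T x. S (T x)"
  by auto

instance
proof
  show "(0::'a op) \<noteq> 1"
  proof
    assume "(0::'a op) = 1"
    then have "act (0::'a op) (\<lambda>i. 1) 0 = act 1 (\<lambda>i. 1) 0" by simp
    then show False by (simp add: zero_op.rep_eq one_op.rep_eq)
  qed
qed (transfer; auto simp: algebra_simps fun_eq_iff; fail)+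

end

lift_definition scal :: "'k::field \<Rightarrow> 'k op" is "\<lambda>c x i. c * x i"
  by (auto simp: algebra_simps)

lemmas act_simps [simp] = zero_op.rep_eq one_op.rep_eq plus_op.rep_eq uminus_op.rep_eq minus_op.rep_eq
  times_op.rep_eq scal.rep_eq

lemma act_sum: "act (sum f I) x = (\<lambda>i. \<Sum>j\<in>I. act (f j) x i)"
  by (induction I rule: infinite_finite_induct) auto

section \<open>The generators on tensor space\<close>

text \<open>
  An index \<open>i\<close> encodes a tensor word: its lowest binary digit is the last tensor factor, with the
  digit 0 for \<open>\<omega>\<^sub>1\<close> and 1 for \<open>\<omega>\<^sub>2\<close>. All digits above the \<open>r\<close>-th are inert, so that the operators
  for all \<open>r\<close> act on the same space.
\<close>

definition ev :: "(nat \<Rightarrow> 'k) \<Rightarrow> nat \<Rightarrow> 'k" where "ev f = (\<lambda>j. f (2 * j))"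
definition od :: "(nat \<Rightarrow> 'k) \<Rightarrow> nat \<Rightarrow> 'k" where "od f = (\<lambda>j. f (2 * j + 1))"
definition join :: "(nat \<Rightarrow> 'k) \<Rightarrow> (nat \<Rightarrow> 'k) \<Rightarrow> nat \<Rightarrow> 'k" where
  "join f g = (\<lambda>i. if even i then f (i div 2) else g (i div 2))"

lemma ev_join [simp]: "ev (join f g) = f" and od_join [simp]: "od (join f g) = g"
  by (auto simp: ev_def od_def join_def)

lemma join_ev_od: "join (ev f) (od f) = f"
  by (auto simp: ev_def od_def join_def fun_eq_iff)

lemma ev_od_lin:
  "ev (\<lambda>i. x i + y i) = (\<lambda>i. ev x i + ev y i)" "od (\<lambda>i. x i + y i) = (\<lambda>i. od x i + od y i)"
  "ev (\<lambda>i. x i - y i) = (\<lambda>i. ev x i - ev y i)" "od (\<lambda>i. x i - y i) = (\<lambda>i. od x i - od y i)"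
  "ev (\<lambda>i. c * x i) = (\<lambda>i. c * ev x i)" "od (\<lambda>i. c * x i) = (\<lambda>i. c * od x i)"
  "ev (\<lambda>i. 0) = (\<lambda>i. 0)" "od (\<lambda>i. 0) = (\<lambda>i. 0)"
  by (simp_all add: ev_def od_def)

lemma ev_od_eqI:
  assumes "ev f = ev g" "od f = od g"
  shows "f = g"
  by (subst (1 2) join_ev_od[symmetric]) (simp only: assms)

text \<open>The number of factors \<open>\<omega>_1\<close>, that is of zero digits, among the
  \<open>r\<close> lowest digits; the weight of the tensor word is
  \<open>(wt r i, r - wt r i)\<close>.\<close>

primrec wt :: "nat \<Rightarrow> nat \<Rightarrow> nat" where
  "wt 0 i = 0"
| "wt (Suc r) i = wt r (i div 2) + (if even i then 1 else 0)"

lemma wt_le: "wt r i \<le> r"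
  by (induction r arbitrary: i) (auto intro: le_SucI)

text \<open>The elements \<open>K_i\<close>, their inverses, the quantum binomials and the weight
  projections are all diagonal with entries depending only on the weight.\<close>

lift_definition dg :: "nat \<Rightarrow> (nat \<Rightarrow> 'k::field) \<Rightarrow> 'k op" is "\<lambda>r g f i. g (wt r i) * f i"
  by (auto simp: algebra_simps)

lemma dg_0: "act (dg 0 g) f = (\<lambda>i. g 0 * f i)"
  by (simp add: dg.rep_eq)

lemma dg_Suc:
  "ev (act (dg (Suc r) g) f) = act (dg r (\<lambda>m. g (Suc m))) (ev f)"
  "od (act (dg (Suc r) g) f) = act (dg r g) (od f)"
  by (auto simp: dg.rep_eq ev_def od_def)

text \<open>The rule \<open>E \<otimes> K + 1 \<otimes> E\<close> on coordinates: \<open>K\<close>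
  multiplies a last factor \<open>\<omega>_1\<close> by \<open>q\<close> and a last factor
  \<open>\<omega>_2\<close> by \<open>inverse q\<close>, and \<open>E\<close> turns a last
  \<open>\<omega>_2\<close> into \<open>\<omega>_1\<close>, which sends the odd part to the even
  part.\<close>

primrec opE :: "'k::field \<Rightarrow> nat \<Rightarrow> (nat \<Rightarrow> 'k) \<Rightarrow> nat \<Rightarrow> 'k" where
  "opE q 0 f = (\<lambda>i. 0)"
| "opE q (Suc r) f = join (\<lambda>i. q * opE q r (ev f) i + od f i) (\<lambda>i. inverse q * opE q r (od f) i)"

lift_definition Eop :: "'k::field \<Rightarrow> nat \<Rightarrow> 'k op" is opE
proof -
  fix q :: 'k and r :: nat
  have "opE q r (\<lambda>i. x i + y i) = (\<lambda>i. opE q r x i + opE q r y i) \<and>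
    opE q r (\<lambda>i. c * x i) = (\<lambda>i. c * opE q r x i)" for c x y
  proof (induction r arbitrary: c x y)
    case (Suc r)
    show ?case
      by (rule conjI; rule ev_od_eqI) (simp_all add: ev_od_lin Suc algebra_simps)
  qed simp
  then show "(\<forall>x y. opE q r (\<lambda>i. x i + y i) = (\<lambda>i. opE q r x i + opE q r y i)) \<and>
       (\<forall>c x. opE q r (\<lambda>i. c * x i) = (\<lambda>i. c * opE q r x i))" by blast
qed

definition Kinv :: "'k::field \<Rightarrow> nat \<Rightarrow> 'k op" where
  "Kinv q r = dg r (\<lambda>m. q powi (int r - 2 * int m))"

text \<open>The rule \<open>F \<otimes> 1 + K^-1 \<otimes> F\<close> on coordinates: a last
  \<open>\<omega>_1\<close> becomes \<open>\<omega>_2\<close>, at the price of \<open>Kinv\<close>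
  on the remaining factors.\<close>

primrec opF :: "'k::field \<Rightarrow> nat \<Rightarrow> (nat \<Rightarrow> 'k) \<Rightarrow> nat \<Rightarrow> 'k" where
  "opF q 0 f = (\<lambda>i. 0)"
| "opF q (Suc r) f = join (opF q r (ev f)) (\<lambda>i. opF q r (od f) i + act (Kinv q r) (ev f) i)"

lift_definition Fop :: "'k::field \<Rightarrow> nat \<Rightarrow> 'k op" is opF
proof -
  fix q :: 'k and r :: nat
  have "opF q r (\<lambda>i. x i + y i) = (\<lambda>i. opF q r x i + opF q r y i) \<and>
    opF q r (\<lambda>i. c * x i) = (\<lambda>i. c * opF q r x i)" for c x y
  proof (induction r arbitrary: c x y)
    case (Suc r)
    show ?case
      by (rule conjI; rule ev_od_eqI) (simp_all add: ev_od_lin Suc algebra_simps act_add act_cmult)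
  qed simp
  then show "(\<forall>x y. opF q r (\<lambda>i. x i + y i) = (\<lambda>i. opF q r x i + opF q r y i)) \<and>
       (\<forall>c x. opF q r (\<lambda>i. c * x i) = (\<lambda>i. c * opF q r x i))" by blast
qed

lemma Eop_0: "act (Eop q 0) f = (\<lambda>i. 0)" and Fop_0: "act (Fop q 0) f = (\<lambda>i. 0)"
  by (simp_all add: Eop.rep_eq Fop.rep_eq)

lemma Eop_Suc:
  "ev (act (Eop q (Suc r)) f) = (\<lambda>i. q * act (Eop q r) (ev f) i + od f i)"
  "od (act (Eop q (Suc r)) f) = (\<lambda>i. inverse q * act (Eop q r) (od f) i)"
  by (simp_all add: Eop.rep_eq)

lemma Fop_Suc:
  "ev (act (Fop q (Suc r)) f) = act (Fop q r) (ev f)"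
  "od (act (Fop q (Suc r)) f) = (\<lambda>i. act (Fop q r) (od f) i + act (Kinv q r) (ev f) i)"
  by (simp_all add: Fop.rep_eq)

lemma dg_mult: "dg r g * dg r h = dg r (\<lambda>m. g m * h m)"
  by (rule op_eqI) (simp add: dg.rep_eq mult.assoc)

lemma dg_add: "dg r g + dg r h = dg r (\<lambda>m. g m + h m)"
  by (rule op_eqI) (simp add: dg.rep_eq algebra_simps)

lemma dg_cong: "(\<And>m. m \<le> r \<Longrightarrow> g m = h m) \<Longrightarrow> dg r g = dg r h"
  by (rule op_eqI) (simp add: dg.rep_eq wt_le)

lemma scal_dg: "scal c = dg r (\<lambda>_. c)"
  by (rule op_eqI) (simp add: dg.rep_eq)

lemma dg_scal: "scal c * dg r g = dg r (\<lambda>m. c * g m)"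
  by (simp add: scal_dg[of c r] dg_mult)

lemma Eop_dg: "Eop q r * dg r (\<lambda>m. g (Suc m)) = dg r g * Eop q r"
proof -
  have "act (Eop q r) (act (dg r (\<lambda>m. g (Suc m))) f) = act (dg r g) (act (Eop q r) f)" for f
  proof (induction r arbitrary: f g)
    case (Suc r)
    show ?case
      by (rule ev_od_eqI; unfold Eop_Suc dg_Suc Suc[of g] Suc[of "\<lambda>m. g (Suc m)"]) (simp_all add: dg.rep_eq algebra_simps)
  qed (simp add: Eop_0 act_zero)
  then show ?thesis by (intro op_eqI) simp
qed

lemma Fop_dg: "Fop q r * dg r g = dg r (\<lambda>m. g (Suc m)) * Fop q r"
proof -
  have "act (Fop q r) (act (dg r g) f) = act (dg r (\<lambda>m. g (Suc m))) (act (Fop q r) f)" for f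
  proof (induction r arbitrary: f g)
    case (Suc r)
    show ?case
      by (rule ev_od_eqI; unfold Fop_Suc dg_Suc Suc) (simp_all add: dg.rep_eq algebra_simps Kinv_def)
  qed (simp add: Fop_0 act_zero)
  then show ?thesis by (intro op_eqI) simp
qed

lemma Kinv_shift:
  fixes q :: "'k::field"
  assumes "q \<noteq> 0"
  shows "q powi (int r - 2 * int m) = q * q * q powi (int r - 2 * int (Suc m))"
proof -
  have 1: "int r - 2 * int m = 1 + (1 + (int r - 2 * int (Suc m)))" by simp
  have 2: "q powi (1 + n) = q * q powi n" for n
    using assms by (simp add: power_int_add)
  show ?thesis unfolding 1 by (simp only: 2 mult.assoc)
qed

lemma Kinv_eq: "q \<noteq> 0 \<Longrightarrow> Kinv q r = dg r (\<lambda>m. q * q * q powi (int r - 2 * int (Suc m)))"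
  unfolding Kinv_def by (intro dg_cong Kinv_shift)

lemma Eop_Kinv: assumes "q \<noteq> 0" shows "Eop q r * Kinv q r = scal (q * q) * Kinv q r * Eop q r"
proof -
  have "Eop q r * Kinv q r = Eop q r * dg r (\<lambda>m. q * q * q powi (int r - 2 * int (Suc m)))"
    by (simp only: Kinv_eq[OF assms])
  also have "\<dots> = dg r (\<lambda>m. q * q * q powi (int r - 2 * int m)) * Eop q r"
    by (rule Eop_dg)
  finally show ?thesis by (simp only: Kinv_def dg_scal)
qed

lemma Fop_Kinv: assumes "q \<noteq> 0" shows "scal (q * q) * (Fop q r * Kinv q r) = Kinv q r * Fop q r"
proof -
  have "scal (q * q) * (Fop q r * Kinv q r) = scal (q * q) * dg r (\<lambda>m. q powi (int r - 2 * int (Suc m))) * Fop q r"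
    unfolding Kinv_def Fop_dg by (simp only: mult.assoc)
  also have "\<dots> = Kinv q r * Fop q r"
    by (simp only: dg_scal Kinv_eq[OF assms])
  finally show ?thesis .
qed

text \<open>Induction on the last tensor factor. The mixed terms of the two coproducts cancel by
  \<open>Eop_Kinv\<close>; the diagonal remainders combine to \<open>[h + 1]\<close> for a last
  \<open>\<omega>_1\<close> and to \<open>[h - 1]\<close> for a last \<open>\<omega>_2\<close>,
  where \<open>h\<close> is the weight of the other factors.\<close>

lemma Eop_Fop:
  assumes q: "q \<noteq> 0" "q * q \<noteq> 1"
  shows "Eop q r * Fop q r = Fop q r * Eop q r + dg r (\<lambda>m. qbr q (2 * int m - int r))"
proof -
  have "act (Eop q r) (act (Fop q r) f) = (\<lambda>i. act (Fop q r) (act (Eop q r) f) i + act (dg r (\<lambda>m. qbr q (2 * int m - int r))) f i)" for f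
  proof (induction r arbitrary: f)
    case 0
    show ?case by (simp add: Eop_0 Fop_0 dg.rep_eq)
  next
    case (Suc r)
    have EK: "act (Eop q r) (act (Kinv q r) f) = (\<lambda>i. q * q * act (Kinv q r) (act (Eop q r) f) i)" for f
      using arg_cong[OF Eop_Kinv[OF q(1), of r], of "\<lambda>T. act T f"] by simp
    have 0: "qbr q (2 * int (Suc m) - int (Suc r)) = q * qbr q (2 * int m - int r) + q powi (int r - 2 * int m)" for m
      using qbr_Suc(1)[OF q, of "2 * int m - int r"] by (simp add: algebra_simps)
    have 1: "qbr q (2 * int m - int (Suc r)) = inverse q * qbr q (2 * int m - int r) - q powi (int r - 2 * int m)" for m
    proof -
      have "qbr q (2 * int m - int r) = q * qbr q (2 * int m - int (Suc r)) + q powi (- (2 * int m - int (Suc r)))"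
        using qbr_Suc(1)[OF q, of "2 * int m - int (Suc r)"] by (simp add: algebra_simps)
      moreover have "q powi (- (2 * int m - int (Suc r))) = q * q powi (int r - 2 * int m)"
        using power_int_add[of q 1 "int r - 2 * int m"] q by (simp add: algebra_simps)
      ultimately show ?thesis using q by (simp add: field_simps)
    qed
    show ?case
      by (rule ev_od_eqI; unfold ev_od_lin Eop_Suc Fop_Suc dg_Suc Suc act_add act_cmult 0 EK; (unfold 1)?)
        (use q in \<open>auto simp: dg.rep_eq fun_eq_iff algebra_simps Kinv_def\<close>)
  qed
  then show ?thesis by (intro op_eqI) simp
qed

definition Pop :: "nat \<Rightarrow> int \<Rightarrow> 'k::field op" where
  "Pop r m = dg r (\<lambda>n. if int n = m then 1 else 0)"

lemma act_Pop: "act (Pop r m) f = (\<lambda>i. if int (wt r i) = m then f i else 0)"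
  by (auto simp: Pop_def dg.rep_eq)

lemma weight_algebra_op:
  assumes q: "q \<noteq> 0" "q * q \<noteq> 1"
  shows "weight_algebra scal (Eop q r) (Fop q r) (Pop r) q r"
proof
  show "scal (a + b) = scal a + scal b" for a b :: 'a by (rule op_eqI) (simp add: algebra_simps)
  show "scal (a * b) = scal a * scal b" for a b :: 'a by (rule op_eqI) (simp add: algebra_simps)
  show "scal (1 :: 'a) = 1" by (rule op_eqI) simp
  show "x * scal c = scal c * x" for x and c :: 'a by (rule op_eqI) (simp add: act_cmult)
  show "q \<noteq> 0" "q * q \<noteq> 1" by fact+
  show "Pop r m * Pop r n = (if m = n then Pop r m else 0 :: 'a op)" for m n
    by (rule op_eqI) (auto simp: act_Pop)
  show "Pop r m = (0 :: 'a op)" if "m < 0 \<or> int r < m" for m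
    using that by (intro op_eqI) (auto simp: act_Pop fun_eq_iff leD[OF wt_le])
  show "(\<Sum>m\<in>{0..int r}. Pop r m) = (1 :: 'a op)"
  proof (rule op_eqI)
    fix x :: "nat \<Rightarrow> 'a"
    have "(\<Sum>m\<in>{0..int r}. if int (wt r i) = m then x i else 0) = x i" for i
      using wt_le[of r i] by (subst sum.delta') auto
    then show "act (\<Sum>m\<in>{0..int r}. Pop r m) x = act 1 x" by (simp add: act_sum act_Pop)
  qed
  show "Eop q r * Pop r m = Pop r (m + 1) * Eop q r" for m
  proof -
    have "Pop r m = dg r (\<lambda>n. if int (Suc n) = m + 1 then 1 else 0 :: 'a)"
      unfolding Pop_def by (simp add: add.commute)
    then show ?thesis using Eop_dg[of q r "\<lambda>n. if int n = m + 1 then 1 else 0"]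
      by (simp only: Pop_def)
  qed
  show "Fop q r * Pop r m = Pop r (m - 1) * Fop q r" for m
  proof -
    have "Pop r (m - 1) = dg r (\<lambda>n. if int (Suc n) = m then 1 else 0 :: 'a)"
      unfolding Pop_def by (intro dg_cong) auto
    then show ?thesis using Fop_dg[of q r "\<lambda>n. if int n = m then 1 else 0"]
      by (simp only: Pop_def)
  qed
  show "Eop q r * Fop q r * Pop r m = Fop q r * Eop q r * Pop r m + scal (qbr q (2 * m - int r)) * Pop r m" for m
    unfolding Eop_Fop[OF q] distrib_right
    by (rule arg_cong[of _ _ "\<lambda>x. _ + x"], rule op_eqI) (auto simp: act_Pop dg.rep_eq)
qed

text \<open>The two summands of the coproduct commute up to a power of \<open>q\<close>, and
  \<open>E\<close> squares to zero on the last factor, so only two terms of the q-binomial expansion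
  remain. For \<open>n = 0\<close> the truncated exponent \<open>n - 1\<close> is harmless because
  \<open>[0] = 0\<close>.\<close>

lemma Eop_pow:
  assumes q: "q \<noteq> 0" "q * q \<noteq> 1"
  shows "ev (act (Eop q (Suc r) ^ n) f) = (\<lambda>i. q ^ n * act (Eop q r ^ n) (ev f) i + qbr q (int n) * act (Eop q r ^ (n - 1)) (od f) i)"
    and "od (act (Eop q (Suc r) ^ n) f) = (\<lambda>i. inverse q ^ n * act (Eop q r ^ n) (od f) i)"
proof (induction n)
  case (Suc n)
  have s: "qbr q (int n) * act (Eop q r * Eop q r ^ (n - 1)) g i = qbr q (int n) * act (Eop q r ^ n) g i" for g i
    by (cases n) auto
  {
    case 1
    show ?case
      using qbr_Suc(1)[OF q, of "int n"] s[of "od f"] q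
      by (simp add: Eop_Suc Suc act_add act_cmult algebra_simps fun_eq_iff power_int_minus power_inverse)
  next
    case 2
    show ?case by (simp add: Eop_Suc Suc act_cmult algebra_simps fun_eq_iff)
  }
qed auto

lemma Fop_pow:
  assumes q: "q \<noteq> 0" "q * q \<noteq> 1"
  shows "ev (act (Fop q (Suc r) ^ n) f) = act (Fop q r ^ n) (ev f)"
    and "od (act (Fop q (Suc r) ^ n) f) = (\<lambda>i. act (Fop q r ^ n) (od f) i
        + inverse q * q ^ n * qbr q (int n) * act (Fop q r ^ (n - 1)) (act (Kinv q r) (ev f)) i)"
proof (induction n)
  case (Suc n)
  have s: "qbr q (int n) * act (Fop q r * Fop q r ^ (n - 1)) g i = qbr q (int n) * act (Fop q r ^ n) g i" for g i
    by (cases n) auto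
  have "Kinv q r * Fop q r ^ n = scal ((q * q) ^ n) * (Fop q r ^ n * Kinv q r)"
  proof (induction n)
    case 0
    show ?case by (rule op_eqI) simp
  next
    case (Suc n)
    have "Kinv q r * Fop q r ^ Suc n = (Kinv q r * Fop q r) * Fop q r ^ n" by (simp add: mult.assoc)
    also have "\<dots> = scal (q * q) * Fop q r * (Kinv q r * Fop q r ^ n)"
      unfolding Fop_Kinv[OF q(1), symmetric] by (simp add: mult.assoc)
    also have "\<dots> = scal ((q * q) ^ Suc n) * (Fop q r ^ Suc n * Kinv q r)"
      unfolding Suc by (rule op_eqI) (simp add: act_cmult mult.assoc)
    finally show ?case .
  qed
  from arg_cong[OF this, of "\<lambda>T. act T (ev f)"]
  have KF: "act (Kinv q r) (act (Fop q r ^ n) (ev f)) = (\<lambda>i. (q * q) ^ n * act (Fop q r ^ n) (act (Kinv q r) (ev f)) i)"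
    by simp
  {
    case 1
    show ?case by (simp add: Fop_Suc Suc)
  next
    case 2
    have c: "inverse q * q ^ n * qbr q (int n) + (q * q) ^ n = inverse q * q ^ Suc n * qbr q (int (Suc n))"
    proof -
      have "inverse q * q ^ n * qbr q (int n) + (q * q) ^ n = q ^ n * (inverse q * qbr q (int n) + q powi int n)"
        by (simp add: power_mult_distrib distrib_left mult_ac)
      also have "\<dots> = q ^ n * qbr q (int (Suc n))"
        using qbr_Suc(2)[OF q, of "int n"] by (simp add: add.commute)
      finally show ?thesis using q by simp
    qed
    have "od (act (Fop q (Suc r) ^ Suc n) f) = (\<lambda>i. act (Fop q r ^ Suc n) (od f) i +
       (inverse q * q ^ n * (qbr q (int n) * act (Fop q r * Fop q r ^ (n - 1)) (act (Kinv q r) (ev f)) i) +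
         (q * q) ^ n * act (Fop q r ^ n) (act (Kinv q r) (ev f)) i))"
      by (simp add: Fop_Suc Suc act_add act_cmult KF fun_eq_iff mult.assoc)
    also have "\<dots> = (\<lambda>i. act (Fop q r ^ Suc n) (od f) i +
       (inverse q * q ^ n * qbr q (int n) + (q * q) ^ n) * act (Fop q r ^ n) (act (Kinv q r) (ev f)) i)"
      unfolding s by (simp add: algebra_simps)
    finally show ?case unfolding c by simp
  }
qed auto

text \<open>The mixed term in \<open>Fop_pow\<close> carries the factor \<open>[n]\<close>, so the
  vanishing is inherited from one tensor power to the next.\<close>

lemma Fop_pow_0:
  assumes q: "q \<noteq> 0" "q * q \<noteq> 1" and n: "n > 0" "qbr q (int n) = 0"
  shows "Fop q r ^ n = 0"
proof (rule op_eqI)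
  fix x
  show "act (Fop q r ^ n) x = act 0 x"
  proof (induction r arbitrary: x)
    case 0
    then show ?case using n by (cases n) (auto simp: Fop_0)
  next
    case (Suc r)
    show ?case by (rule ev_od_eqI; unfold Fop_pow[OF q] Suc) (use n in \<open>simp_all add: ev_od_lin\<close>)
  qed
qed

text \<open>Division of \<open>Eop_pow\<close> and \<open>Fop_pow\<close> by the quantum factorial
  leaves a recursion without denominators, because \<open>[n] / [n]! = 1 / [n - 1]!\<close>. The set
  \<open>Z\<close> stands for the ring of Laurent polynomials.\<close>

lemma divided_powers_integral:
  fixes q :: "'k::field"
  assumes q: "q \<noteq> 0" "q * q \<noteq> 1" "\<And>n. n > 0 \<Longrightarrow> qbr q (int n) \<noteq> 0"
    and Z: "0 \<in> Z" "1 \<in> Z" "q \<in> Z" "inverse q \<in> Z" "\<And>a b. a \<in> Z \<Longrightarrow> b \<in> Z \<Longrightarrow> a + b \<in> Z"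
      "\<And>a b. a \<in> Z \<Longrightarrow> b \<in> Z \<Longrightarrow> a * b \<in> Z"
    and f: "\<And>i. f i \<in> Z"
  shows "inverse (\<Prod>i=1..n. qbr q (int i)) * act (Eop q r ^ n) f i \<in> Z"
    and "inverse (\<Prod>i=1..n. qbr q (int i)) * act (Fop q r ^ n) f i \<in> Z"
proof -
  have pow: "x ^ n \<in> Z" if "x \<in> Z" for x n using that by (induction n) (auto simp: Z)
  have powi: "q powi m \<in> Z" for m by (cases "m \<ge> 0") (auto simp: power_int_def pow Z)
  define c :: "nat \<Rightarrow> 'k" where "c n = inverse (\<Prod>i=1..n. qbr q (int i))" for n
  have c: "c n * qbr q (int n) = (if n = 0 then 0 else c (n - 1))" for n
    using q(3)[of n] by (cases n) (simp_all add: c_def)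
  have ev_od_Z: "f i \<in> Z" if "ev f (i div 2) \<in> Z" "od f (i div 2) \<in> Z" for f :: "nat \<Rightarrow> 'k" and i
    using that by (cases "even i") (auto simp: ev_def od_def)
  have ev_Z: "(\<And>i. f i \<in> Z) \<Longrightarrow> ev f i \<in> Z" "(\<And>i. f i \<in> Z) \<Longrightarrow> od f i \<in> Z" for f i
    by (auto simp: ev_def od_def)
  have "c n * act (Eop q r ^ n) f i \<in> Z" using f
  proof (induction r arbitrary: n f i)
    case 0
    then show ?case by (cases n) (auto simp: Eop_0 Z c_def)
  next
    case (Suc r)
    have 1: "c n * ev (act (Eop q (Suc r) ^ n) f) j = q ^ n * (c n * act (Eop q r ^ n) (ev f) j)
        + (if n = 0 then 0 else c (n - 1) * act (Eop q r ^ (n - 1)) (od f) j)" for j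
      unfolding Eop_pow[OF q(1,2)] using c[of n] by (auto simp: algebra_simps)
    have 2: "c n * od (act (Eop q (Suc r) ^ n) f) j = inverse q ^ n * (c n * act (Eop q r ^ n) (od f) j)" for j
      unfolding Eop_pow[OF q(1,2)] by simp
    have IH: "c n * act (Eop q r ^ n) (ev f) j \<in> Z" "c n * act (Eop q r ^ n) (od f) j \<in> Z" for n j
      by (rule Suc.IH, rule ev_Z, rule Suc.prems)+
    have "c n * ev (act (Eop q (Suc r) ^ n) f) j \<in> Z" for j
      unfolding 1 by (split if_split, intro conjI impI Z pow IH)
    moreover have "c n * od (act (Eop q (Suc r) ^ n) f) j \<in> Z" for j
      unfolding 2 by (intro Z pow IH)
    ultimately show ?case
      using ev_od_Z[of "\<lambda>i. c n * act (Eop q (Suc r) ^ n) f i" i] by (simp add: ev_od_lin)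
  qed
  then show "inverse (\<Prod>i=1..n. qbr q (int i)) * act (Eop q r ^ n) f i \<in> Z" by (simp add: c_def)
  have "c n * act (Fop q r ^ n) f i \<in> Z" using f
  proof (induction r arbitrary: n f i)
    case 0
    then show ?case by (cases n) (auto simp: Fop_0 Z c_def)
  next
    case (Suc r)
    have K: "act (Kinv q r) (ev f) j \<in> Z" for j
      unfolding Kinv_def dg.rep_eq by (intro Z powi ev_Z Suc.prems)
    have 1: "c n * ev (act (Fop q (Suc r) ^ n) f) j = c n * act (Fop q r ^ n) (ev f) j" for j
      unfolding Fop_pow[OF q(1,2)] by simp
    have 2: "c n * od (act (Fop q (Suc r) ^ n) f) j = c n * act (Fop q r ^ n) (od f) j
        + inverse q * q ^ n * (if n = 0 then 0 else c (n - 1) * act (Fop q r ^ (n - 1)) (act (Kinv q r) (ev f)) j)" for j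
      unfolding Fop_pow[OF q(1,2)] using c[of n] by (auto simp: algebra_simps)
    have IH: "c n * act (Fop q r ^ n) (ev f) j \<in> Z" "c n * act (Fop q r ^ n) (od f) j \<in> Z" for n j
      by (rule Suc.IH, rule ev_Z, rule Suc.prems)+
    have IHK: "c n * act (Fop q r ^ n) (act (Kinv q r) (ev f)) j \<in> Z" for n j
      by (rule Suc.IH, rule K)
    have "c n * ev (act (Fop q (Suc r) ^ n) f) j \<in> Z" for j
      unfolding 1 by (intro Z pow IH)
    moreover have "c n * od (act (Fop q (Suc r) ^ n) f) j \<in> Z" for j
      unfolding 2 by (split if_split, intro conjI impI Z pow IH IHK)
    ultimately show ?case
      using ev_od_Z[of "\<lambda>i. c n * act (Fop q (Suc r) ^ n) f i" i] by (simp add: ev_od_lin)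
  qed
  then show "inverse (\<Prod>i=1..n. qbr q (int i)) * act (Fop q r ^ n) f i \<in> Z" by (simp add: c_def)
qed

section \<open>Semisimplicity of a block\<close>

context ring
begin

abbreviation "corner e \<equiv> (\<lambda>a. e \<otimes> a) ` carrier R"
abbreviation "corner_ring e \<equiv> R\<lparr>carrier := corner e, one := e\<rparr>"

lemma corner_mem_iff:
  assumes "central_idempotent R e"
  shows "x \<in> corner e \<longleftrightarrow> x \<in> carrier R \<and> e \<otimes> x = x"
proof
  assume "x \<in> corner e"
  then obtain a where a: "a \<in> carrier R" "x = e \<otimes> a" by blast
  then show "x \<in> carrier R \<and> e \<otimes> x = x"
    using assms unfolding central_idempotent_def by (metis m_assoc m_closed)
next
  assume "x \<in> carrier R \<and> e \<otimes> x = x"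
  then show "x \<in> corner e" by (metis image_eqI)
qed

lemma corner_closed:
  assumes e: "central_idempotent R e" and x: "x \<in> corner e"
  shows "a \<in> carrier R \<Longrightarrow> a \<otimes> x \<in> corner e" "y \<in> corner e \<Longrightarrow> x \<oplus> y \<in> corner e" "\<ominus> x \<in> corner e"
    "\<zero> \<in> corner e"
proof -
  have eR: "e \<in> carrier R" "\<And>a. a \<in> carrier R \<Longrightarrow> e \<otimes> a = a \<otimes> e"
    using e by (auto simp: central_idempotent_def)
  have xR: "x \<in> carrier R" "e \<otimes> x = x" using x corner_mem_iff[OF e] by auto
  show "a \<otimes> x \<in> corner e" if a: "a \<in> carrier R"
  proof -
    have "e \<otimes> (a \<otimes> x) = a \<otimes> (e \<otimes> x)" using eR(1) eR(2)[OF a] xR(1) a by (metis m_assoc)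
    then show ?thesis unfolding corner_mem_iff[OF e] using a xR by simp
  qed
  show "x \<oplus> y \<in> corner e" if "y \<in> corner e"
    using that xR eR(1) unfolding corner_mem_iff[OF e] by (simp add: r_distr)
  show "\<ominus> x \<in> corner e" "\<zero> \<in> corner e" using xR eR(1) unfolding corner_mem_iff[OF e] by (simp_all add: r_minus)
qed

text \<open>The additive inverse of the corner is a definite description over a smaller carrier; its
  agreement with the negative in \<open>R\<close> does not hold by definition.\<close>

lemma corner_inv:
  assumes e: "central_idempotent R e" and x: "x \<in> corner e"
  shows "inv\<^bsub>add_monoid (corner_ring e)\<^esub> x = \<ominus> x"
proof -
  have "\<ominus> x \<in> corner e" "x \<in> carrier R" "\<And>y. y \<in> corner e \<Longrightarrow> y \<in> carrier R"
    using corner_closed[OF e x] x corner_mem_iff[OF e] by auto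
  then show ?thesis
    unfolding m_inv_def
    by (intro the_equality) (auto simp: r_neg l_neg intro!: minus_equality[symmetric] simp del: image_iff)
qed

text \<open>Since \<open>e\<close> acts as the identity on the corner, multiplication by
  \<open>a\<close> and by \<open>e a\<close> agree there; so the left ideals of the block are the
  left submodules over the whole ring that it contains.\<close>

lemma corner_left_ideal_iff:
  assumes e: "central_idempotent R e"
  shows "left_ideal J (corner_ring e) \<longleftrightarrow> J \<subseteq> corner e \<and> \<zero> \<in> J \<and> (\<forall>x\<in>J. \<forall>y\<in>J. x \<oplus> y \<in> J)
           \<and> (\<forall>a\<in>carrier R. \<forall>x\<in>J. a \<otimes> x \<in> J)" (is "?L \<longleftrightarrow> ?R")
proof
  assume L: ?L
  then have sg: "subgroup J (add_monoid (corner_ring e))"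
    by (simp add: left_ideal_def additive_subgroup_def)
  have sub: "J \<subseteq> corner e" using subgroup.subset[OF sg] by simp
  have "a \<otimes> x \<in> J" if "a \<in> carrier R" "x \<in> J" for a x
  proof -
    have "e \<otimes> a \<in> corner e" using that by blast
    then have "(e \<otimes> a) \<otimes> x \<in> J" using L that unfolding left_ideal_def by simp
    moreover have "e \<otimes> x = x" "x \<in> carrier R" "e \<in> carrier R" "e \<otimes> a = a \<otimes> e"
      using that sub corner_mem_iff[OF e] e unfolding central_idempotent_def by auto
    ultimately show ?thesis using that by (metis m_assoc)
  qed
  then show ?R using sub subgroup.one_closed[OF sg] subgroup.m_closed[OF sg] by auto
next
  assume r: ?R
  have sg: "subgroup J (add_monoid (corner_ring e))"
  proof
    show "J \<subseteq> carrier (add_monoid (corner_ring e))" using r by simp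
    fix x assume x: "x \<in> J"
    have "x \<in> corner e" using x r by blast
    then have "x \<in> carrier R" using corner_mem_iff[OF e] by blast
    moreover have "\<ominus> \<one> \<otimes> x \<in> J" using x r by simp
    ultimately have "\<ominus> x \<in> J" by (simp add: l_minus)
    then show "inv\<^bsub>add_monoid (corner_ring e)\<^esub> x \<in> J"
      unfolding corner_inv[OF e \<open>x \<in> corner e\<close>] .
  qed (use r in auto)
  have "corner e \<subseteq> carrier R" using corner_mem_iff[OF e] by blast
  then show ?L using r sg unfolding left_ideal_def additive_subgroup_def by auto
qed

text \<open>
  The block is the sum of the left ideals \<open>R z g\<close>, which are simple or zero.
\<close>

lemma semisimple_blockI:
  assumes e: "central_idempotent R e" and z: "z \<in> carrier R" "e \<otimes> z = z"
    and simple: "\<And>x. x \<in> carrier R \<Longrightarrow> x \<otimes> z \<noteq> \<zero> \<Longrightarrow> \<exists>y\<in>carrier R. y \<otimes> (x \<otimes> z) = z"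
    and gen: "e \<in> generate (add_monoid R) {f \<otimes> z \<otimes> g | f g. f \<in> carrier R \<and> g \<in> carrier R}"
  shows "semisimple_ring (corner_ring e)"
proof -
  let ?B = "corner_ring e"
  let ?M = "\<Union>{J. minimal_left_ideal J ?B}"
  have zB: "z \<in> corner e" using z corner_mem_iff[OF e] by auto
  have zg: "x \<otimes> z \<otimes> g \<in> corner e" if "x \<in> carrier R" "g \<in> carrier R" for x g
  proof -
    have "e \<in> carrier R" "e \<otimes> x = x \<otimes> e" using e that by (auto simp: central_idempotent_def)
    then have "e \<otimes> (x \<otimes> z \<otimes> g) = x \<otimes> z \<otimes> g" using that z by (metis m_assoc m_closed)
    then show ?thesis unfolding corner_mem_iff[OF e] using that z by simp
  qed
  have min: "x \<otimes> z \<otimes> g \<in> ?M" if x: "x \<in> carrier R" and g: "g \<in> carrier R" and nz: "x \<otimes> z \<otimes> g \<noteq> \<zero>" for x g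
  proof -
    \<comment> \<open>A nonzero element \<open>y z g\<close> of a left ideal inside \<open>J\<close>
      forces \<open>y z\<close> to be nonzero; then \<open>simple\<close> recovers \<open>z\<close>,
      and with it every element of \<open>J\<close>.\<close>
    define J where "J = {y \<otimes> z \<otimes> g | y. y \<in> carrier R}"
    have "left_ideal J ?B"
      unfolding corner_left_ideal_iff[OF e]
    proof (intro conjI ballI)
      show "J \<subseteq> corner e" unfolding J_def using zg g by blast
      show "\<zero> \<in> J" unfolding J_def using z g by (auto intro!: exI[of _ \<zero>])
      show "u \<oplus> v \<in> J" if uv: "u \<in> J" "v \<in> J" for u v
      proof -
        obtain y y' where "u = y \<otimes> z \<otimes> g" "v = y' \<otimes> z \<otimes> g" "y \<in> carrier R" "y' \<in> carrier R"
          using uv unfolding J_def by blast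
        then have "u \<oplus> v = (y \<oplus> y') \<otimes> z \<otimes> g" "y \<oplus> y' \<in> carrier R" using z g by (simp_all add: l_distr)
        then show ?thesis unfolding J_def by blast
      qed
      show "a \<otimes> u \<in> J" if au: "a \<in> carrier R" "u \<in> J" for a u
      proof -
        obtain y where "u = y \<otimes> z \<otimes> g" "y \<in> carrier R"
          using au unfolding J_def by blast
        then have "a \<otimes> u = (a \<otimes> y) \<otimes> z \<otimes> g" "a \<otimes> y \<in> carrier R" using z g au by (simp_all add: m_assoc)
        then show ?thesis unfolding J_def by blast
      qed
    qed
    moreover have "x \<otimes> z \<otimes> g \<in> J" using x unfolding J_def by blast
    moreover have "J' = {\<zero>} \<or> J' = J" if J': "left_ideal J' ?B" "J' \<subseteq> J" for J'
    proof (rule disjCI)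
      assume "J' \<noteq> J"
      have J'': "\<zero> \<in> J'" "\<And>a x. a \<in> carrier R \<Longrightarrow> x \<in> J' \<Longrightarrow> a \<otimes> x \<in> J'"
        using J'(1) unfolding corner_left_ideal_iff[OF e] by blast+
      have "w = \<zero>" if w: "w \<in> J'" for w
      proof (rule ccontr)
        assume "w \<noteq> \<zero>"
        obtain y where y: "y \<in> carrier R" "w = y \<otimes> z \<otimes> g" using w J'(2) unfolding J_def by blast
        then have "y \<otimes> z \<noteq> \<zero>" using \<open>w \<noteq> \<zero>\<close> g by auto
        then obtain u where u: "u \<in> carrier R" "u \<otimes> (y \<otimes> z) = z" using simple y by blast
        have "J \<subseteq> J'"
        proof
          fix v assume "v \<in> J"
          then obtain y' where y': "y' \<in> carrier R" "v = y' \<otimes> z \<otimes> g" unfolding J_def by blast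
          have "v = (y' \<otimes> u) \<otimes> w"
            using y' y u z g by (metis m_assoc m_closed)
          then show "v \<in> J'" using J''(2)[OF _ w] y' u by simp
        qed
        then show False using J' \<open>J' \<noteq> J\<close> by blast
      qed
      then show "J' = {\<zero>}" using J''(1) by blast
    qed
    ultimately have "minimal_left_ideal J ?B" using nz unfolding minimal_left_ideal_def by auto
    then show ?thesis using \<open>x \<otimes> z \<otimes> g \<in> J\<close> by blast
  qed
  let ?G = "generate (add_monoid ?B) ?M"
  have G0: "\<zero> \<in> ?G" using generate.one[of "add_monoid ?B" ?M] by simp
  have G1: "x \<otimes> z \<otimes> g \<in> ?G" if "x \<in> carrier R" "g \<in> carrier R" for x g
    using min[OF that] G0 generate.incl[of _ ?M "add_monoid ?B"] by (cases "x \<otimes> z \<otimes> g = \<zero>") auto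
  have Gcar: "{f \<otimes> z \<otimes> g | f g. f \<in> carrier R \<and> g \<in> carrier R} \<subseteq> carrier (add_monoid R)" using z by auto
  have "b \<otimes> w \<in> ?G \<and> w \<in> carrier R"
    if "w \<in> generate (add_monoid R) {f \<otimes> z \<otimes> g | f g. f \<in> carrier R \<and> g \<in> carrier R}" "b \<in> carrier R" for b w
    using that
  proof (induction arbitrary: b rule: generate.induct)
    case one
    then show ?case using G0 by simp
  next
    case (incl h)
    then obtain f g where "h = f \<otimes> z \<otimes> g" "f \<in> carrier R" "g \<in> carrier R" by blast
    then show ?case using incl(2) z G1[of "b \<otimes> f" g] by (simp add: m_assoc)
  next
    case (inv h)
    then obtain f g where "h = f \<otimes> z \<otimes> g" "f \<in> carrier R" "g \<in> carrier R" by blast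
    then show ?case using inv(2) z G1[of "\<ominus> (b \<otimes> f)" g] by (simp add: m_assoc l_minus r_minus flip: a_inv_def)
  next
    case (eng h1 h2)
    then have "b \<otimes> h1 \<in> ?G" "b \<otimes> h2 \<in> ?G" "h1 \<in> carrier R" "h2 \<in> carrier R" by auto
    then show ?case using eng(5) generate.eng[of "b \<otimes> h1" "add_monoid ?B" ?M "b \<otimes> h2"] by (simp add: r_distr)
  qed
  from this[OF gen] have 1: "b \<otimes> e \<in> ?G" if "b \<in> carrier R" for b using that by blast
  have "corner e \<subseteq> ?G"
  proof
    fix x assume "x \<in> corner e"
    then have "x \<in> carrier R" "x \<otimes> e = x" using corner_mem_iff[OF e] e by (auto simp: central_idempotent_def)
    then show "x \<in> ?G" using 1[of x] by simp
  qed
  moreover have "w \<in> corner e" if "w \<in> ?G" for w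
    using that
  proof (induction rule: generate.induct)
    case one
    then show ?case using corner_closed(4)[OF e zB] by simp
  next
    case (incl h)
    then obtain J where "left_ideal J ?B" "h \<in> J" unfolding minimal_left_ideal_def by blast
    then show ?case unfolding corner_left_ideal_iff[OF e] by blast
  next
    case (inv h)
    then obtain J where "left_ideal J ?B" "h \<in> J" unfolding minimal_left_ideal_def by blast
    then have "h \<in> corner e" unfolding corner_left_ideal_iff[OF e] by blast
    then show ?case unfolding corner_inv[OF e \<open>h \<in> corner e\<close>] by (rule corner_closed(3)[OF e])
  next
    case (eng h1 h2)
    then show ?case using corner_closed(2)[OF e, of h1 h2] by simp
  qed
  ultimately show ?thesis unfolding semisimple_ring_def by auto
qed

text \<open>The minimal left ideals generate the block, so they cannot all lie in an additive
  subgroup \<open>K\<close> that misses \<open>e\<close>. An element \<open>y\<close> of a minimal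
  left ideal is recovered from each of its nonzero multiples, which turns semisimplicity into a
  property of a single element.\<close>

lemma semisimple_blockD:
  assumes e: "central_idempotent R e" and ss: "semisimple_ring (corner_ring e)"
    and K: "\<zero> \<in> K" "\<And>x y. x \<in> K \<Longrightarrow> y \<in> K \<Longrightarrow> x \<oplus> y \<in> K" "\<And>x. x \<in> K \<Longrightarrow> \<ominus> x \<in> K" "e \<notin> K"
  shows "\<exists>y\<in>carrier R. y \<notin> K \<and> (\<forall>a\<in>carrier R. a \<otimes> y \<noteq> \<zero> \<longrightarrow> (\<exists>x\<in>carrier R. x \<otimes> (a \<otimes> y) = y))"
proof -
  let ?B = "corner_ring e"
  let ?M = "\<Union>{J. minimal_left_ideal J ?B}"
  have "\<exists>y\<in>?M. y \<notin> K"
  proof (rule ccontr)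
    assume "\<not> ?thesis"
    then have M: "?M \<subseteq> K" by blast
    have "w \<in> K" if "w \<in> generate (add_monoid ?B) ?M" for w
      using that
    proof (induction rule: generate.induct)
      case (inv h)
      then obtain J where "left_ideal J ?B" "h \<in> J" unfolding minimal_left_ideal_def by blast
      then have "h \<in> corner e" unfolding corner_left_ideal_iff[OF e] by blast
      then show ?case unfolding corner_inv[OF e \<open>h \<in> corner e\<close>] using inv M K by blast
    qed (use K M in auto)
    moreover have "e \<in> corner e" using e corner_mem_iff[OF e] by (simp add: central_idempotent_def)
    ultimately show False using ss K(4) unfolding semisimple_ring_def by auto
  qed
  then obtain J y where J: "minimal_left_ideal J ?B" and y: "y \<in> J" "y \<notin> K" by blast
  have Ji: "J \<subseteq> corner e" "\<And>a x. a \<in> carrier R \<Longrightarrow> x \<in> J \<Longrightarrow> a \<otimes> x \<in> J"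
  proof -
    have l: "left_ideal J ?B" using J by (simp only: minimal_left_ideal_def)
    show "J \<subseteq> corner e" using l unfolding corner_left_ideal_iff[OF e] by (elim conjE)
    show "a \<otimes> x \<in> J" if "a \<in> carrier R" "x \<in> J" for a x
      using l that unfolding corner_left_ideal_iff[OF e] by (elim conjE) (drule (1) bspec, drule (1) bspec)
  qed
  have "y \<in> corner e" using Ji(1) y(1) by (rule subsetD)
  then have yR: "y \<in> carrier R" using corner_mem_iff[OF e, of y] by simp
  have "\<exists>x\<in>carrier R. x \<otimes> (a \<otimes> y) = y" if a: "a \<in> carrier R" "a \<otimes> y \<noteq> \<zero>" for a
  proof -
    define J' where "J' = {x \<otimes> (a \<otimes> y) | x. x \<in> carrier R}"
    have ay: "a \<otimes> y \<in> J" using Ji(2) a y by blast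
    then have sub: "J' \<subseteq> J" unfolding J'_def using Ji(2) by blast
    have "left_ideal J' ?B"
      unfolding corner_left_ideal_iff[OF e]
    proof (intro conjI ballI)
      show "J' \<subseteq> corner e" using sub Ji(1) by blast
      show "\<zero> \<in> J'" unfolding J'_def using a yR by (auto intro!: exI[of _ \<zero>])
      show "u \<oplus> v \<in> J'" if uv: "u \<in> J'" "v \<in> J'" for u v
      proof -
        obtain x x' where "u = x \<otimes> (a \<otimes> y)" "v = x' \<otimes> (a \<otimes> y)" "x \<in> carrier R" "x' \<in> carrier R"
          using uv unfolding J'_def by blast
        then have "u \<oplus> v = (x \<oplus> x') \<otimes> (a \<otimes> y)" "x \<oplus> x' \<in> carrier R" using a yR by (simp_all add: l_distr)
        then show ?thesis unfolding J'_def by blast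
      qed
      show "c \<otimes> u \<in> J'" if cu: "c \<in> carrier R" "u \<in> J'" for c u
      proof -
        obtain x where "u = x \<otimes> (a \<otimes> y)" "x \<in> carrier R" using cu unfolding J'_def by blast
        then have "c \<otimes> u = (c \<otimes> x) \<otimes> (a \<otimes> y)" "c \<otimes> x \<in> carrier R" using a yR cu by (simp_all add: m_assoc)
        then show ?thesis unfolding J'_def by blast
      qed
    qed
    moreover have "\<one> \<otimes> (a \<otimes> y) \<in> J'" unfolding J'_def by blast
    then have "J' \<noteq> {\<zero>}" using a yR by auto
    moreover have "left_ideal J' ?B \<and> J' \<subseteq> J \<longrightarrow> J' = {\<zero>} \<or> J' = J"
      using J unfolding minimal_left_ideal_def by (elim conjE) (drule spec[of _ J'], simp)
    ultimately have "J' = J" using sub by blast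
    then have "y \<in> J'" using y(1) by (simp only:)
    then obtain x where "y = x \<otimes> (a \<otimes> y)" "x \<in> carrier R" unfolding J'_def by blast
    then show ?thesis by (metis (no_types))
  qed
  then show ?thesis using yR y(2) by blast
qed

end

section \<open>Specialisation of Laurent polynomials\<close>

definition ieval :: "'c::field \<Rightarrow> int poly \<Rightarrow> 'c" where
  "ieval x p = poly (map_poly of_int p) x"

lemma ieval_simps [simp]: "ieval x 0 = 0" "ieval x 1 = 1" "ieval x (pCons c p) = of_int c + x * ieval x p"
  by (simp_all add: ieval_def map_poly_pCons)

lemma ieval_add [simp]: "ieval x (p + q) = ieval x p + ieval x q"
  by (induction p q rule: poly_induct2) (simp_all add: algebra_simps)

lemma ieval_minus [simp]: "ieval x (- p) = - ieval x p"
  using ieval_add[of x p "- p"] by (simp add: eq_neg_iff_add_eq_0 add.commute)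

lemma ieval_smult [simp]: "ieval x (smult c p) = of_int c * ieval x p"
  by (induction p) (simp_all add: algebra_simps)

lemma ieval_mult [simp]: "ieval x (p * q) = ieval x p * ieval x q"
  by (induction p) (simp_all add: algebra_simps)

lemma ieval_monom [simp]: "ieval x (monom c n) = of_int c * x ^ n"
  by (induction n) (simp_all add: monom_0 monom_Suc algebra_simps)

lemma laurent_eval_ieval: "laurent_eval x p n = ieval x p / x ^ n"
  by (simp add: laurent_eval_def ieval_def)

lemma upsilon_nonzero [simp]: "\<upsilon> \<noteq> 0"
  by (simp add: upsilon_def Zero_fract_def eq_fract)

lemma Fract_of_int: "Fract (of_int c) 1 = (of_int c :: qv)"
proof (cases c)
  case (nonneg n)
  then show ?thesis using Fract_of_nat_eq[of n] by simp
next
  case (neg n)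
  have "Fract (- of_nat (Suc n)) 1 = (- of_nat (Suc n) :: qv)"
    unfolding minus_fract[symmetric] Fract_of_nat_eq ..
  then show ?thesis unfolding neg of_int_minus of_int_of_nat_eq .
qed

lemma ieval_upsilon: "ieval \<upsilon> p = Fract (map_poly of_int p) 1"
proof (induction p)
  case 0
  then show ?case by (simp add: Zero_fract_def)
next
  case (pCons c p)
  have "(of_int c :: qv) = Fract [:of_int c:] 1"
    using Fract_of_int[of c] by (simp add: of_int_poly)
  then show ?case
    unfolding ieval_simps pCons by (simp add: upsilon_def map_poly_pCons)
qed

lemma ieval_upsilon_inj: "ieval \<upsilon> p = ieval \<upsilon> p' \<Longrightarrow> p = p'"
  unfolding ieval_upsilon
  by (simp add: eq_fract poly_eq_iff coeff_map_poly)

text \<open>As \<open>\<upsilon>\<close> is transcendental, two representations of one Laurent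
  polynomial agree as polynomials after cross multiplication, hence also at
  \<open>\<epsilon>\<close>; the description in \<open>spec\<close> is therefore
  unambiguous.\<close>

lemma spec_laurent:
  assumes "\<epsilon> \<noteq> 0"
  shows "spec \<epsilon> (laurent_eval \<upsilon> p n) = laurent_eval \<epsilon> p n"
  unfolding spec_def
proof (rule the_equality)
  fix c assume "\<exists>p' n'. laurent_eval \<upsilon> p n = laurent_eval \<upsilon> p' n' \<and> c = laurent_eval \<epsilon> p' n'"
  then obtain p' n' where e: "laurent_eval \<upsilon> p n = laurent_eval \<upsilon> p' n'" "c = laurent_eval \<epsilon> p' n'" by blast
  from e(1) have "ieval \<upsilon> (p * monom 1 n') = ieval \<upsilon> (p' * monom 1 n)"
    by (simp add: laurent_eval_ieval frac_eq_eq)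
  then have "p * monom 1 n' = p' * monom 1 n" by (rule ieval_upsilon_inj)
  then have "ieval \<epsilon> (p * monom 1 n') = ieval \<epsilon> (p' * monom 1 n)" by simp
  then show "c = laurent_eval \<epsilon> p n" using assms e by (simp add: laurent_eval_ieval frac_eq_eq)
qed blast

lemma ZZ_I: "laurent_eval \<upsilon> p n \<in> \<Z>"
  by (auto simp: ZZ_def)

lemma ZZ_E: assumes "z \<in> \<Z>" obtains p n where "z = laurent_eval \<upsilon> p n"
  using assms by (auto simp: ZZ_def)

lemma laurent_add: "x \<noteq> 0 \<Longrightarrow> laurent_eval x p n + laurent_eval x p' n' = laurent_eval x (p * monom 1 n' + p' * monom 1 n) (n + n')"
  by (simp add: laurent_eval_ieval add_frac_eq power_add)

lemma laurent_mult: "laurent_eval x p n * laurent_eval x p' n' = laurent_eval x (p * p') (n + n')"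
  by (simp add: laurent_eval_ieval power_add)

lemma laurent_minus: "- laurent_eval x p n = laurent_eval x (- p) n"
  by (simp add: laurent_eval_ieval)

lemma ZZ_add: "a \<in> \<Z> \<Longrightarrow> b \<in> \<Z> \<Longrightarrow> a + b \<in> \<Z>"
  by (elim ZZ_E) (simp add: laurent_add ZZ_I)

lemma ZZ_mult: "a \<in> \<Z> \<Longrightarrow> b \<in> \<Z> \<Longrightarrow> a * b \<in> \<Z>"
  by (elim ZZ_E) (simp add: laurent_mult ZZ_I)

lemma ZZ_minus: "a \<in> \<Z> \<Longrightarrow> - a \<in> \<Z>"
  by (elim ZZ_E) (simp add: laurent_minus ZZ_I)

lemma laurent_const: "laurent_eval x 0 0 = 0" "laurent_eval x 1 0 = 1" "laurent_eval x [:0, 1:] 0 = x"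
  "laurent_eval x 1 1 = inverse x"
  by (simp_all add: laurent_eval_ieval divide_inverse)

lemma ZZ_const: "0 \<in> \<Z>" "1 \<in> \<Z>" "\<upsilon> \<in> \<Z>" "inverse \<upsilon> \<in> \<Z>"
  using laurent_const[of \<upsilon>] ZZ_I[of 0 0] ZZ_I[of 1 0] ZZ_I[of "[:0, 1:]" 0] ZZ_I[of 1 1] by simp_all

lemma ZZ_pow: "a \<in> \<Z> \<Longrightarrow> a ^ n \<in> \<Z>"
  by (induction n) (auto simp: ZZ_const ZZ_mult)

lemma ZZ_powi: "\<upsilon> powi m \<in> \<Z>"
  by (cases "m \<ge> 0") (auto simp: power_int_def ZZ_pow ZZ_const)

lemma ZZ_sum: "(\<And>i. i \<in> I \<Longrightarrow> f i \<in> \<Z>) \<Longrightarrow> sum f I \<in> \<Z>"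
  by (induction I rule: infinite_finite_induct) (auto simp: ZZ_const ZZ_add)

context
  fixes \<epsilon> :: "'k::field"
  assumes eps: "\<epsilon> \<noteq> 0"
begin

lemma spec_add: "a \<in> \<Z> \<Longrightarrow> b \<in> \<Z> \<Longrightarrow> spec \<epsilon> (a + b) = spec \<epsilon> a + spec \<epsilon> b"
  by (elim ZZ_E) (simp add: laurent_add spec_laurent eps)

lemma spec_mult: "a \<in> \<Z> \<Longrightarrow> b \<in> \<Z> \<Longrightarrow> spec \<epsilon> (a * b) = spec \<epsilon> a * spec \<epsilon> b"
  by (elim ZZ_E) (simp add: laurent_mult spec_laurent eps)

lemma spec_const: "spec \<epsilon> 0 = 0" "spec \<epsilon> 1 = 1" "spec \<epsilon> \<upsilon> = \<epsilon>" "spec \<epsilon> (inverse \<upsilon>) = inverse \<epsilon>"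
  using spec_laurent[OF eps, of 0 0] spec_laurent[OF eps, of 1 0] spec_laurent[OF eps, of "[:0, 1:]" 0]
    spec_laurent[OF eps, of 1 1] by (simp_all only: laurent_const)

lemma spec_pow: "a \<in> \<Z> \<Longrightarrow> spec \<epsilon> (a ^ n) = spec \<epsilon> a ^ n"
  by (induction n) (auto simp: spec_const spec_mult ZZ_pow)

lemma spec_powi: "spec \<epsilon> (\<upsilon> powi m) = \<epsilon> powi m"
  by (cases "m \<ge> 0") (auto simp: power_int_def spec_pow ZZ_const spec_const)

lemma spec_sum: "(\<And>i. i \<in> I \<Longrightarrow> f i \<in> \<Z>) \<Longrightarrow> spec \<epsilon> (sum f I) = (\<Sum>i\<in>I. spec \<epsilon> (f i))"
  by (induction I rule: infinite_finite_induct) (auto simp: spec_const spec_add ZZ_sum)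

end

lemma upsilon_pow_neq_1: "n > 0 \<Longrightarrow> \<upsilon> ^ n \<noteq> 1"
proof
  assume n: "n > 0" "\<upsilon> ^ n = 1"
  then have "ieval \<upsilon> (monom 1 n) = ieval \<upsilon> 1" by simp
  then have "monom 1 n = (1 :: int poly)" by (rule ieval_upsilon_inj)
  then have "coeff (monom 1 n) n = coeff (1 :: int poly) n" by simp
  then show False using n(1) by simp
qed

lemma upsilon_square: "\<upsilon> * \<upsilon> \<noteq> 1"
  using upsilon_pow_neq_1[of 2] by (simp add: power2_eq_square)

lemma upsilon_powi_diff:
  assumes "n > 0" shows "\<upsilon> powi int n - \<upsilon> powi (- int n) \<noteq> 0"
proof
  assume "\<upsilon> powi int n - \<upsilon> powi (- int n) = 0"
  then have "\<upsilon> ^ n = inverse (\<upsilon> ^ n)" by (simp only: power_int_minus power_int_of_nat right_minus_eq)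
  then have "\<upsilon> ^ n * \<upsilon> ^ n = 1"
    by (metis (no_types) power_not_zero right_inverse upsilon_nonzero)
  then have "\<upsilon> ^ (n + n) = 1" by (simp only: power_add)
  then show False using upsilon_pow_neq_1[of "n + n"] assms by simp
qed

lemma qint_qbr: "qint i = qbr \<upsilon> (int i)"
  by (simp add: qint_def qbr_def power_int_minus)

lemma qbr_upsilon_nonzero: "n > 0 \<Longrightarrow> qbr \<upsilon> (int n) \<noteq> 0"
  using upsilon_powi_diff[of n] upsilon_powi_diff[of 1] by (simp add: qbr_def power_int_minus)

section \<open>Quantum binomials as Laurent polynomials\<close>

abbreviation X :: "int \<Rightarrow> qv" where "X k \<equiv> \<upsilon> powi k - \<upsilon> powi (- k)"

lemma qbinom_0: "qbinom c 0 = 1"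
  by (simp add: qbinom_def)

lemma qbinom_step: "qbinom c (Suc t) = qbinom c t * (X (int c - int t) / X (int (Suc t)))"
proof -
  have 1: "int c - int (Suc t) + 1 = int c - int t" by simp
  have 2: "{1..Suc t} = insert (Suc t) {1..t}" by auto
  show ?thesis
    unfolding qbinom_def 2 by (subst prod.insert) (simp_all only: 1 mult.commute, simp_all)
qed

lemma qbinom_absorb: "qbinom (Suc c) (Suc t) * X (int (Suc t)) = qbinom c t * X (int (Suc c))"
proof (induction t)
  case 0
  show ?case using upsilon_powi_diff[of 1] by (simp add: qbinom_step qbinom_0)
next
  case (Suc t)
  have nz: "X (int (Suc t)) \<noteq> 0" "X (int (Suc (Suc t))) \<noteq> 0" by (rule upsilon_powi_diff, simp)+
  have "qbinom (Suc c) (Suc (Suc t)) * X (int (Suc (Suc t))) = qbinom (Suc c) (Suc t) * X (int c - int t)"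
    using nz by (simp only: qbinom_step[of "Suc c" "Suc t"]) simp
  also have "\<dots> = (qbinom (Suc c) (Suc t) * X (int (Suc t))) * X (int c - int t) / X (int (Suc t))"
    using nz by simp
  also have "\<dots> = qbinom c (Suc t) * X (int (Suc c))"
    unfolding Suc by (simp only: qbinom_step[of c t]) simp
  finally show ?case .
qed

text \<open>It gives \<open>qbinom_ZZ\<close>: although quantum binomials are defined as fractions,
  this recursion has only Laurent monomials as coefficients.\<close>

lemma qbinom_Pascal: "qbinom (Suc c) (Suc t) = \<upsilon> powi int (Suc t) * qbinom c (Suc t) + \<upsilon> powi (int t - int c) * qbinom c t"
proof -
  have nz: "X (int (Suc t)) \<noteq> 0" by (rule upsilon_powi_diff, simp)
  have p: "\<upsilon> powi a * \<upsilon> powi b = \<upsilon> powi (a + b)" for a b by (simp add: power_int_add)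
  have "X (int (Suc c)) = \<upsilon> powi int (Suc t) * X (int c - int t) + \<upsilon> powi (int t - int c) * X (int (Suc t))"
    by (simp only: right_diff_distrib p) (simp add: algebra_simps)
  then have "qbinom (Suc c) (Suc t) * X (int (Suc t)) =
     (\<upsilon> powi int (Suc t) * qbinom c (Suc t) + \<upsilon> powi (int t - int c) * qbinom c t) * X (int (Suc t))"
    unfolding qbinom_absorb using nz by (simp only: qbinom_step[of c t]) (simp add: field_simps)
  then show ?thesis using nz by simp
qed

lemma qbinom_ZZ: "qbinom c t \<in> \<Z>"
proof (induction c arbitrary: t)
  case 0
  have "qbinom 0 (Suc t) = 0" for t by (induction t) (simp_all only: qbinom_step[of 0] mult_zero_left, simp)
  then show ?case by (cases t) (auto simp: ZZ_const qbinom_0)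
next
  case (Suc c)
  then show ?case by (cases t) (auto simp: ZZ_const qbinom_0 qbinom_Pascal intro!: ZZ_add ZZ_mult ZZ_powi ZZ_pow simp del: of_nat_Suc)
qed

lemma qbinom_self: "qbinom c c = 1"
proof (induction c)
  case (Suc c)
  then show ?case using qbinom_absorb[of c c] upsilon_powi_diff[of "Suc c"] by simp
qed (simp add: qbinom_0)

lemma qbinom_eq_0: "c < t \<Longrightarrow> qbinom c t = 0"
proof (induction t)
  case (Suc t)
  then show ?case by (cases "c = t") (auto simp: qbinom_step)
qed simp

section \<open>Matrices as operators\<close>

text \<open>The matrix acts on the position \<open>i mod N\<close>, which for
  \<open>N = 2 ^ r\<close> is given by the \<open>r\<close> lowest digits, and leaves the inert part
  \<open>i div N\<close> alone.\<close>

lift_definition mop :: "nat \<Rightarrow> 'k::field mat \<Rightarrow> 'k op" is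
  "\<lambda>N M f i. \<Sum>j<N. M $$ (i mod N, j) * f (i div N * N + j)"
  by (auto simp: algebra_simps sum.distrib sum_distrib_left)

lemma mop_one: "N > 0 \<Longrightarrow> mop N (1\<^sub>m N) = 1"
proof (rule op_eqI)
  fix x :: "nat \<Rightarrow> 'a" assume N: "N > 0"
  have "(\<Sum>j<N. 1\<^sub>m N $$ (i mod N, j) * x (i div N * N + j)) = (\<Sum>j<N. if i mod N = j then x (i div N * N + j) else 0)" for i
    using N by (intro sum.cong) auto
  then show "act (mop N (1\<^sub>m N)) x = act 1 x" using N by (simp add: mop.rep_eq)
qed

lemma mop_mult:
  assumes N: "N > 0" and A: "A \<in> carrier_mat N N" and B: "B \<in> carrier_mat N N"
  shows "mop N (A * B) = mop N A * mop N B"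
proof (rule op_eqI, rule ext)
  fix x :: "nat \<Rightarrow> 'a" and i
  have "act (mop N (A * B)) x i = (\<Sum>j<N. (\<Sum>k<N. A $$ (i mod N, k) * B $$ (k, j)) * x (i div N * N + j))"
    unfolding mop.rep_eq
  proof (rule sum.cong, rule refl)
    fix j assume "j \<in> {..<N}"
    then have "(A * B) $$ (i mod N, j) = (\<Sum>k<N. A $$ (i mod N, k) * B $$ (k, j))"
      using A B N by (auto simp: scalar_prod_def atLeast0LessThan)
    then show "(A * B) $$ (i mod N, j) * x (i div N * N + j) = (\<Sum>k<N. A $$ (i mod N, k) * B $$ (k, j)) * x (i div N * N + j)"
      by simp
  qed
  also have "\<dots> = (\<Sum>k<N. A $$ (i mod N, k) * (\<Sum>j<N. B $$ (k, j) * x (i div N * N + j)))"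
    unfolding sum_distrib_left sum_distrib_right by (subst sum.swap) (simp add: mult.assoc)
  also have "\<dots> = act (mop N A * mop N B) x i"
    using N by (auto simp: mop.rep_eq intro!: sum.cong)
  finally show "act (mop N (A * B)) x i = act (mop N A * mop N B) x i" .
qed

lemma mop_add:
  assumes N: "N > 0" and A: "A \<in> carrier_mat N N" and B: "B \<in> carrier_mat N N"
  shows "mop N (A + B) = mop N A + mop N B"
  using assms by (intro op_eqI) (auto simp: mop.rep_eq fun_eq_iff algebra_simps sum.distrib[symmetric] intro!: sum.cong)

lemma mop_smult:
  assumes N: "N > 0" and A: "A \<in> carrier_mat N N"
  shows "mop N (c \<cdot>\<^sub>m A) = scal c * mop N A"
  using assms by (intro op_eqI) (auto simp: mop.rep_eq fun_eq_iff sum_distrib_left algebra_simps intro!: sum.cong)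

lemma mop_zero: "N > 0 \<Longrightarrow> mop N (0\<^sub>m N N) = 0"
  by (intro op_eqI) (auto simp: mop.rep_eq fun_eq_iff)

lemma mop_scal: "N > 0 \<Longrightarrow> mop N (c \<cdot>\<^sub>m 1\<^sub>m N) = scal c"
  by (simp add: mop_smult mop_one)

lemma mop_entry:
  assumes "i < N" "j < N"
  shows "act (mop N A) (\<lambda>m. if m = j then 1 else 0) i = A $$ (i, j)"
proof -
  have "(\<Sum>k<N. A $$ (i mod N, k) * (if i div N * N + k = j then 1 else 0)) = (\<Sum>k<N. if j = k then A $$ (i, k) else 0)"
    using assms by (intro sum.cong) auto
  then show ?thesis using assms by (simp add: mop.rep_eq)
qed

lemma mop_inj:
  assumes A: "A \<in> carrier_mat N N" and B: "B \<in> carrier_mat N N" and eq: "mop N A = mop N B"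
  shows "A = B"
proof (rule eq_matI)
  fix i j assume "i < dim_row B" "j < dim_col B"
  then have "i < N" "j < N" using B by auto
  from mop_entry[OF this, of A] mop_entry[OF this, of B] show "A $$ (i, j) = B $$ (i, j)" using eq by simp
qed (use A B in auto)

lemma sum_lessThan_double: "(\<Sum>j<2 * N. g j) = (\<Sum>j<N. g (2 * j) + g (2 * j + 1 :: nat) :: 'a::comm_monoid_add)"
  by (induction N) (simp_all add: ac_simps)

text \<open>In the lexicographic basis the second factor occupies the lowest digit, so the entries
  of \<open>B\<close> mix the even and odd parts while \<open>A\<close> acts within each of
  them.\<close>

lemma mop_kron:
  assumes N: "N > 0" and A: "A \<in> carrier_mat N N" and B: "B \<in> carrier_mat 2 2"
  shows "ev (act (mop (2 * N) (kron A B)) f) = (\<lambda>i. B $$ (0, 0) * act (mop N A) (ev f) i + B $$ (0, 1) * act (mop N A) (od f) i)"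
    and "od (act (mop (2 * N) (kron A B)) f) = (\<lambda>i. B $$ (1, 0) * act (mop N A) (ev f) i + B $$ (1, 1) * act (mop N A) (od f) i)"
proof -
  have e: "kron A B $$ (i, 2 * j) = A $$ (i div 2, j) * B $$ (i mod 2, 0)"
      "kron A B $$ (i, Suc (2 * j)) = A $$ (i div 2, j) * B $$ (i mod 2, 1)" if "i < 2 * N" "j < N" for i j
  proof -
    have "2 * j < N * 2" "Suc (2 * j) < N * 2" "i < N * 2" "Suc (2 * j) mod 2 = 1" "Suc (2 * j) div 2 = j"
      using that by auto
    then show "kron A B $$ (i, 2 * j) = A $$ (i div 2, j) * B $$ (i mod 2, 0)"
      "kron A B $$ (i, Suc (2 * j)) = A $$ (i div 2, j) * B $$ (i mod 2, 1)"
      using A B by (simp_all add: kron_def)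
  qed
  have act: "act (mop (2 * N) (kron A B)) f i =
      (\<Sum>j<N. A $$ (i div 2 mod N, j) * B $$ (i mod 2, 0) * f (2 * (i div 2 div N * N + j))
            + A $$ (i div 2 mod N, j) * B $$ (i mod 2, 1) * f (2 * (i div 2 div N * N + j) + 1))" for i
  proof -
    have m0: "i mod (2 * N) < 2 * N" using N by (intro mod_less_divisor) simp
    have m: "i mod (2 * N) div 2 = i div 2 mod N" "i mod (2 * N) mod 2 = i mod 2"
      using N by (simp_all add: mod_mult2_eq)
    have d: "i div (2 * N) * (2 * N) = 2 * (i div 2 div N * N)"
      by (simp add: div_mult2_eq)
    show ?thesis
      unfolding mop.rep_eq sum_lessThan_double d
      by (intro sum.cong refl) (use e[OF m0] m in \<open>simp add: algebra_simps\<close>)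
  qed
  have p: "2 * j div 2 = j" "2 * j mod 2 = 0" "(2 * j + 1) div 2 = j" "(2 * j + 1) mod 2 = 1" for j :: nat
    by simp_all
  show "ev (act (mop (2 * N) (kron A B)) f) = (\<lambda>i. B $$ (0, 0) * act (mop N A) (ev f) i + B $$ (0, 1) * act (mop N A) (od f) i)"
    "od (act (mop (2 * N) (kron A B)) f) = (\<lambda>i. B $$ (1, 0) * act (mop N A) (ev f) i + B $$ (1, 1) * act (mop N A) (od f) i)"
    unfolding ev_def od_def act p by (simp_all add: mop.rep_eq sum.distrib sum_distrib_left mult_ac)
qed

lemma wt_mod: "wt r (i mod 2 ^ r) = wt r i"
proof (induction r arbitrary: i)
  case (Suc r)
  have "i mod 2 ^ Suc r div 2 = i div 2 mod 2 ^ r" by (simp add: mod_mult2_eq)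
  moreover have "even (i mod 2 ^ Suc r) = even i" by (simp add: even_iff_mod_2_eq_zero mod_mult2_eq mod_mod_cancel)
  ultimately show ?case by (simp add: Suc del: power_Suc)
qed simp

definition dgmat :: "nat \<Rightarrow> (nat \<Rightarrow> 'k::field) \<Rightarrow> 'k mat" where
  "dgmat r g = mat (2 ^ r) (2 ^ r) (\<lambda>(i, j). if i = j then g (wt r i) else 0)"

lemma dgmat_carrier [simp]: "dgmat r g \<in> carrier_mat (2 ^ r) (2 ^ r)"
  by (simp add: dgmat_def)

lemma mop_dgmat: "mop (2 ^ r) (dgmat r g) = dg r g"
proof (rule op_eqI, rule ext)
  fix x :: "nat \<Rightarrow> 'a" and i
  have "(\<Sum>j<2 ^ r. dgmat r g $$ (i mod 2 ^ r, j) * x (i div 2 ^ r * 2 ^ r + j))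
    = (\<Sum>j<2 ^ r. if i mod 2 ^ r = j then g (wt r (i mod 2 ^ r)) * x (i div 2 ^ r * 2 ^ r + j) else 0)"
    by (intro sum.cong) (auto simp: dgmat_def)
  then show "act (mop (2 ^ r) (dgmat r g)) x i = act (dg r g) x i"
    unfolding mop.rep_eq dg.rep_eq by (simp add: wt_mod div_mult_mod_eq)
qed

section \<open>The representation on tensor space\<close>

lemma word_mat_carrier: "(\<And>g. \<rho> g \<in> carrier_mat d d) \<Longrightarrow> word_mat d \<rho> w \<in> carrier_mat d d"
  by (induction w) (auto simp: word_mat_def intro!: mult_carrier_mat[of _ d d])

lemma mop_word_mat:
  assumes "d > 0" "\<And>g. \<rho> g \<in> carrier_mat d d"
  shows "mop d (word_mat d \<rho> w) = foldr (\<lambda>g T. mop d (\<rho> g) * T) w 1"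
proof (induction w)
  case (Cons a w)
  have "word_mat d \<rho> (a # w) = \<rho> a * word_mat d \<rho> w" by (simp add: word_mat_def)
  then show ?case using Cons assms word_mat_carrier[OF assms(2)] by (simp add: mop_mult)
qed (simp add: word_mat_def mop_one assms)

text \<open>Closed forms at an arbitrary parameter, with \<open>K_1\<close> counting the factors
  \<open>\<omega>_1\<close> and \<open>K_2\<close> the factors \<open>\<omega>_2\<close>. At
  \<open>\<upsilon>\<close> this is the given representation, at \<open>\<epsilon>\<close> its
  specialisation.\<close>

fun gop :: "'k::field \<Rightarrow> nat \<Rightarrow> gen \<Rightarrow> 'k op" where
  "gop q r GE = Eop q r"
| "gop q r GF = Fop q r"
| "gop q r (GK I1) = dg r (\<lambda>m. q powi int m)"
| "gop q r (GK I2) = dg r (\<lambda>m. q powi (int r - int m))"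
| "gop q r (GKi I1) = dg r (\<lambda>m. q powi (- int m))"
| "gop q r (GKi I2) = dg r (\<lambda>m. q powi (int m - int r))"

lemma Omega_carrier [simp]: "Omega g \<in> carrier_mat 2 2"
  by (cases g rule: Omega.cases) (auto simp: mat_of_rows_list_def)

lemma mat2_mult: "A \<in> carrier_mat 2 2 \<Longrightarrow> B \<in> carrier_mat 2 2 \<Longrightarrow> i < 2 \<Longrightarrow> j < 2 \<Longrightarrow>
   (A * B) $$ (i, j) = A $$ (i, 0) * B $$ (0, j) + A $$ (i, 1) * (B $$ (1, j) :: 'a::semiring_1)"
  by (auto simp: scalar_prod_def numeral_2_eq_2)

lemma kron_carrier: "A \<in> carrier_mat N N \<Longrightarrow> B \<in> carrier_mat M M \<Longrightarrow> kron A B \<in> carrier_mat (N * M) (N * M)"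
  by (auto simp: kron_def)

lemma tensor_rep_carrier [simp]: "tensor_rep r g \<in> carrier_mat (2 ^ r) (2 ^ r)"
proof (induction r arbitrary: g)
  case 0
  show ?case by (cases g) auto
next
  case (Suc r)
  have "foldr (\<lambda>(a, b) S. kron (word_mat (2 ^ r) (tensor_rep r) a) (word_mat 2 Omega b) + S) xs (0\<^sub>m (2 ^ Suc r) (2 ^ Suc r))
      \<in> carrier_mat (2 ^ Suc r) (2 ^ Suc r)" for xs
  proof (induction xs)
    case (Cons x xs)
    have "kron (word_mat (2 ^ r) (tensor_rep r) (fst x)) (word_mat 2 Omega (snd x)) \<in> carrier_mat (2 ^ r * 2) (2 ^ r * 2)"
      by (intro kron_carrier word_mat_carrier Suc Omega_carrier)
    then show ?case using Cons by (auto simp: mult.commute split: prod.split)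
  qed simp
  then show ?case by simp
qed

text \<open>Splitting off the last factor by \<open>mop_kron\<close> turns the summands of
  \<open>Delta\<close> into the very recursions that define \<open>opE\<close> and
  \<open>opF\<close>.\<close>

lemma tensor_rep_op: "mop (2 ^ r) (tensor_rep r g) = gop \<upsilon> r g"
proof (induction r arbitrary: g)
  case 0
  have "mop 1 (0\<^sub>m 1 1) = (0 :: qv op)" "mop 1 (1\<^sub>m 1) = (1 :: qv op)"
    "dg 0 (\<lambda>m. \<upsilon> powi int m) = 1" "dg 0 (\<lambda>m. \<upsilon> powi (int 0 - int m)) = 1"
    "dg 0 (\<lambda>m. \<upsilon> powi (- int m)) = 1" "dg 0 (\<lambda>m. \<upsilon> powi (int m - int 0)) = 1"
    by (auto simp: mop_zero mop_one intro!: op_eqI simp: dg.rep_eq)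
  then show ?case
    by (cases g rule: Omega.cases) (simp_all add: op_eqI Eop_0 Fop_0)
next
  case (Suc r)
  let ?N = "2 ^ r :: nat"
  let ?W = "word_mat ?N (tensor_rep r)" and ?O = "word_mat 2 Omega"
  have N: "?N > 0" by simp
  have W: "?W w \<in> carrier_mat ?N ?N" and O: "?O w \<in> carrier_mat 2 2" for w
    by (auto intro: word_mat_carrier)
  have kc: "kron (?W a) (?O b) \<in> carrier_mat (2 * ?N) (2 * ?N)" for a b
    using kron_carrier[OF W O, of a b] by (simp add: mult.commute)
  have Wop: "mop ?N (?W w) = foldr (\<lambda>g T. gop \<upsilon> r g * T) w 1" for w
    using mop_word_mat[of ?N "tensor_rep r" w] Suc by simp
  have O0: "?O [] = 1\<^sub>m 2" by (simp add: word_mat_def)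
  have O1: "?O [g] = Omega g" for g by (simp add: word_mat_def right_mult_one_mat[OF Omega_carrier])
  have O2: "?O [g, h] = Omega g * Omega h" for g h by (simp add: word_mat_def right_mult_one_mat[OF Omega_carrier])
  have act1: "mop (2 * ?N) (kron (?W a) (?O b) + 0\<^sub>m (2 * ?N) (2 * ?N)) = mop (2 * ?N) (kron (?W a) (?O b))" for a b
    using kc[of a b] by simp
  have act2: "mop (2 * ?N) (kron (?W a) (?O b) + (kron (?W c) (?O d) + 0\<^sub>m (2 * ?N) (2 * ?N)))
     = mop (2 * ?N) (kron (?W a) (?O b)) + mop (2 * ?N) (kron (?W c) (?O d))" for a b c d
    using kc[of a b] kc[of c d] by (simp add: mop_add)
  note kr = mop_kron[OF N W O]
  have pw: "\<upsilon> powi (1 + m) = \<upsilon> * \<upsilon> powi m" "\<upsilon> powi (m - 1) = inverse \<upsilon> * \<upsilon> powi m"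
    "\<upsilon> powi (1 + m - n) = \<upsilon> * \<upsilon> powi (m - n)" "\<upsilon> powi (- 1 - m) = inverse \<upsilon> * \<upsilon> powi (- m)"
    "\<upsilon> powi (m - (1 + n)) = inverse \<upsilon> * \<upsilon> powi (m - n)" for m n
    by (simp_all add: power_int_add power_int_diff power_int_minus divide_inverse)
  have E: "Omega GE $$ (0, 0) = 0" "Omega GE $$ (0, 1) = 1" "Omega GE $$ (1, 0) = 0" "Omega GE $$ (1, 1) = 0"
    and F: "Omega GF $$ (0, 0) = 0" "Omega GF $$ (0, 1) = 0" "Omega GF $$ (1, 0) = 1" "Omega GF $$ (1, 1) = 0"
    and I: "1\<^sub>m 2 $$ (0, 0) = (1::qv)" "1\<^sub>m 2 $$ (0, 1) = (0::qv)" "1\<^sub>m 2 $$ (1, 0) = (0::qv)" "1\<^sub>m 2 $$ (1, 1) = (1::qv)"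
    and K: "Omega (GK I1) $$ (0, 0) = \<upsilon>" "Omega (GK I1) $$ (1, 1) = 1" "Omega (GK I2) $$ (0, 0) = 1" "Omega (GK I2) $$ (1, 1) = \<upsilon>"
      "Omega (GKi I1) $$ (0, 0) = inverse \<upsilon>" "Omega (GKi I1) $$ (1, 1) = 1"
      "Omega (GKi I2) $$ (0, 0) = 1" "Omega (GKi I2) $$ (1, 1) = inverse \<upsilon>"
      "Omega (GK i) $$ (0, 1) = 0" "Omega (GK i) $$ (1, 0) = 0" "Omega (GKi i) $$ (0, 1) = 0" "Omega (GKi i) $$ (1, 0) = 0"
    for i by ((cases i)?; simp add: mat_of_rows_list_def)+
  have Kp: "(Omega (GK I1) * Omega (GKi I2)) $$ (i, j) = (if i \<noteq> j then 0 else if i = 0 then \<upsilon> else inverse \<upsilon>)" if "i < 2" "j < 2" for i j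
    using that K by (auto simp: mat2_mult less_2_cases_iff simp del: Omega.simps)
  note ent = E F I K Kp
  have Kinv: "gop \<upsilon> r (GK I2) * gop \<upsilon> r (GKi I1) = Kinv \<upsilon> r"
    unfolding gop.simps dg_mult Kinv_def by (rule dg_cong) (simp add: power_int_add[symmetric])
  show ?case
  proof (cases g)
    case GE
    have "mop (2 * ?N) (tensor_rep (Suc r) GE) = mop (2 * ?N) (kron (?W [GE]) (?O [GK I1, GKi I2])) + mop (2 * ?N) (kron (?W []) (?O [GE]))"
      using act2 by simp
    also have "\<dots> = Eop \<upsilon> (Suc r)"
      by (rule op_eqI; rule ev_od_eqI; simp only: plus_op.rep_eq ev_od_lin kr Wop Eop_Suc)
         (simp_all add: O0 O1 O2 ent del: Omega.simps One_nat_def)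
    finally show ?thesis using GE by simp
  next
    case GF
    have "mop (2 * ?N) (tensor_rep (Suc r) GF) = mop (2 * ?N) (kron (?W [GF]) (?O [])) + mop (2 * ?N) (kron (?W [GK I2, GKi I1]) (?O [GF]))"
      using act2 by simp
    also have "\<dots> = Fop \<upsilon> (Suc r)"
      by (rule op_eqI; rule ev_od_eqI; simp only: plus_op.rep_eq ev_od_lin kr Wop Fop_Suc)
         (simp_all add: O0 O1 O2 ent Kinv del: Omega.simps One_nat_def gop.simps(3-))
    finally show ?thesis using GF by simp
  next
    case (GK i)
    have "mop (2 * ?N) (tensor_rep (Suc r) (GK i)) = mop (2 * ?N) (kron (?W [GK i]) (?O [GK i]))"
      using act1 by simp
    also have "\<dots> = gop \<upsilon> (Suc r) (GK i)"
      by (cases i; rule op_eqI; rule ev_od_eqI; simp only: ev_od_lin kr Wop gop.simps dg_Suc)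
         (simp_all add: O1 ent dg.rep_eq pw algebra_simps del: Omega.simps One_nat_def)
    finally show ?thesis using GK by simp
  next
    case (GKi i)
    have "mop (2 * ?N) (tensor_rep (Suc r) (GKi i)) = mop (2 * ?N) (kron (?W [GKi i]) (?O [GKi i]))"
      using act1 by simp
    also have "\<dots> = gop \<upsilon> (Suc r) (GKi i)"
      by (cases i; rule op_eqI; rule ev_od_eqI; simp only: ev_od_lin kr Wop gop.simps dg_Suc)
         (simp_all add: O1 ent dg.rep_eq pw algebra_simps del: Omega.simps One_nat_def)
    finally show ?thesis using GKi by simp
  qed
qed

section \<open>Homomorphisms out of monoid algebras and quotient rings\<close>

text \<open>The linear extension of a multiplicative map. It serves twice, for the words in the
  generators and for the multiplicative monoid of \<open>UZ\<close>.\<close>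

lemma monoid_algebra_lift:
  fixes f :: "'m \<Rightarrow> 'c::comm_ring_1 mat" and N :: nat
  defines "h \<equiv> \<lambda>p. mat N N (\<lambda>ij. \<Sum>w\<in>Poly_Mapping.keys p. Poly_Mapping.lookup p w * f w $$ ij)"
  assumes G: "monoid G" and f: "\<And>a. a \<in> carrier G \<Longrightarrow> f a \<in> carrier_mat N N"
    and f_mult: "\<And>a b. a \<in> carrier G \<Longrightarrow> b \<in> carrier G \<Longrightarrow> f (a \<otimes>\<^bsub>G\<^esub> b) = f a * f b"
    and f_one: "f \<one>\<^bsub>G\<^esub> = 1\<^sub>m N"
  shows "h \<in> ring_hom (monoid_algebra G) (ring_mat TYPE('c) N ())"
    and "h (p + p') = h p + h p'"
    and "a \<in> carrier G \<Longrightarrow> h (Poly_Mapping.single a c) = c \<cdot>\<^sub>m f a"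
proof -
  define L where "L p ij = (\<Sum>w\<in>Poly_Mapping.keys p. Poly_Mapping.lookup p w * f w $$ ij)" for p ij
  have h: "h p = mat N N (L p)" for p unfolding h_def L_def ..
  have L_sup: "L p ij = (\<Sum>w\<in>S. Poly_Mapping.lookup p w * f w $$ ij)"
    if "finite S" "Poly_Mapping.keys p \<subseteq> S" for p ij S
    unfolding L_def by (rule sum.mono_neutral_left) (use that in \<open>auto simp: in_keys_iff\<close>)
  have L_add: "L (p + q) ij = L p ij + L q ij" for p q ij
  proof -
    let ?S = "Poly_Mapping.keys p \<union> Poly_Mapping.keys q"
    have "finite ?S" "Poly_Mapping.keys (p + q) \<subseteq> ?S" by (auto dest: subsetD[OF Poly_Mapping.keys_add])
    then show ?thesis
      using L_sup[of ?S p] L_sup[of ?S q] L_sup[of ?S "p + q"]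
      by (simp add: lookup_add distrib_right sum.distrib)
  qed
  have L_0: "L 0 ij = 0" for ij by (simp add: L_def)
  have L_sum: "L (sum g I) ij = (\<Sum>i\<in>I. L (g i) ij)" for g :: "'m \<Rightarrow> _" and I ij
    by (induction I rule: infinite_finite_induct) (simp_all add: L_0 L_add)
  have L_single: "L (Poly_Mapping.single a c) ij = c * f a $$ ij" for a c ij
    by (subst L_sup[of "{a}"]) auto
  show add: "h (p + p') = h p + h p'" for p p'
    unfolding h by (rule eq_matI) (auto simp: L_add)
  show single: "a \<in> carrier G \<Longrightarrow> h (Poly_Mapping.single a c) = c \<cdot>\<^sub>m f a" for a c
    unfolding h using f[of a] by (intro eq_matI) (auto simp: L_single)
  show "h \<in> ring_hom (monoid_algebra G) (ring_mat TYPE('c) N ())"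
  proof (rule ring_hom_memI)
    fix p q :: "'m \<Rightarrow>\<^sub>0 'c"
    assume p: "p \<in> carrier (monoid_algebra G)" and q: "q \<in> carrier (monoid_algebra G)"
    then have car: "Poly_Mapping.keys p \<subseteq> carrier G" "Poly_Mapping.keys q \<subseteq> carrier G"
      by (auto simp: monoid_algebra_def)
    show "h p \<in> carrier (ring_mat TYPE('c) N ())" by (simp add: h ring_mat_simps)
    show "h (p \<oplus>\<^bsub>monoid_algebra G\<^esub> q) = h p \<oplus>\<^bsub>ring_mat TYPE('c) N ()\<^esub> h q"
      by (simp add: add ring_mat_simps) (simp add: monoid_algebra_def add)
    have "h (p \<otimes>\<^bsub>monoid_algebra G\<^esub> q) = h p * h q"
    proof (rule eq_matI)
      fix i j assume ij: "i < dim_row (h p * h q)" "j < dim_col (h p * h q)"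
      then have ij': "i < N" "j < N" by (auto simp: h)
      let ?P = "Poly_Mapping.keys p" and ?Q = "Poly_Mapping.keys q"
      have "h (p \<otimes>\<^bsub>monoid_algebra G\<^esub> q) $$ (i, j) = L (p \<otimes>\<^bsub>monoid_algebra G\<^esub> q) (i, j)"
        using ij' by (simp add: h)
      also have "\<dots> = (\<Sum>a\<in>?P. \<Sum>b\<in>?Q. Poly_Mapping.lookup p a * Poly_Mapping.lookup q b * f (a \<otimes>\<^bsub>G\<^esub> b) $$ (i, j))"
        by (subst monoid_algebra_mult_eq[OF finite_keys order_refl finite_keys order_refl]) (simp only: L_sum L_single)
      also have "\<dots> = (\<Sum>a\<in>?P. \<Sum>b\<in>?Q. \<Sum>k<N. (Poly_Mapping.lookup p a * f a $$ (i, k)) * (Poly_Mapping.lookup q b * f b $$ (k, j)))"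
      proof (intro sum.cong refl)
        fix a b assume ab: "a \<in> ?P" "b \<in> ?Q"
        then have "f a \<in> carrier_mat N N" "f b \<in> carrier_mat N N" "f (a \<otimes>\<^bsub>G\<^esub> b) = f a * f b"
          using car f f_mult by blast+
        then have "f (a \<otimes>\<^bsub>G\<^esub> b) $$ (i, j) = (\<Sum>k<N. f a $$ (i, k) * f b $$ (k, j))"
          using ij' by (auto simp: scalar_prod_def atLeast0LessThan)
        then show "Poly_Mapping.lookup p a * Poly_Mapping.lookup q b * f (a \<otimes>\<^bsub>G\<^esub> b) $$ (i, j)
            = (\<Sum>k<N. (Poly_Mapping.lookup p a * f a $$ (i, k)) * (Poly_Mapping.lookup q b * f b $$ (k, j)))"
          by (simp add: sum_distrib_left mult_ac)
      qed
      also have "\<dots> = (\<Sum>a\<in>?P. \<Sum>k<N. \<Sum>b\<in>?Q. (Poly_Mapping.lookup p a * f a $$ (i, k)) * (Poly_Mapping.lookup q b * f b $$ (k, j)))"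
        by (rule sum.cong[OF refl], rule sum.swap)
      also have "\<dots> = (\<Sum>k<N. \<Sum>a\<in>?P. \<Sum>b\<in>?Q. (Poly_Mapping.lookup p a * f a $$ (i, k)) * (Poly_Mapping.lookup q b * f b $$ (k, j)))"
        by (rule sum.swap)
      also have "\<dots> = (\<Sum>k<N. L p (i, k) * L q (k, j))"
        by (simp only: L_def sum_product)
      also have "\<dots> = (h p * h q) $$ (i, j)"
        using ij' unfolding h by (simp add: scalar_prod_def atLeast0LessThan)
      finally show "h (p \<otimes>\<^bsub>monoid_algebra G\<^esub> q) $$ (i, j) = (h p * h q) $$ (i, j)" .
    qed (auto simp: h)
    then show "h (p \<otimes>\<^bsub>monoid_algebra G\<^esub> q) = h p \<otimes>\<^bsub>ring_mat TYPE('c) N ()\<^esub> h q" by (simp add: ring_mat_simps)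
  next
    have "\<one>\<^bsub>monoid_algebra G\<^esub> = Poly_Mapping.single \<one>\<^bsub>G\<^esub> (1 :: 'c)" by (simp add: monoid_algebra_def)
    then show "h \<one>\<^bsub>monoid_algebra G\<^esub> = \<one>\<^bsub>ring_mat TYPE('c) N ()\<^esub>"
      using single[of "\<one>\<^bsub>G\<^esub>" 1] monoid.one_closed[OF G] by (simp add: ring_mat_simps f_one) auto
  qed
qed

text \<open>A homomorphism that vanishes on the generators of an ideal is constant on its cosets, so
  \<open>the_elem\<close> in \<open>zeta_U\<close> and \<open>zeta\<close> is applied to singletons
  and yields homomorphisms.\<close>

lemma quotient_lift:
  assumes R: "ring R" and M: "ring M" and S: "S \<subseteq> carrier R" and h: "h \<in> ring_hom R M"
    and S0: "\<And>s. s \<in> S \<Longrightarrow> h s = \<zero>\<^bsub>M\<^esub>"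
  shows "x \<in> carrier R \<Longrightarrow> the_elem (h ` (genideal R S +>\<^bsub>R\<^esub> x)) = h x"
    and "(\<lambda>X. the_elem (h ` X)) \<in> ring_hom (R Quot genideal R S) M"
proof -
  interpret R: ring R by fact
  interpret M: ring M by fact
  interpret h: ring_hom_ring R M h by (rule ring_hom_ringI2[OF R M h])
  let ?I = "genideal R S"
  interpret I: ideal ?I R by (rule R.genideal_ideal[OF S])
  have "?I \<subseteq> a_kernel R M h"
  proof (rule R.genideal_minimal[OF h.kernel_is_ideal], rule subsetI)
    fix s assume "s \<in> S"
    then show "s \<in> a_kernel R M h" unfolding a_kernel_def' using S S0 by blast
  qed
  then have I0: "h i = \<zero>\<^bsub>M\<^esub>" if "i \<in> ?I" for i using that unfolding a_kernel_def' by blast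
  show the: "the_elem (h ` (?I +>\<^bsub>R\<^esub> x)) = h x" if x: "x \<in> carrier R" for x
  proof -
    have "h ` (?I +>\<^bsub>R\<^esub> x) = {h x}"
    proof
      show "h ` (?I +>\<^bsub>R\<^esub> x) \<subseteq> {h x}"
      proof
        fix y assume "y \<in> h ` (?I +>\<^bsub>R\<^esub> x)"
        then obtain i where "i \<in> ?I" "y = h (i \<oplus>\<^bsub>R\<^esub> x)" by (auto simp: a_r_coset_def')
        then show "y \<in> {h x}" using I0[of i] x I.Icarr[of i] by simp
      qed
      show "{h x} \<subseteq> h ` (?I +>\<^bsub>R\<^esub> x)" using I.a_rcos_self[OF x] by blast
    qed
    then show ?thesis by simp
  qed
  have car: "\<exists>x\<in>carrier R. X = ?I +>\<^bsub>R\<^esub> x" if "X \<in> carrier (R Quot ?I)" for X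
    using that by (auto simp: FactRing_def A_RCOSETS_def')
  show "(\<lambda>X. the_elem (h ` X)) \<in> ring_hom (R Quot ?I) M"
  proof (rule ring_hom_memI)
    fix X Y assume "X \<in> carrier (R Quot ?I)" "Y \<in> carrier (R Quot ?I)"
    then obtain x y where x: "x \<in> carrier R" "X = ?I +>\<^bsub>R\<^esub> x" and y: "y \<in> carrier R" "Y = ?I +>\<^bsub>R\<^esub> y"
      using car by meson
    show "the_elem (h ` X) \<in> carrier M" using x by (simp add: the)
    show "the_elem (h ` (X \<otimes>\<^bsub>R Quot ?I\<^esub> Y)) = the_elem (h ` X) \<otimes>\<^bsub>M\<^esub> the_elem (h ` Y)"
      using x y by (simp add: FactRing_def I.rcoset_mult_add the)
    show "the_elem (h ` (X \<oplus>\<^bsub>R Quot ?I\<^esub> Y)) = the_elem (h ` X) \<oplus>\<^bsub>M\<^esub> the_elem (h ` Y)"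
      using x y by (simp add: FactRing_def I.a_rcos_sum the)
  next
    show "the_elem (h ` \<one>\<^bsub>R Quot ?I\<^esub>) = \<one>\<^bsub>M\<^esub>"
      by (simp add: FactRing_def the)
  qed
qed

lemma ring_hom_generate_ring:
  assumes R: "ring R" and M: "ring M" and h: "h \<in> ring_hom R M" and S: "S \<subseteq> carrier R"
  shows "h ` generate_ring R S = generate_ring M (h ` S)"
proof -
  interpret R: ring R by fact
  interpret M: ring M by fact
  interpret h: ring_hom_ring R M h by (rule ring_hom_ringI2[OF R M h])
  have car: "x \<in> carrier R" if "x \<in> generate_ring R S" for x
    using R.generate_ring_in_carrier[OF S that] .
  have "h x \<in> generate_ring M (h ` S)" if "x \<in> generate_ring R S" for x
    using that by (induction rule: generate_ring.induct) (auto simp: car intro: generate_ring.intros)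
  moreover have "y \<in> h ` generate_ring R S" if "y \<in> generate_ring M (h ` S)" for y
    using that
  proof (induction rule: generate_ring.induct)
    case one
    show ?case by (rule image_eqI[of _ _ "\<one>\<^bsub>R\<^esub>"]) (auto intro: generate_ring.intros)
  next
    case (incl y)
    then show ?case by (auto intro: generate_ring.intros)
  next
    case (a_inv y)
    then obtain x where "x \<in> generate_ring R S" "y = h x" by blast
    then show ?case by (intro image_eqI[of _ _ "\<ominus>\<^bsub>R\<^esub> x"]) (auto simp: car intro: generate_ring.intros)
  next
    case (eng_add y1 y2)
    then obtain x1 x2 where "x1 \<in> generate_ring R S" "y1 = h x1" "x2 \<in> generate_ring R S" "y2 = h x2" by blast
    then show ?case by (intro image_eqI[of _ _ "x1 \<oplus>\<^bsub>R\<^esub> x2"]) (auto simp: car intro: generate_ring.intros)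
  next
    case (eng_mult y1 y2)
    then obtain x1 x2 where "x1 \<in> generate_ring R S" "y1 = h x1" "x2 \<in> generate_ring R S" "y2 = h x2" by blast
    then show ?case by (intro image_eqI[of _ _ "x1 \<otimes>\<^bsub>R\<^esub> x2"]) (auto simp: car intro: generate_ring.intros)
  qed
  ultimately show ?thesis by blast
qed

lemma ring_mat_uminus:
  assumes "A \<in> carrier_mat n n"
  shows "\<ominus>\<^bsub>ring_mat TYPE('a::comm_ring_1) n ()\<^esub> A = - A"
proof -
  interpret ring "ring_mat TYPE('a) n ()" by (rule ring_mat)
  have "- A + A = 0\<^sub>m n n" using assms by (rule uminus_l_inv_mat)
  then show ?thesis using minus_equality[of "- A" A] assms by (simp add: ring_mat_simps)
qed

section \<open>From the enveloping algebra to matrices\<close>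

abbreviation "MR r \<equiv> ring_mat TYPE(qv) (2 ^ r) ()"

lemma free_alg_ring: "ring free_alg"
  by (rule monoid.monoid_algebra_ring[OF monoid_words])

lemma free_alg_carrier [simp]: "x \<in> carrier free_alg"
  by (simp add: monoid_algebra_def words_def)

lemma word_mat_append:
  assumes "\<And>g. \<rho> g \<in> carrier_mat d d"
  shows "word_mat d \<rho> (u @ v) = word_mat d \<rho> u * word_mat d \<rho> v"
proof (induction u)
  case Nil
  show ?case using word_mat_carrier[of \<rho> d v, OF assms] by (simp add: word_mat_def)
next
  case (Cons g u)
  have 1: "word_mat d \<rho> (g # w) = \<rho> g * word_mat d \<rho> w" for w by (simp add: word_mat_def)
  show ?case
    unfolding append_Cons 1 Cons
    by (rule assoc_mult_mat[of _ d d _ d _ d, symmetric]) (use assms word_mat_carrier[of \<rho> d, OF assms] in auto)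
qed

lemma zeta_free:
  "zeta_free r \<in> ring_hom free_alg (MR r)"
  "zeta_free r (p + p') = zeta_free r p + zeta_free r p'"
  "zeta_free r (cwd c w) = c \<cdot>\<^sub>m word_mat (2 ^ r) (tensor_rep r) w"
proof -
  have 1: "word_mat (2 ^ r) (tensor_rep r) a \<in> carrier_mat (2 ^ r) (2 ^ r)" for a
    by (rule word_mat_carrier) simp
  have 2: "word_mat (2 ^ r) (tensor_rep r) (a \<otimes>\<^bsub>words\<^esub> b)
      = word_mat (2 ^ r) (tensor_rep r) a * word_mat (2 ^ r) (tensor_rep r) b" for a b
    by (simp add: words_def word_mat_append)
  have 3: "word_mat (2 ^ r) (tensor_rep r) \<one>\<^bsub>words\<^esub> = 1\<^sub>m (2 ^ r)"
    by (simp add: words_def word_mat_def)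
  have 4: "a \<in> carrier words" for a by (simp add: words_def)
  note lift = monoid_algebra_lift[OF monoid_words, where N = "2 ^ r" and f = "word_mat (2 ^ r) (tensor_rep r)", OF 1 2 3]
  show "zeta_free r \<in> ring_hom free_alg (MR r)"
    unfolding zeta_free_def[abs_def] by (rule lift(1))
  show "zeta_free r (p + p') = zeta_free r p + zeta_free r p'"
    unfolding zeta_free_def by (rule lift(2))
  show "zeta_free r (cwd c w) = c \<cdot>\<^sub>m word_mat (2 ^ r) (tensor_rep r) w"
    unfolding zeta_free_def by (rule lift(3)) (rule 4)
qed

lemma zeta_free_carrier: "zeta_free r p \<in> carrier_mat (2 ^ r) (2 ^ r)"
  by (simp add: zeta_free_def)

definition hop :: "nat \<Rightarrow> (gen list \<Rightarrow>\<^sub>0 qv) \<Rightarrow> qv op" where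
  "hop r p = mop (2 ^ r) (zeta_free r p)"

lemma hop_add: "hop r (p + p') = hop r p + hop r p'"
  by (simp add: hop_def zeta_free(2) mop_add zeta_free_carrier)

lemma hop_diff: "hop r (p - p') = hop r p - hop r p'"
  using hop_add[of r "p - p'" p'] by (simp add: algebra_simps)

lemma hop_cwd: "hop r (cwd c w) = scal c * foldr (\<lambda>g T. gop \<upsilon> r g * T) w 1"
  by (simp add: hop_def zeta_free(3) mop_smult mop_word_mat word_mat_carrier tensor_rep_op)

lemma scal_one: "scal 1 = 1"
  by (rule op_eqI) simp

lemma dg_one: "dg r (\<lambda>_. 1) = 1"
  by (simp add: scal_dg[of 1 r, symmetric] scal_one)

lemma gop_K_commute: "gop q r (GK i) * gop q r (GK j) = gop q r (GK j) * gop q r (GK i)"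
  by (cases i; cases j) (simp_all add: dg_mult mult.commute)

lemma gop_K_inverse:
  assumes "q \<noteq> 0"
  shows "gop q r (GK i) * gop q r (GKi i) = 1" "gop q r (GKi i) * gop q r (GK i) = 1"
proof -
  have "q powi a * q powi b = 1" if "a + b = 0" for a b
    using assms that power_int_add[of q a b] by simp
  then have "dg r (\<lambda>m. q powi f m * q powi g m) = 1" if "\<And>m. f m + g m = 0" for f g
    using that by (simp only: dg_one)
  then show "gop q r (GK i) * gop q r (GKi i) = 1" "gop q r (GKi i) * gop q r (GK i) = 1"
    by (cases i; simp only: gop.simps dg_mult; simp)+
qed

lemma mult_powi:
  fixes q :: "'k::field"
  assumes "q \<noteq> 0"
  shows "q * q powi a = q powi (a + 1)" "inverse q * q powi a = q powi (a - 1)"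
  using assms by (simp_all add: power_int_add power_int_diff divide_inverse)

lemma gop_K_E:
  assumes "q \<noteq> 0"
  shows "gop q r (GK I1) * Eop q r = scal q * (Eop q r * gop q r (GK I1))"
    and "gop q r (GK I2) * Eop q r = scal (inverse q) * (Eop q r * gop q r (GK I2))"
proof -
  have s: "Eop q r * (scal c * T) = scal c * (Eop q r * T)" for c T
    by (rule op_eqI) (simp add: act_cmult)
  have "dg r (\<lambda>m. q powi int (Suc m)) = scal q * gop q r (GK I1)"
    unfolding gop.simps dg_scal mult_powi[OF assms] by (rule dg_cong, rule arg_cong[of _ _ "\<lambda>x. q powi x"]) simp
  then show "gop q r (GK I1) * Eop q r = scal q * (Eop q r * gop q r (GK I1))"
    using Eop_dg[of q r "\<lambda>m. q powi int m"] by (simp only: s gop.simps)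
  have "dg r (\<lambda>m. q powi (int r - int (Suc m))) = scal (inverse q) * gop q r (GK I2)"
    unfolding gop.simps dg_scal mult_powi[OF assms] by (rule dg_cong, rule arg_cong[of _ _ "\<lambda>x. q powi x"]) simp
  then show "gop q r (GK I2) * Eop q r = scal (inverse q) * (Eop q r * gop q r (GK I2))"
    using Eop_dg[of q r "\<lambda>m. q powi (int r - int m)"] by (simp only: s gop.simps)
qed

lemma gop_K_F:
  assumes "q \<noteq> 0"
  shows "gop q r (GK I1) * Fop q r = scal (inverse q) * (Fop q r * gop q r (GK I1))"
    and "gop q r (GK I2) * Fop q r = scal q * (Fop q r * gop q r (GK I2))"
proof -
  have "scal (inverse q) * dg r (\<lambda>m. q powi int (Suc m)) = gop q r (GK I1)"
    unfolding gop.simps dg_scal mult_powi[OF assms] by (rule dg_cong, rule arg_cong[of _ _ "\<lambda>x. q powi x"]) simp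
  then show "gop q r (GK I1) * Fop q r = scal (inverse q) * (Fop q r * gop q r (GK I1))"
    unfolding gop.simps Fop_dg by (simp only: mult.assoc[symmetric])
  have "scal q * dg r (\<lambda>m. q powi (int r - int (Suc m))) = gop q r (GK I2)"
    unfolding gop.simps dg_scal mult_powi[OF assms] by (rule dg_cong, rule arg_cong[of _ _ "\<lambda>x. q powi x"]) simp
  then show "gop q r (GK I2) * Fop q r = scal q * (Fop q r * gop q r (GK I2))"
    unfolding gop.simps Fop_dg by (simp only: mult.assoc[symmetric])
qed

lemma gop_E_F:
  assumes "q \<noteq> 0" "q * q \<noteq> 1"
  shows "Eop q r * Fop q r - Fop q r * Eop q r =
     scal (1 / (q - inverse q)) * (gop q r (GK I1) * gop q r (GKi I2)) - scal (1 / (q - inverse q)) * (gop q r (GK I2) * gop q r (GKi I1))"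
proof -
  have pm: "q powi a * q powi b = q powi (a + b)" for a b
    using assms by (simp add: power_int_add)
  have "dg r (\<lambda>m. qbr q (2 * int m - int r)) + dg r (\<lambda>m. q powi (int r - 2 * int m) / (q - inverse q))
      = dg r (\<lambda>m. q powi (2 * int m - int r) / (q - inverse q))"
    unfolding dg_add by (rule dg_cong) (simp add: qbr_def diff_divide_distrib)
  moreover have "scal (1 / (q - inverse q)) * (gop q r (GK I1) * gop q r (GKi I2)) = dg r (\<lambda>m. q powi (2 * int m - int r) / (q - inverse q))"
    unfolding gop.simps dg_mult dg_scal
    by (rule dg_cong) (simp only: pm, simp)
  moreover have "scal (1 / (q - inverse q)) * (gop q r (GK I2) * gop q r (GKi I1)) = dg r (\<lambda>m. q powi (int r - 2 * int m) / (q - inverse q))"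
    unfolding gop.simps dg_mult dg_scal
    by (rule dg_cong) (simp only: pm, simp)
  ultimately show ?thesis using Eop_Fop[OF assms] by (simp add: algebra_simps)
qed

text \<open>The relations are checked on operators, where they are identities for
  \<open>gop\<close>; injectivity of \<open>mop\<close> brings them back to matrices.\<close>

lemma hop_relations:
  assumes "s \<in> U_relations"
  shows "hop r s = 0"
proof -
  have u: "\<upsilon> powi (-1) = inverse \<upsilon>" by (simp add: power_int_minus)
  have EF: "gop \<upsilon> r GE * gop \<upsilon> r GF - gop \<upsilon> r GF * gop \<upsilon> r GE =
     scal (1 / (\<upsilon> - inverse \<upsilon>)) * (gop \<upsilon> r (GK I1) * gop \<upsilon> r (GKi I2)) - scal (1 / (\<upsilon> - inverse \<upsilon>)) * (gop \<upsilon> r (GK I2) * gop \<upsilon> r (GKi I1))"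
    using gop_E_F[OF upsilon_nonzero upsilon_square] by (simp only: gop.simps(1,2))
  note rels = gop_K_E[OF upsilon_nonzero, folded gop.simps(1)] gop_K_F[OF upsilon_nonzero, folded gop.simps(2)]
    gop_K_inverse[OF upsilon_nonzero] gop_K_commute[of \<upsilon> r I1 I2]
  show ?thesis
    using assms unfolding U_relations_def u
    by (elim UnE UN_E insertE singletonE emptyE; hypsubst)
       (simp_all only: hop_diff hop_cwd foldr.simps o_apply id_apply mult_1_right mult_1_left scal_one rels EF diff_self)
qed

lemma zeta_free_relations: "s \<in> U_relations \<Longrightarrow> zeta_free r s = \<zero>\<^bsub>MR r\<^esub>"
  using hop_relations[of s r] unfolding hop_def ring_mat_simps
  by (intro mop_inj[of _ "2 ^ r"]) (simp_all add: zeta_free_carrier mop_zero)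

lemma U_ring: "ring U"
  unfolding U_def U_ideal_def
  by (intro ideal.quotient_is_ring ring.genideal_ideal free_alg_ring subsetI free_alg_carrier)

lemma zeta_U_hom: "zeta_U r \<in> ring_hom U (MR r)"
  and zeta_U_coset: "zeta_U r (U_ideal +>\<^bsub>free_alg\<^esub> p) = zeta_free r p"
proof -
  have sub: "U_relations \<subseteq> carrier free_alg" by (rule subsetI, rule free_alg_carrier)
  note l = quotient_lift[OF free_alg_ring ring_mat sub zeta_free(1) zeta_free_relations]
  show "zeta_U r \<in> ring_hom U (MR r)"
    unfolding zeta_U_def[abs_def] U_def U_ideal_def by (rule l(2), assumption)
  show "zeta_U r (U_ideal +>\<^bsub>free_alg\<^esub> p) = zeta_free r p"
    unfolding zeta_U_def U_ideal_def by (rule l(1), assumption, rule free_alg_carrier)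
qed

lemma U_scal_carrier [simp]: "U_scal c \<in> carrier U" and U_gen_carrier [simp]: "U_gen g \<in> carrier U"
proof -
  interpret ideal U_ideal free_alg
    unfolding U_ideal_def by (intro ring.genideal_ideal free_alg_ring subsetI free_alg_carrier)
  show "U_scal c \<in> carrier U" "U_gen g \<in> carrier U"
    unfolding U_def U_scal_def U_gen_def FactRing_def by (simp_all add: a_rcosetsI[OF a_subset])
qed

lemma U_scal_one: "U_scal 1 = \<one>\<^bsub>U\<^esub>"
proof -
  have "wd [] = \<one>\<^bsub>free_alg\<^esub>" by (simp add: monoid_algebra_def words_def)
  then show ?thesis by (simp add: U_scal_def U_def FactRing_def)
qed

definition uop :: "nat \<Rightarrow> U_elem \<Rightarrow> qv op" where
  "uop r u = mop (2 ^ r) (zeta_U r u)"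

lemma zeta_U_carrier: "u \<in> carrier U \<Longrightarrow> zeta_U r u \<in> carrier_mat (2 ^ r) (2 ^ r)"
  using ring_hom_closed[OF zeta_U_hom, of u r] by (simp add: ring_mat_simps)

lemma uop_mult: "u \<in> carrier U \<Longrightarrow> v \<in> carrier U \<Longrightarrow> uop r (u \<otimes>\<^bsub>U\<^esub> v) = uop r u * uop r v"
  using ring_hom_mult[OF zeta_U_hom, of u v r] by (simp add: ring_mat_simps uop_def mop_mult zeta_U_carrier)

lemma uop_add: "u \<in> carrier U \<Longrightarrow> v \<in> carrier U \<Longrightarrow> uop r (u \<oplus>\<^bsub>U\<^esub> v) = uop r u + uop r v"
  using ring_hom_add[OF zeta_U_hom, of u v r] by (simp add: ring_mat_simps uop_def mop_add zeta_U_carrier)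

lemma uop_one: "uop r \<one>\<^bsub>U\<^esub> = 1"
  using ring_hom_one[OF zeta_U_hom, of r] by (simp add: ring_mat_simps uop_def mop_one)

lemma uop_zero: "uop r \<zero>\<^bsub>U\<^esub> = 0"
proof -
  interpret ring U by (rule U_ring)
  show ?thesis using uop_add[of "\<zero>\<^bsub>U\<^esub>" "\<zero>\<^bsub>U\<^esub>" r] by simp
qed

lemma uop_uminus: assumes "u \<in> carrier U" shows "uop r (\<ominus>\<^bsub>U\<^esub> u) = - uop r u"
proof -
  interpret ring U by (rule U_ring)
  show ?thesis using uop_add[of "\<ominus>\<^bsub>U\<^esub> u" u r] assms by (simp add: l_neg uop_zero eq_neg_iff_add_eq_0)
qed

lemma uop_minus: assumes "u \<in> carrier U" "v \<in> carrier U" shows "uop r (u \<ominus>\<^bsub>U\<^esub> v) = uop r u - uop r v"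
proof -
  interpret ring U by (rule U_ring)
  show ?thesis using assms by (simp add: a_minus_def uop_add uop_uminus)
qed

lemma uop_scal: "uop r (U_scal c) = scal c"
  unfolding uop_def U_scal_def zeta_U_coset using hop_cwd[where c = c and w = "[]"] by (simp add: hop_def)

lemma uop_gen: "uop r (U_gen g) = gop \<upsilon> r g"
  unfolding uop_def U_gen_def zeta_U_coset using hop_cwd[where c = 1 and w = "[g]"] by (simp add: hop_def scal_one)

lemma uop_pow: assumes "u \<in> carrier U" shows "uop r (u [^]\<^bsub>U\<^esub> (m::nat)) = uop r u ^ m"
proof -
  interpret ring U by (rule U_ring)
  show ?thesis by (induction m) (simp_all add: uop_one uop_mult assms nat_pow_Suc power_Suc2 del: power_Suc)
qed

lemma U_divpow_carrier: "U_divpow g m \<in> carrier U"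
proof -
  interpret ring U by (rule U_ring)
  show ?thesis by (simp add: U_divpow_def)
qed

lemma uop_divpow: "uop r (U_divpow g m) = scal (1 / qfact m) * gop \<upsilon> r g ^ m"
proof -
  interpret ring U by (rule U_ring)
  show ?thesis by (simp add: U_divpow_def uop_mult uop_scal uop_pow uop_gen)
qed

lemma U_Kbinom_carrier: "U_Kbinom i t \<in> carrier U"
proof -
  interpret ring U by (rule U_ring)
  show ?thesis by (induction t) simp_all
qed

fun wcomp :: "nat \<Rightarrow> idx \<Rightarrow> nat \<Rightarrow> nat" where
  "wcomp r I1 m = m"
| "wcomp r I2 m = r - m"

lemma gop_K: "gop q r (GK i) = dg r (\<lambda>m. q powi int (wcomp r i m))"
  "gop q r (GKi i) = dg r (\<lambda>m. q powi (- int (wcomp r i m)))"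
proof -
  show "gop q r (GK i) = dg r (\<lambda>m. q powi int (wcomp r i m))"
    by (cases i) (simp_all only: gop.simps wcomp.simps, rule dg_cong, simp add: of_nat_diff)
  show "gop q r (GKi i) = dg r (\<lambda>m. q powi (- int (wcomp r i m)))"
    by (cases i) (simp_all only: gop.simps wcomp.simps, rule dg_cong, simp add: of_nat_diff)
qed

text \<open>Where \<open>K_i\<close> acts by \<open>\<upsilon> powi int c\<close>, the factor split
  off in \<open>U_Kbinom\<close> becomes \<open>X (int c - int t) / X (int (Suc t))\<close>, as in
  \<open>qbinom_step\<close>.\<close>

lemma uop_Kbinom: "uop r (U_Kbinom i t) = dg r (\<lambda>m. qbinom (wcomp r i m) t)"
proof (induction t)
  case 0
  show ?case by (simp add: uop_one qbinom_0 dg_one)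
next
  case (Suc t)
  interpret ring U by (rule U_ring)
  have s: "dg r g - dg r h = dg r (\<lambda>m. g m - h m)" for g h :: "nat \<Rightarrow> qv"
    by (rule op_eqI) (simp add: dg.rep_eq algebra_simps)
  have X: "\<upsilon> powi (- int t) * \<upsilon> powi int c - \<upsilon> powi int t * \<upsilon> powi (- int c) = X (int c - int t)" for c
  proof -
    have "\<upsilon> powi a * \<upsilon> powi b = \<upsilon> powi (a + b)" for a b by (simp add: power_int_add)
    then have "\<upsilon> powi (- int t) * \<upsilon> powi int c - \<upsilon> powi int t * \<upsilon> powi (- int c) = \<upsilon> powi (- int t + int c) - \<upsilon> powi (int t + - int c)"
      by (simp only:)
    also have "\<dots> = X (int c - int t)" by simp
    finally show ?thesis .
  qed
  have "uop r (U_Kbinom i (Suc t)) = uop r (U_Kbinom i t) * (scal (1 / X (int (Suc t)))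
     * (scal (\<upsilon> powi (- int t)) * gop \<upsilon> r (GK i) - scal (\<upsilon> powi int t) * gop \<upsilon> r (GKi i)))"
    by (simp only: U_Kbinom.simps uop_mult uop_minus uop_scal uop_gen U_Kbinom_carrier U_scal_carrier U_gen_carrier m_closed minus_closed)
  also have "\<dots> = dg r (\<lambda>m. qbinom (wcomp r i m) t * (1 / X (int (Suc t)) * X (int (wcomp r i m) - int t)))"
    unfolding Suc gop_K s dg_scal dg_mult X ..
  finally show ?case unfolding qbinom_step by (simp only: times_divide_eq_left mult_1_left)
qed

text \<open>Stability of the lattice, phrased without matrix entries so that it passes at once to
  sums and products; coordinate functions as arguments give back the entries in
  \<open>UZ_entries\<close>.\<close>

definition integral_op :: "qv op \<Rightarrow> bool" where
  "integral_op T \<longleftrightarrow> (\<forall>f. (\<forall>i. f i \<in> \<Z>) \<longrightarrow> (\<forall>i. act T f i \<in> \<Z>))"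

lemma integral_op_dg: "(\<And>m. g m \<in> \<Z>) \<Longrightarrow> integral_op (dg r g)"
  by (auto simp: integral_op_def dg.rep_eq intro: ZZ_mult)

lemma integral_op_scal: "c \<in> \<Z> \<Longrightarrow> integral_op (scal c)"
  by (auto simp: integral_op_def intro: ZZ_mult)

lemma qfact_qbr: "qfact m = (\<Prod>i=1..m. qbr \<upsilon> (int i))"
  by (simp add: qfact_def qint_qbr)

lemma integral_op_divpow:
  "integral_op (scal (1 / qfact m) * Eop \<upsilon> r ^ m)" "integral_op (scal (1 / qfact m) * Fop \<upsilon> r ^ m)"
proof -
  note d = divided_powers_integral[OF upsilon_nonzero upsilon_square qbr_upsilon_nonzero ZZ_const ZZ_add ZZ_mult]
  show "integral_op (scal (1 / qfact m) * Eop \<upsilon> r ^ m)" "integral_op (scal (1 / qfact m) * Fop \<upsilon> r ^ m)"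
    unfolding integral_op_def qfact_qbr divide_inverse mult_1_left times_op.rep_eq scal.rep_eq
    by (intro allI impI d; simp)+
qed

lemma UZ_gens_carrier: "U_scal ` \<Z> \<union> {U_divpow GE m | m. True} \<union> {U_divpow GF m | m. True}
      \<union> {U_gen (GK i) | i. True} \<union> {U_gen (GKi i) | i. True} \<union> {U_Kbinom i t | i t. True} \<subseteq> carrier U"
  using U_divpow_carrier U_Kbinom_carrier by auto

lemma UZ_carrier: "u \<in> UZ \<Longrightarrow> u \<in> carrier U"
  unfolding UZ_def by (rule ring.generate_ring_in_carrier[OF U_ring UZ_gens_carrier])

lemma UZ_integral: "u \<in> UZ \<Longrightarrow> integral_op (uop r u)"
  unfolding UZ_def
proof (induction rule: generate_ring.induct)
  case one
  show ?case by (simp add: uop_one integral_op_def)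
next
  case (incl h)
  then show ?case
    using integral_op_divpow[of _ r]
    by (auto simp: uop_scal uop_divpow uop_gen gop_K uop_Kbinom qbinom_ZZ simp del: gop.simps(3-)
         intro!: integral_op_scal integral_op_dg ZZ_powi ZZ_pow ZZ_const)
next
  case (a_inv h)
  then show ?case using UZ_carrier[unfolded UZ_def] by (simp add: uop_uminus integral_op_def ZZ_minus)
next
  case (eng_add h1 h2)
  then show ?case using UZ_carrier[unfolded UZ_def] by (simp add: uop_add integral_op_def ZZ_add)
next
  case (eng_mult h1 h2)
  then show ?case using UZ_carrier[unfolded UZ_def] by (simp add: uop_mult integral_op_def)
qed

lemma UZ_entries:
  assumes "u \<in> UZ" "i < 2 ^ r" "j < 2 ^ r"
  shows "zeta_U r u $$ (i, j) \<in> \<Z>"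
proof -
  have "act (uop r u) (\<lambda>m. if m = j then 1 else 0) i \<in> \<Z>"
    using UZ_integral[OF assms(1), of r] unfolding integral_op_def by (auto simp: ZZ_const)
  then show ?thesis using mop_entry[OF assms(2,3), of "zeta_U r u"] by (simp add: uop_def)
qed

section \<open>Base change\<close>

lemma UZ_closed:
  "\<one>\<^bsub>U\<^esub> \<in> UZ" "u \<in> UZ \<Longrightarrow> v \<in> UZ \<Longrightarrow> u \<oplus>\<^bsub>U\<^esub> v \<in> UZ" "u \<in> UZ \<Longrightarrow> v \<in> UZ \<Longrightarrow> u \<otimes>\<^bsub>U\<^esub> v \<in> UZ"
  by (simp_all add: UZ_def generate_ring.intros)

lemma U_scal_UZ: "z \<in> \<Z> \<Longrightarrow> U_scal z \<in> UZ"
  unfolding UZ_def by (intro generate_ring.incl) blast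

lemma U_Kbinom_UZ: "U_Kbinom i t \<in> UZ"
  unfolding UZ_def by (intro generate_ring.incl) blast

lemma U_gen_UZ: "U_gen g \<in> UZ"
proof -
  interpret ring U by (rule U_ring)
  have "qfact 1 = 1" using qbr_1[OF upsilon_nonzero upsilon_square] by (simp add: qfact_qbr)
  then have d: "U_divpow h 1 = U_gen h" for h
    by (simp add: U_divpow_def U_scal_one)
  have "U_divpow GE 1 \<in> UZ" "U_divpow GF 1 \<in> UZ" "U_gen (GK i) \<in> UZ" "U_gen (GKi i) \<in> UZ" for i
    unfolding UZ_def by (intro generate_ring.incl, blast)+
  then show ?thesis unfolding d by (cases g) simp_all
qed

lemma UZ_monoid: "monoid (U\<lparr>carrier := UZ\<rparr>)"
  using ring.generate_ring_is_ring[OF U_ring UZ_gens_carrier] unfolding UZ_def by (rule ring.axioms(2))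

definition fmat :: "'k::field \<Rightarrow> nat \<Rightarrow> U_elem \<Rightarrow> 'k mat" where
  "fmat \<epsilon> r u = mat (2 ^ r) (2 ^ r) (\<lambda>ij. spec \<epsilon> (zeta_U r u $$ ij))"

lemma fmat_carrier [simp]: "fmat \<epsilon> r u \<in> carrier_mat (2 ^ r) (2 ^ r)"
  by (simp add: fmat_def)

abbreviation "MK TY r \<equiv> ring_mat TY (2 ^ r) ()"

context
  fixes \<epsilon> :: "'k::field"
  assumes eps: "\<epsilon> \<noteq> 0"
begin

text \<open>The map \<open>spec\<close> respects sums and products of elements of
  \<open>\<Z>\<close>, so the integrality of the entries is what lets it pass through the matrix
  product.\<close>

lemma fmat_mult:
  assumes "u \<in> UZ" "v \<in> UZ"
  shows "fmat \<epsilon> r (u \<otimes>\<^bsub>U\<^esub> v) = fmat \<epsilon> r u * fmat \<epsilon> r v"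
proof (rule eq_matI)
  fix i j assume "i < dim_row (fmat \<epsilon> r u * fmat \<epsilon> r v)" "j < dim_col (fmat \<epsilon> r u * fmat \<epsilon> r v)"
  then have ij: "i < 2 ^ r" "j < 2 ^ r" by (auto simp: fmat_def)
  have c: "zeta_U r u \<in> carrier_mat (2 ^ r) (2 ^ r)" "zeta_U r v \<in> carrier_mat (2 ^ r) (2 ^ r)"
    using assms by (auto intro: zeta_U_carrier UZ_carrier)
  have "zeta_U r (u \<otimes>\<^bsub>U\<^esub> v) = zeta_U r u * zeta_U r v"
    using ring_hom_mult[OF zeta_U_hom UZ_carrier[OF assms(1)] UZ_carrier[OF assms(2)], of r] by (simp add: ring_mat_simps)
  then have "zeta_U r (u \<otimes>\<^bsub>U\<^esub> v) $$ (i, j) = (\<Sum>k<2 ^ r. zeta_U r u $$ (i, k) * zeta_U r v $$ (k, j))"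
    using ij c by (auto simp: scalar_prod_def atLeast0LessThan)
  then have "spec \<epsilon> (zeta_U r (u \<otimes>\<^bsub>U\<^esub> v) $$ (i, j)) = (\<Sum>k<2 ^ r. spec \<epsilon> (zeta_U r u $$ (i, k) * zeta_U r v $$ (k, j)))"
    using assms ij by (simp only:) (rule spec_sum[OF eps], auto intro: ZZ_mult UZ_entries)
  also have "\<dots> = (\<Sum>k<2 ^ r. spec \<epsilon> (zeta_U r u $$ (i, k)) * spec \<epsilon> (zeta_U r v $$ (k, j)))"
    using assms ij by (intro sum.cong refl spec_mult[OF eps] UZ_entries) auto
  finally have "spec \<epsilon> (zeta_U r (u \<otimes>\<^bsub>U\<^esub> v) $$ (i, j)) = (\<Sum>k<2 ^ r. spec \<epsilon> (zeta_U r u $$ (i, k)) * spec \<epsilon> (zeta_U r v $$ (k, j)))" .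
  then show "fmat \<epsilon> r (u \<otimes>\<^bsub>U\<^esub> v) $$ (i, j) = (fmat \<epsilon> r u * fmat \<epsilon> r v) $$ (i, j)"
    using ij by (simp add: fmat_def scalar_prod_def atLeast0LessThan)
qed (auto simp: fmat_def)

lemma fmat_add:
  assumes "u \<in> UZ" "v \<in> UZ"
  shows "fmat \<epsilon> r (u \<oplus>\<^bsub>U\<^esub> v) = fmat \<epsilon> r u + fmat \<epsilon> r v"
proof -
  have c: "zeta_U r u \<in> carrier_mat (2 ^ r) (2 ^ r)" "zeta_U r v \<in> carrier_mat (2 ^ r) (2 ^ r)"
    using assms by (auto intro: zeta_U_carrier UZ_carrier)
  have "zeta_U r (u \<oplus>\<^bsub>U\<^esub> v) = zeta_U r u + zeta_U r v"
    using ring_hom_add[OF zeta_U_hom UZ_carrier[OF assms(1)] UZ_carrier[OF assms(2)], of r] by (simp add: ring_mat_simps)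
  then show ?thesis
    using assms c by (intro eq_matI) (auto simp: fmat_def spec_add[OF eps] UZ_entries)
qed

lemma fmat_scal:
  assumes "z \<in> \<Z>"
  shows "fmat \<epsilon> r (U_scal z) = spec \<epsilon> z \<cdot>\<^sub>m 1\<^sub>m (2 ^ r)"
proof -
  have "zeta_U r (U_scal z) = z \<cdot>\<^sub>m 1\<^sub>m (2 ^ r)"
    unfolding U_scal_def zeta_U_coset zeta_free(3) by (simp add: word_mat_def)
  then show ?thesis
    by (intro eq_matI) (auto simp: fmat_def spec_const[OF eps])
qed

lemma fmat_one: "fmat \<epsilon> r \<one>\<^bsub>U\<^esub> = 1\<^sub>m (2 ^ r)"
  using fmat_scal[OF ZZ_const(2), of r] unfolding U_scal_one spec_const[OF eps] by auto

lemma zeta_UZ_lift: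
  "zeta_UZ \<epsilon> r \<in> ring_hom UZ_alg (MK TYPE('k) r)"
  "zeta_UZ \<epsilon> r (p + p') = zeta_UZ \<epsilon> r p + zeta_UZ \<epsilon> r p'"
  "u \<in> UZ \<Longrightarrow> zeta_UZ \<epsilon> r (Poly_Mapping.single u c) = c \<cdot>\<^sub>m fmat \<epsilon> r u"
proof -
  have z: "zeta_UZ \<epsilon> r = (\<lambda>p. mat (2 ^ r) (2 ^ r) (\<lambda>ij. \<Sum>u\<in>Poly_Mapping.keys p. Poly_Mapping.lookup p u * fmat \<epsilon> r u $$ ij))"
    by (rule ext, rule eq_matI) (auto simp: zeta_UZ_def fmat_def)
  have 1: "fmat \<epsilon> r (a \<otimes>\<^bsub>U\<lparr>carrier := UZ\<rparr>\<^esub> b) = fmat \<epsilon> r a * fmat \<epsilon> r b"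
    if "a \<in> carrier (U\<lparr>carrier := UZ\<rparr>)" "b \<in> carrier (U\<lparr>carrier := UZ\<rparr>)" for a b
    using that fmat_mult by simp
  have 2: "fmat \<epsilon> r \<one>\<^bsub>U\<lparr>carrier := UZ\<rparr>\<^esub> = 1\<^sub>m (2 ^ r)" by (simp add: fmat_one)
  note l = monoid_algebra_lift[OF UZ_monoid, where N = "2 ^ r" and f = "fmat \<epsilon> r", OF fmat_carrier 1 2]
  show "zeta_UZ \<epsilon> r \<in> ring_hom UZ_alg (MK TYPE('k) r)" unfolding z by (rule l(1))
  show "zeta_UZ \<epsilon> r (p + p') = zeta_UZ \<epsilon> r p + zeta_UZ \<epsilon> r p'" unfolding z by (rule l(2))
  show "u \<in> UZ \<Longrightarrow> zeta_UZ \<epsilon> r (Poly_Mapping.single u c) = c \<cdot>\<^sub>m fmat \<epsilon> r u" unfolding z by (rule l(3)) simp_all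
qed

definition kop :: "nat \<Rightarrow> (U_elem \<Rightarrow>\<^sub>0 'k) \<Rightarrow> 'k op" where
  "kop r p = mop (2 ^ r) (zeta_UZ \<epsilon> r p)"

lemma zeta_UZ_carrier: "zeta_UZ \<epsilon> r p \<in> carrier_mat (2 ^ r) (2 ^ r)"
  by (simp add: zeta_UZ_def)

lemma kop_diff: "kop r (p - p') = kop r p - kop r p'"
proof -
  have "kop r ((p - p') + p') = kop r (p - p') + kop r p'"
    unfolding kop_def zeta_UZ_lift(2) by (simp add: mop_add zeta_UZ_carrier)
  then show ?thesis by (simp add: algebra_simps)
qed

lemma kop_single: "u \<in> UZ \<Longrightarrow> kop r (Poly_Mapping.single u c) = scal c * mop (2 ^ r) (fmat \<epsilon> r u)"
  by (simp add: kop_def zeta_UZ_lift(3) mop_smult)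

lemma zeta_UZ_relations:
  assumes "s \<in> Uk_relations \<epsilon>"
  shows "zeta_UZ \<epsilon> r s = \<zero>\<^bsub>MK TYPE('k) r\<^esub>"
proof -
  have "kop r s = 0"
    using assms unfolding Uk_relations_def
  proof (elim UnE CollectE exE conjE)
    fix u u' assume "s = Poly_Mapping.single (u \<oplus>\<^bsub>U\<^esub> u') 1 - Poly_Mapping.single u 1 - Poly_Mapping.single u' 1"
      "u \<in> UZ" "u' \<in> UZ"
    then show ?thesis
      by (simp add: kop_diff kop_single UZ_closed fmat_add mop_add scal_one)
  next
    fix z u assume zu: "s = Poly_Mapping.single (U_scal z \<otimes>\<^bsub>U\<^esub> u) 1 - Poly_Mapping.single u (spec \<epsilon> z)"
      "z \<in> \<Z>" "u \<in> UZ"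
    have "kop r s = mop (2 ^ r) (fmat \<epsilon> r (U_scal z) * fmat \<epsilon> r u) - scal (spec \<epsilon> z) * mop (2 ^ r) (fmat \<epsilon> r u)"
      using zu by (simp add: kop_diff kop_single UZ_closed U_scal_UZ fmat_mult scal_one)
    also have "mop (2 ^ r) (fmat \<epsilon> r (U_scal z) * fmat \<epsilon> r u) = scal (spec \<epsilon> z) * mop (2 ^ r) (fmat \<epsilon> r u)"
      using zu by (subst mop_mult) (simp_all add: fmat_scal mop_scal)
    finally show ?thesis by simp
  qed
  then show ?thesis unfolding kop_def ring_mat_simps
    by (intro mop_inj[of _ "2 ^ r"]) (simp_all add: zeta_UZ_carrier mop_zero)
qed

lemma UZ_alg_ring: "ring (UZ_alg :: (U_elem \<Rightarrow>\<^sub>0 'k) ring)"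
  by (rule monoid.monoid_algebra_ring[OF UZ_monoid])

lemma single_carrier: "u \<in> UZ \<Longrightarrow> Poly_Mapping.single u c \<in> carrier (UZ_alg :: (U_elem \<Rightarrow>\<^sub>0 'k) ring)"
  by (simp add: monoid_algebra_def)

lemma Uk_relations_carrier: "Uk_relations \<epsilon> \<subseteq> carrier UZ_alg"
proof -
  have d: "p - p' \<in> carrier UZ_alg" if "p \<in> carrier UZ_alg" "p' \<in> carrier UZ_alg" for p p' :: "U_elem \<Rightarrow>\<^sub>0 'k"
    using that keys_diff[of p p'] unfolding monoid_algebra_def by auto
  show ?thesis unfolding Uk_relations_def
    by (auto intro!: d single_carrier UZ_closed U_scal_UZ)
qed

lemma zeta_hom: "zeta \<epsilon> r \<in> ring_hom (Uk \<epsilon>) (MK TYPE('k) r)"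
  and zeta_tensor: "u \<in> UZ \<Longrightarrow> zeta \<epsilon> r (Uk_tensor \<epsilon> u c) = c \<cdot>\<^sub>m fmat \<epsilon> r u"
proof -
  note l = quotient_lift[OF UZ_alg_ring ring_mat Uk_relations_carrier zeta_UZ_lift(1) zeta_UZ_relations]
  show "zeta \<epsilon> r \<in> ring_hom (Uk \<epsilon>) (MK TYPE('k) r)"
    unfolding zeta_def[abs_def] Uk_def Uk_ideal_def by (rule l(2), assumption)
  show "zeta \<epsilon> r (Uk_tensor \<epsilon> u c) = c \<cdot>\<^sub>m fmat \<epsilon> r u" if "u \<in> UZ"
  proof -
    have "zeta \<epsilon> r (Uk_tensor \<epsilon> u c) = zeta_UZ \<epsilon> r (Poly_Mapping.single u c)"
      unfolding zeta_def Uk_tensor_def Uk_ideal_def by (rule l(1), assumption, rule single_carrier[OF that])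
    then show ?thesis using zeta_UZ_lift(3)[OF that] by simp
  qed
qed

lemma Uk_ring: "ring (Uk \<epsilon>)"
  unfolding Uk_def Uk_ideal_def
  by (intro ideal.quotient_is_ring ring.genideal_ideal UZ_alg_ring Uk_relations_carrier)

lemma Uk_tensor_carrier: "u \<in> UZ \<Longrightarrow> Uk_tensor \<epsilon> u c \<in> carrier (Uk \<epsilon>)"
proof -
  assume u: "u \<in> UZ"
  interpret ideal "Uk_ideal \<epsilon>" UZ_alg
    unfolding Uk_ideal_def by (intro ring.genideal_ideal UZ_alg_ring Uk_relations_carrier)
  show ?thesis
    unfolding Uk_def Uk_tensor_def FactRing_def using single_carrier[OF u] by (simp add: a_rcosetsI[OF a_subset])
qed

lemma little_schur_generated:
  "little_schur \<epsilon> r = generate_ring (MK TYPE('k) r) ({c \<cdot>\<^sub>m 1\<^sub>m (2 ^ r) | c. True} \<union> {zeta_gen \<epsilon> r g | g. True})"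
proof -
  let ?S = "{Uk_tensor \<epsilon> \<one>\<^bsub>U\<^esub> c | c. True} \<union> {Uk_tensor \<epsilon> (U_gen g) 1 | g. True}"
  have S: "?S \<subseteq> carrier (Uk \<epsilon>)"
    using Uk_tensor_carrier UZ_closed(1) U_gen_UZ by blast
  have "zeta \<epsilon> r ` ?S = {c \<cdot>\<^sub>m 1\<^sub>m (2 ^ r) | c. True} \<union> {zeta_gen \<epsilon> r g | g. True}"
    unfolding image_Un zeta_gen_def by (simp add: full_SetCompr_eq image_image zeta_tensor UZ_closed(1) fmat_one)
  then show ?thesis
    unfolding little_schur_def Uk_small_def
    using ring_hom_generate_ring[OF Uk_ring ring_mat zeta_hom S] by simp
qed

text \<open>The recursion that defines the generators is the same for every parameter.\<close>

lemma gop_spec: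
  assumes "\<And>i. f i \<in> \<Z>"
  shows "act (gop \<upsilon> r g) f i \<in> \<Z> \<and> spec \<epsilon> (act (gop \<upsilon> r g) f i) = act (gop \<epsilon> r g) (\<lambda>i. spec \<epsilon> (f i)) i"
proof -
  have dgc: "act (dg r h) f i \<in> \<Z> \<and> spec \<epsilon> (act (dg r h) f i) = act (dg r h') (\<lambda>i. spec \<epsilon> (f i)) i"
    if "\<And>i. f i \<in> \<Z>" "\<And>m. h m \<in> \<Z>" "\<And>m. spec \<epsilon> (h m) = h' m" for r h h' f i
    using that by (simp add: dg.rep_eq ZZ_mult spec_mult[OF eps])
  have act_split: "act T f i = (if even i then ev (act T f) (i div 2) else od (act T f) (i div 2))"
    for T :: "'c::field op" and f i
    by (auto simp: ev_def od_def)
  have sp: "ev (\<lambda>i. spec \<epsilon> (f i)) = (\<lambda>i. spec \<epsilon> (ev f i))" "od (\<lambda>i. spec \<epsilon> (f i)) = (\<lambda>i. spec \<epsilon> (od f i))" for f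
    by (auto simp: ev_def od_def)
  have K: "act (Kinv \<upsilon> r) f i \<in> \<Z> \<and> spec \<epsilon> (act (Kinv \<upsilon> r) f i) = act (Kinv \<epsilon> r) (\<lambda>i. spec \<epsilon> (f i)) i"
    if "\<And>i. f i \<in> \<Z>" for r f i
    unfolding Kinv_def by (rule dgc) (auto simp: that ZZ_powi spec_powi[OF eps])
  have E: "act (Eop \<upsilon> r) f i \<in> \<Z> \<and> spec \<epsilon> (act (Eop \<upsilon> r) f i) = act (Eop \<epsilon> r) (\<lambda>i. spec \<epsilon> (f i)) i"
    if "\<And>i. f i \<in> \<Z>" for r f i
    using that
  proof (induction r arbitrary: f i)
    case 0
    show ?case by (simp add: Eop_0 ZZ_const spec_const[OF eps])
  next
    case (Suc r)
    have f: "ev f j \<in> \<Z>" "od f j \<in> \<Z>" for j using Suc.prems by (auto simp: ev_def od_def)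
    have IH: "act (Eop \<upsilon> r) (ev f) j \<in> \<Z>" "spec \<epsilon> (act (Eop \<upsilon> r) (ev f) j) = act (Eop \<epsilon> r) (\<lambda>i. spec \<epsilon> (ev f i)) j"
       "act (Eop \<upsilon> r) (od f) j \<in> \<Z>" "spec \<epsilon> (act (Eop \<upsilon> r) (od f) j) = act (Eop \<epsilon> r) (\<lambda>i. spec \<epsilon> (od f i)) j" for j
      using Suc.IH[of "ev f" j] Suc.IH[of "od f" j] f by auto
    show ?case
      by (subst (1 2 3) act_split)
         (simp add: Eop_Suc sp IH f ZZ_const ZZ_add ZZ_mult spec_add[OF eps] spec_mult[OF eps] spec_const[OF eps])
  qed
  have F: "act (Fop \<upsilon> r) f i \<in> \<Z> \<and> spec \<epsilon> (act (Fop \<upsilon> r) f i) = act (Fop \<epsilon> r) (\<lambda>i. spec \<epsilon> (f i)) i"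
    if "\<And>i. f i \<in> \<Z>" for r f i
    using that
  proof (induction r arbitrary: f i)
    case 0
    show ?case by (simp add: Fop_0 ZZ_const spec_const[OF eps])
  next
    case (Suc r)
    have f: "ev f j \<in> \<Z>" "od f j \<in> \<Z>" for j using Suc.prems by (auto simp: ev_def od_def)
    have IH: "act (Fop \<upsilon> r) (ev f) j \<in> \<Z>" "spec \<epsilon> (act (Fop \<upsilon> r) (ev f) j) = act (Fop \<epsilon> r) (\<lambda>i. spec \<epsilon> (ev f i)) j"
       "act (Fop \<upsilon> r) (od f) j \<in> \<Z>" "spec \<epsilon> (act (Fop \<upsilon> r) (od f) j) = act (Fop \<epsilon> r) (\<lambda>i. spec \<epsilon> (od f i)) j" for j
      using Suc.IH[of "ev f" j] Suc.IH[of "od f" j] f by auto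
    show ?case
      by (subst (1 2 3) act_split)
         (simp add: Fop_Suc sp IH f K ZZ_add spec_add[OF eps])
  qed
  show ?thesis
  proof (cases g)
    case GE
    then show ?thesis using E assms by simp
  next
    case GF
    then show ?thesis using F assms by simp
  next
    case (GK i)
    then show ?thesis unfolding GK gop_K by (intro dgc) (auto simp: assms ZZ_powi spec_powi[OF eps] simp del: power_int_of_nat)
  next
    case (GKi i)
    then show ?thesis unfolding GKi gop_K by (intro dgc) (auto simp: assms ZZ_powi spec_powi[OF eps])
  qed
qed

end

text \<open>Entries determine an operator only among those that come from matrices. So
  \<open>gop\<close> must first be seen to act on the \<open>r\<close> lowest digits alone, and the
  coproduct recursion builds its matrix from Kronecker products.\<close>

lemma gop_matrix: "\<exists>M\<in>carrier_mat (2 ^ r) (2 ^ r). mop (2 ^ r) M = gop q r g"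
proof -
  define B where "B a b c d = mat 2 2 (\<lambda>(i, j). if i = 0 then if j = 0 then a else b else if j = 0 then c else d)" for a b c d :: 'a
  have Bc: "B a b c d \<in> carrier_mat 2 2" for a b c d by (simp add: B_def)
  have Be: "B a b c d $$ (0, 0) = a" "B a b c d $$ (0, 1) = b" "B a b c d $$ (1, 0) = c" "B a b c d $$ (1, 1) = d" for a b c d
    by (simp_all add: B_def)
  have dgm: "\<exists>M\<in>carrier_mat (2 ^ r) (2 ^ r). mop (2 ^ r) M = dg r h" for r and h :: "nat \<Rightarrow> 'a"
    using mop_dgmat[of r h] by (intro bexI[of _ "dgmat r h"]) auto
  have N: "(2::nat) ^ r > 0" for r by simp
  have one: "mop (2 ^ r) (1\<^sub>m (2 ^ r)) = (1 :: 'a op)" for r by (rule mop_one) simp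
  have sum: "\<exists>M\<in>carrier_mat (2 ^ Suc r) (2 ^ Suc r). mop (2 ^ Suc r) M = T"
    if "A \<in> carrier_mat (2 ^ r) (2 ^ r)" "A' \<in> carrier_mat (2 ^ r) (2 ^ r)" "C \<in> carrier_mat 2 2" "C' \<in> carrier_mat 2 2"
      "mop (2 * 2 ^ r) (kron A C) + mop (2 * 2 ^ r) (kron A' C') = T" for A A' C C' T r
    using that kron_carrier[OF that(1,3)] kron_carrier[OF that(2,4)]
    by (intro bexI[of _ "kron A C + kron A' C'"]) (auto simp: mop_add mult.commute)
  have E: "\<exists>M\<in>carrier_mat (2 ^ r) (2 ^ r). mop (2 ^ r) M = Eop q r" for r
  proof (induction r)
    case 0
    show ?case by (rule bexI[of _ "0\<^sub>m 1 1"]) (auto simp: mop_zero Eop_0 intro!: op_eqI)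
  next
    case (Suc r)
    then obtain M where M: "M \<in> carrier_mat (2 ^ r) (2 ^ r)" "mop (2 ^ r) M = Eop q r" by blast
    have "mop (2 * 2 ^ r) (kron M (B q 0 0 (inverse q))) + mop (2 * 2 ^ r) (kron (1\<^sub>m (2 ^ r)) (B 0 1 0 0)) = Eop q (Suc r)"
      by (rule op_eqI; rule ev_od_eqI; simp only: plus_op.rep_eq ev_od_lin mop_kron[OF N M(1) Bc] mop_kron[OF N one_carrier_mat Bc] Be M(2) one Eop_Suc)
         simp_all
    then show ?case by (rule sum[OF M(1) one_carrier_mat Bc Bc])
  qed
  have F: "\<exists>M\<in>carrier_mat (2 ^ r) (2 ^ r). mop (2 ^ r) M = Fop q r" for r
  proof (induction r)
    case 0
    show ?case by (rule bexI[of _ "0\<^sub>m 1 1"]) (auto simp: mop_zero Fop_0 intro!: op_eqI)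
  next
    case (Suc r)
    then obtain M where M: "M \<in> carrier_mat (2 ^ r) (2 ^ r)" "mop (2 ^ r) M = Fop q r" by blast
    obtain K where K: "K \<in> carrier_mat (2 ^ r) (2 ^ r)" "mop (2 ^ r) K = Kinv q r" using dgm Kinv_def by metis
    have "mop (2 * 2 ^ r) (kron M (B 1 0 0 1)) + mop (2 * 2 ^ r) (kron K (B 0 0 1 0)) = Fop q (Suc r)"
      by (rule op_eqI; rule ev_od_eqI; simp only: plus_op.rep_eq ev_od_lin mop_kron[OF N M(1) Bc] mop_kron[OF N K(1) Bc] Be M(2) K(2) Fop_Suc)
         simp_all
    then show ?case by (rule sum[OF M(1) K(1) Bc Bc])
  qed
  show ?thesis using E F dgm by (cases g) (simp_all only: gop.simps(1,2) gop_K)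
qed

lemma mop_zeta_gen:
  assumes "\<epsilon> \<noteq> 0"
  shows "zeta_gen \<epsilon> r g \<in> carrier_mat (2 ^ r) (2 ^ r)" "mop (2 ^ r) (zeta_gen \<epsilon> r g) = gop \<epsilon> r g"
proof -
  have z: "zeta_gen \<epsilon> r g = fmat \<epsilon> r (U_gen g)"
    unfolding zeta_gen_def zeta_tensor[OF assms U_gen_UZ] by auto
  show "zeta_gen \<epsilon> r g \<in> carrier_mat (2 ^ r) (2 ^ r)" unfolding z by simp
  obtain M where M: "M \<in> carrier_mat (2 ^ r) (2 ^ r)" "mop (2 ^ r) M = gop \<epsilon> r g" using gop_matrix by blast
  have "fmat \<epsilon> r (U_gen g) = M"
  proof (rule eq_matI)
    fix i j assume "i < dim_row M" "j < dim_col M"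
    then have ij: "i < 2 ^ r" "j < 2 ^ r" using M by auto
    have "zeta_U r (U_gen g) $$ (i, j) = act (gop \<upsilon> r g) (\<lambda>m. if m = j then 1 else 0) i"
      using mop_entry[OF ij, of "zeta_U r (U_gen g)"] uop_gen[of r g] by (simp add: uop_def)
    also have "spec \<epsilon> \<dots> = act (gop \<epsilon> r g) (\<lambda>m. spec \<epsilon> (if m = j then 1 else 0)) i"
      using gop_spec[OF assms, of "\<lambda>m. if m = j then 1 else 0" r g i] by (simp add: ZZ_const)
    also have "(\<lambda>m. spec \<epsilon> (if m = j then 1 else 0)) = (\<lambda>m. if m = j then 1 else 0)"
      using spec_const[OF assms] by auto
    also have "act (gop \<epsilon> r g) (\<lambda>m. if m = j then 1 else 0) i = M $$ (i, j)"
      using mop_entry[OF ij, of M] M by simp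
    finally show "fmat \<epsilon> r (U_gen g) $$ (i, j) = M $$ (i, j)" using ij by (simp add: fmat_def)
  qed (use M in \<open>auto simp: fmat_def\<close>)
  then show "mop (2 ^ r) (zeta_gen \<epsilon> r g) = gop \<epsilon> r g" using M z by simp
qed

lemma mop_zeta_Kbinom:
  assumes "\<epsilon> \<noteq> 0"
  shows "zeta_Kbinom \<epsilon> r i t \<in> carrier_mat (2 ^ r) (2 ^ r)"
    "mop (2 ^ r) (zeta_Kbinom \<epsilon> r i t) = dg r (\<lambda>m. spec \<epsilon> (qbinom (wcomp r i m) t))"
proof -
  have z: "zeta_Kbinom \<epsilon> r i t = fmat \<epsilon> r (U_Kbinom i t)"
    unfolding zeta_Kbinom_def zeta_tensor[OF assms U_Kbinom_UZ] by auto
  show "zeta_Kbinom \<epsilon> r i t \<in> carrier_mat (2 ^ r) (2 ^ r)" unfolding z by simp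
  have "zeta_U r (U_Kbinom i t) = dgmat r (\<lambda>m. qbinom (wcomp r i m) t)"
    using uop_Kbinom[of r i t] mop_dgmat[of r "\<lambda>m. qbinom (wcomp r i m) t"]
    by (intro mop_inj[of _ "2 ^ r"]) (simp_all add: uop_def zeta_U_carrier U_Kbinom_carrier)
  then have "zeta_Kbinom \<epsilon> r i t = dgmat r (\<lambda>m. spec \<epsilon> (qbinom (wcomp r i m) t))"
    unfolding z by (intro eq_matI) (auto simp: fmat_def dgmat_def spec_const[OF assms])
  then show "mop (2 ^ r) (zeta_Kbinom \<epsilon> r i t) = dg r (\<lambda>m. spec \<epsilon> (qbinom (wcomp r i m) t))"
    by (simp add: mop_dgmat)
qed

section \<open>Weyl modules twisted by a power of the determinant\<close>

text \<open>The \<open>b\<close>-fold tensor power of the quantum determinant \<open>\<omega>_1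
  \<otimes> \<omega>_2 - inverse q \<omega>_2 \<otimes> \<omega>_1\<close>, on which
  \<open>E\<close> and \<open>F\<close> act by zero. The initial function puts all inert digits to
  zero.\<close>

primrec detv :: "'k::field \<Rightarrow> nat \<Rightarrow> nat \<Rightarrow> 'k" where
  "detv q 0 = (\<lambda>i. if i = 0 then 1 else 0)"
| "detv q (Suc b) = join (join (\<lambda>_. 0) (\<lambda>i. - inverse q * detv q b i)) (join (detv q b) (\<lambda>_. 0))"

text \<open>The standard basis of a Weyl module: \<open>detv q b\<close> followed by the words with
  \<open>j\<close> factors \<open>\<omega>_2\<close> among \<open>n\<close>, weighted by powers of
  \<open>q\<close>. By \<open>Fop_wv\<close> the vector with index \<open>j\<close> is the divided
  power \<open>F^j / [j]!\<close> of the one with index 0 wherever the denominator is invertible.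
  The index is an integer, and vectors outside \<open>0..n\<close> vanish, so the formulas for
  \<open>E\<close> and \<open>F\<close> have no boundary cases.\<close>

primrec wv :: "'k::field \<Rightarrow> nat \<Rightarrow> nat \<Rightarrow> int \<Rightarrow> nat \<Rightarrow> 'k" where
  "wv q b 0 j = (if j = 0 then detv q b else (\<lambda>_. 0))"
| "wv q b (Suc n) j = join (wv q b n j) (\<lambda>i. q powi (j - int n - 1) * wv q b n (j - 1) i)"

lemma join_eq_0_iff: "join f g = (\<lambda>_. 0) \<longleftrightarrow> f = (\<lambda>_. 0) \<and> g = (\<lambda>_. 0)"
proof
  assume h: "join f g = (\<lambda>_. 0)"
  have "ev (join f g) = (\<lambda>_. 0)" "od (join f g) = (\<lambda>_. 0)" unfolding h by (simp_all add: ev_def od_def)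
  then show "f = (\<lambda>_. 0) \<and> g = (\<lambda>_. 0)" by simp
qed (auto simp: join_def)

lemma detv_nonzero: "detv q b \<noteq> (\<lambda>_. 0)"
proof (induction b)
  case 0
  show ?case by (auto simp: fun_eq_iff)
qed (simp add: join_eq_0_iff)

lemma wv_eq_0: "j < 0 \<or> j > int n \<Longrightarrow> wv q b n j = (\<lambda>_. 0)"
  by (induction n arbitrary: j) (auto simp: join_eq_0_iff)

lemma wv_nonzero:
  assumes "q \<noteq> 0"
  shows "0 \<le> j \<Longrightarrow> j \<le> int n \<Longrightarrow> wv q b n j \<noteq> (\<lambda>_. 0)"
proof (induction n arbitrary: j)
  case 0
  then show ?case by (simp add: detv_nonzero)
next
  case (Suc n)
  show ?case
  proof (cases "j \<le> int n")
    case True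
    then show ?thesis using Suc by (simp add: join_eq_0_iff)
  next
    case False
    then have "wv q b n (j - 1) \<noteq> (\<lambda>_. 0)" using Suc by simp
    then have "(\<lambda>i. q powi (j - int n - 1) * wv q b n (j - 1) i) \<noteq> (\<lambda>_. 0)"
      using assms by (auto simp: fun_eq_iff)
    then show ?thesis by (simp add: join_eq_0_iff)
  qed
qed

lemma dg_detv: "act (dg (2 * b) g) (detv q b) = (\<lambda>i. g b * detv q b i)"
proof (induction b arbitrary: g)
  case 0
  show ?case by (simp add: dg_0)
next
  case (Suc b)
  have "2 * Suc b = Suc (Suc (2 * b))" by simp
  then show ?case
    by (simp only:) (rule ev_od_eqI; rule ev_od_eqI; simp only: dg_Suc detv.simps ev_join od_join ev_od_lin Suc act_zero act_cmult; simp add: mult_ac)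
qed

lemma Eop_detv: "q \<noteq> 0 \<Longrightarrow> act (Eop q (2 * b)) (detv q b) = (\<lambda>_. 0)"
proof (induction b)
  case 0
  show ?case by (simp add: Eop_0)
next
  case (Suc b)
  have "2 * Suc b = Suc (Suc (2 * b))" by simp
  then show ?case using Suc
    by (simp only:) (rule ev_od_eqI; rule ev_od_eqI;
      simp only: Eop_Suc detv.simps ev_join od_join ev_od_lin act_zero act_cmult; simp add: act_cmult mult.assoc[symmetric])
qed

lemma Fop_detv: "q \<noteq> 0 \<Longrightarrow> act (Fop q (2 * b)) (detv q b) = (\<lambda>_. 0)"
proof (induction b)
  case 0
  show ?case by (simp add: Fop_0)
next
  case (Suc b)
  have e: "2 * Suc b = Suc (Suc (2 * b))" by simp
  have K: "od (act (Kinv q (Suc (2 * b))) f) = act (dg (2 * b) (\<lambda>m. q powi (int (Suc (2 * b)) - 2 * int m))) (od f)"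
     "ev (act (Kinv q (Suc (2 * b))) f) = act (dg (2 * b) (\<lambda>m. q powi (int (Suc (2 * b)) - 2 * int (Suc m)))) (ev f)" for f
    unfolding Kinv_def dg_Suc by rule+
  have K': "act (Kinv q (2 * b)) (detv q b) = detv q b"
    by (simp add: Kinv_def dg_detv)
  have IH: "act (Fop q (2 * b)) (detv q b) = (\<lambda>_. 0)" using Suc by blast
  have z: "(0::'a) * x = 0" "x + (0::'a) = x" "(0::'a) + x = x" "x * (0::'a) = 0" for x by simp_all
  have q1: "q powi (int (Suc (2 * b)) - 2 * int b) = q" by simp
  show ?case
    unfolding e
    by (rule ev_od_eqI; rule ev_od_eqI;
      simp only: Fop_Suc detv.simps ev_join od_join ev_od_lin K K' IH act_zero act_cmult dg_detv z q1)
      (use Suc.prems in \<open>simp add: mult.assoc[symmetric]\<close>)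
qed

lemma dg_wv: "act (dg (2 * b + n) g) (wv q b n j) = (\<lambda>i. g (nat (int b + int n - j)) * wv q b n j i)"
proof (induction n arbitrary: g j)
  case 0
  show ?case by (simp add: dg_detv act_zero)
next
  case (Suc n)
  \<comment> \<open>For \<open>j > int n\<close> the vector vanishes, so the truncation by
    \<open>nat\<close> does no harm.\<close>
  have s: "g (Suc (nat (int b + int n - j))) * wv q b n j i = g (nat (int b + int (Suc n) - j)) * wv q b n j i" for i
  proof (cases "j \<le> int n")
    case True
    then have "Suc (nat (int b + int n - j)) = nat (int b + int (Suc n) - j)" by simp
    then show ?thesis by simp
  qed (simp add: wv_eq_0)
  have t: "int b + int n - (j - 1) = int b + int (Suc n) - j" by simp
  show ?case
    unfolding add_Suc_right
    by (rule ev_od_eqI; simp only: dg_Suc wv.simps ev_join od_join ev_od_lin Suc act_cmult s t)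
       (simp_all add: mult_ac)
qed

lemma Kinv_wv: "act (Kinv q (2 * b + n)) (wv q b n j) = (\<lambda>i. q powi (2 * j - int n) * wv q b n j i)"
proof (cases "j \<le> int n")
  case True
  then have "int (2 * b + n) - 2 * int (nat (int b + int n - j)) = 2 * j - int n" by simp
  then show ?thesis unfolding Kinv_def dg_wv by (simp only:)
next
  case False
  then show ?thesis by (simp add: wv_eq_0 act_zero)
qed

lemma Eop_wv:
  assumes q: "q \<noteq> 0" "q * q \<noteq> 1"
  shows "act (Eop q (2 * b + n)) (wv q b n j) = (\<lambda>i. qbr q (int n - j + 1) * wv q b n (j - 1) i)"
proof (induction n arbitrary: j)
  case 0
  show ?case using Eop_detv[OF q(1)] by (auto simp: act_zero)
next
  case (Suc n)
  have 1: "qbr q (int (Suc n) - j + 1) = q * qbr q (int n - j + 1) + q powi (j - int n - 1)"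
    using qbr_Suc(1)[OF q, of "int n - j + 1"] by (simp add: algebra_simps)
  have 2: "qbr q (int n - (j - 1) + 1) = qbr q (int (Suc n) - j + 1)" by (simp add: algebra_simps)
  have 3: "q powi (j - 1 - int n - 1) = inverse q * q powi (j - int n - 1)"
    using mult_powi(2)[OF q(1), of "j - int n - 1"] by (simp add: algebra_simps)
  show ?case
  proof (rule ev_od_eqI)
    show "ev (act (Eop q (2 * b + Suc n)) (wv q b (Suc n) j)) = ev (\<lambda>i. qbr q (int (Suc n) - j + 1) * wv q b (Suc n) (j - 1) i)"
      unfolding add_Suc_right Eop_Suc wv.simps ev_join od_join ev_od_lin Suc 1 by (simp add: algebra_simps)
    show "od (act (Eop q (2 * b + Suc n)) (wv q b (Suc n) j)) = od (\<lambda>i. qbr q (int (Suc n) - j + 1) * wv q b (Suc n) (j - 1) i)"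
      unfolding add_Suc_right Eop_Suc wv.simps ev_join od_join ev_od_lin act_cmult Suc 2 3 by (simp add: mult_ac)
  qed
qed

lemma Fop_wv:
  assumes q: "q \<noteq> 0" "q * q \<noteq> 1"
  shows "act (Fop q (2 * b + n)) (wv q b n j) = (\<lambda>i. qbr q (j + 1) * wv q b n (j + 1) i)"
proof (induction n arbitrary: j)
  case 0
  show ?case using Fop_detv[OF q(1)] by (auto simp: act_zero)
next
  case (Suc n)
  have 1: "q powi (j - int n - 1) * qbr q (j - 1 + 1) + q powi (2 * j - int n) = qbr q (j + 1) * q powi (j + 1 - int n - 1)"
  proof -
    have "q powi (j - int n - 1) = inverse q * q powi (j - int n)"
      using mult_powi(2)[OF q(1), of "j - int n"] by simp
    moreover have "q powi (2 * j - int n) = q powi (j - int n) * q powi j"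
      using power_int_add[of q "j - int n" j] q by (simp add: algebra_simps)
    moreover have "j + 1 - int n - 1 = j - int n" "j - 1 + 1 = j" by simp_all
    ultimately show ?thesis using qbr_Suc(2)[OF q, of j] by (simp only:) (simp add: algebra_simps)
  qed
  show ?case
  proof (rule ev_od_eqI)
    show "ev (act (Fop q (2 * b + Suc n)) (wv q b (Suc n) j)) = ev (\<lambda>i. qbr q (j + 1) * wv q b (Suc n) (j + 1) i)"
      unfolding add_Suc_right Fop_Suc wv.simps ev_join od_join ev_od_lin Suc by rule
    have "od (act (Fop q (2 * b + Suc n)) (wv q b (Suc n) j)) =
       (\<lambda>i. (q powi (j - int n - 1) * qbr q (j - 1 + 1) + q powi (2 * j - int n)) * wv q b n j i)"
      unfolding add_Suc_right Fop_Suc wv.simps ev_join od_join ev_od_lin act_cmult Suc Kinv_wv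
      by (simp add: algebra_simps)
    then show "od (act (Fop q (2 * b + Suc n)) (wv q b (Suc n) j)) = od (\<lambda>i. qbr q (j + 1) * wv q b (Suc n) (j + 1) i)"
      unfolding 1 wv.simps od_join ev_od_lin by (simp add: mult.assoc)
  qed
qed

lemma Pop_wv:
  assumes "j \<le> int n"
  shows "act (Pop (2 * b + n) m) (wv q b n j) = (if m = int b + int n - j then wv q b n j else (\<lambda>_. 0))"
proof -
  have "int (nat (int b + int n - j)) = int b + int n - j" using assms by simp
  then show ?thesis unfolding Pop_def dg_wv by auto
qed

section \<open>The infinitesimal \<open>q\<close>-Schur algebra as an algebra of operators\<close>

locale root_of_unity_schur =
  fixes \<epsilon> :: "'k::field" and l r :: nat
  assumes l3: "l \<ge> 3" and l_odd: "odd l" and prim: "primitive_root_of_unity l \<epsilon>"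
begin

lemma eps_pow_l: "\<epsilon> ^ l = 1" and eps_pow_neq: "0 < m \<Longrightarrow> m < l \<Longrightarrow> \<epsilon> ^ m \<noteq> 1"
  using prim by (auto simp: primitive_root_of_unity_def)

lemma eps_pow_eq_1_iff: "\<epsilon> ^ n = 1 \<longleftrightarrow> l dvd n"
proof -
  have "\<epsilon> ^ n = \<epsilon> ^ (l * (n div l) + n mod l)" by simp
  also have "\<dots> = \<epsilon> ^ (n mod l)" unfolding power_add power_mult eps_pow_l by simp
  finally have "\<epsilon> ^ n = \<epsilon> ^ (n mod l)" .
  moreover have "n mod l < l" using l3 by simp
  ultimately show ?thesis using eps_pow_neq[of "n mod l"] by (cases "n mod l = 0") (auto simp: dvd_eq_mod_eq_0)
qed

lemma eps0: "\<epsilon> \<noteq> 0"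
  using eps_pow_l l3 by (auto simp: power_0_left)

lemma eps2: "\<epsilon> * \<epsilon> \<noteq> 1"
  using eps_pow_neq[of 2] l3 by (simp add: power2_eq_square)

lemma eps_powi_eq_1_iff: "\<epsilon> powi k = 1 \<longleftrightarrow> int l dvd k"
proof (cases "k \<ge> 0")
  case True
  then show ?thesis using eps_pow_eq_1_iff[of "nat k"] by (simp add: power_int_def int_dvd_int_iff[symmetric])
next
  case False
  then have "\<epsilon> powi k = inverse (\<epsilon> ^ nat (- k))" by (simp add: power_int_def power_inverse)
  then show ?thesis using eps_pow_eq_1_iff[of "nat (- k)"] False by (simp add: int_dvd_int_iff[symmetric])
qed

lemma qbr_eq_0_iff: "qbr \<epsilon> k = 0 \<longleftrightarrow> int l dvd k"
proof -
  have d: "\<epsilon> - inverse \<epsilon> \<noteq> 0" using eps0 eps2 by (auto simp: field_simps)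
  have "qbr \<epsilon> k = 0 \<longleftrightarrow> \<epsilon> powi k = inverse (\<epsilon> powi k)"
    using d by (simp add: qbr_def power_int_minus)
  also have "\<dots> \<longleftrightarrow> \<epsilon> powi k * \<epsilon> powi k = 1"
    using eps0 by (auto simp: field_simps)
  also have "\<dots> \<longleftrightarrow> int l dvd 2 * k"
    unfolding power_int_add[OF disjI1[OF eps0], symmetric] eps_powi_eq_1_iff by (simp only: mult_2)
  also have "\<dots> \<longleftrightarrow> int l dvd k"
    using l_odd by (intro coprime_dvd_mult_right_iff) simp
  finally show ?thesis .
qed

lemma qbr_nonzero: "0 < k \<Longrightarrow> k < int l \<Longrightarrow> qbr \<epsilon> k \<noteq> 0"
  unfolding qbr_eq_0_iff using zdvd_not_zless by blast

sublocale weight_algebra scal "Eop \<epsilon> r" "Fop \<epsilon> r" "Pop r" \<epsilon> r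
  by (rule weight_algebra_op[OF eps0 eps2])

abbreviation "EE \<equiv> Eop \<epsilon> r"
abbreviation "FF \<equiv> Fop \<epsilon> r"
abbreviation "PP \<equiv> Pop r :: int \<Rightarrow> 'k op"
abbreviation "N \<equiv> 2 ^ r :: nat"
abbreviation "S \<equiv> inf_schur \<epsilon> r"
abbreviation "MS \<equiv> ring_mat TYPE('k) N ()"

lemma dg_A: "dg r g \<in> A"
proof -
  have "dg r g = (\<Sum>m\<in>{0..int r}. scal (g (nat m)) * PP m)"
  proof (rule op_eqI)
    fix x :: "nat \<Rightarrow> 'k"
    have "(\<Sum>m\<in>{0..int r}. g (nat m) * (if int (wt r i) = m then x i else 0))
        = (\<Sum>m\<in>{0..int r}. if int (wt r i) = m then g (wt r i) * x i else 0)" for i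
      by (intro sum.cong) auto
    then have "(\<Sum>m\<in>{0..int r}. g (nat m) * (if int (wt r i) = m then x i else 0)) = g (wt r i) * x i" for i
      using wt_le[of r i] by simp
    then show "act (dg r g) x = act (\<Sum>m\<in>{0..int r}. scal (g (nat m)) * PP m) x"
      by (simp add: act_sum act_Pop dg.rep_eq)
  qed
  then show ?thesis by (auto intro!: A_intros)
qed

lemma gop_A: "gop \<epsilon> r g \<in> A"
  by (cases g) (simp_all only: gop.simps(1,2) gop_K dg_A A_E A_F)

lemma gens_carrier: "little_schur \<epsilon> r \<union> {zeta_Kbinom \<epsilon> r i t | i t. True} \<subseteq> carrier MS"
  and little_carrier: "little_schur \<epsilon> r \<subseteq> carrier MS"
proof -
  have "{c \<cdot>\<^sub>m 1\<^sub>m N | c. True} \<union> {zeta_gen \<epsilon> r g | g. True} \<subseteq> carrier MS"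
    using mop_zeta_gen(1)[OF eps0] by (auto simp: ring_mat_simps)
  then show "little_schur \<epsilon> r \<subseteq> carrier MS"
    unfolding little_schur_generated[OF eps0] by (rule ring.generate_ring_incl[OF ring_mat])
  then show "little_schur \<epsilon> r \<union> {zeta_Kbinom \<epsilon> r i t | i t. True} \<subseteq> carrier MS"
    using mop_zeta_Kbinom(1)[OF eps0] by (auto simp: ring_mat_simps)
qed

lemma carrier_S_eq: "carrier S = generate_ring MS (little_schur \<epsilon> r \<union> {zeta_Kbinom \<epsilon> r i t | i t. True})"
  by (simp add: inf_schur_def)

lemma carrier_S_mat: "M \<in> carrier S \<Longrightarrow> M \<in> carrier_mat N N"
  using ring.generate_ring_in_carrier[OF ring_mat gens_carrier] unfolding carrier_S_eq by (simp add: ring_mat_simps)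

lemma S_simps: "a \<otimes>\<^bsub>S\<^esub> b = a * b" "a \<oplus>\<^bsub>S\<^esub> b = a + b" "\<one>\<^bsub>S\<^esub> = 1\<^sub>m N" "\<zero>\<^bsub>S\<^esub> = 0\<^sub>m N N"
  by (simp_all add: inf_schur_def ring_mat_simps)

lemma S_ring: "ring S"
  unfolding inf_schur_def by (rule ring.generate_ring_is_ring[OF ring_mat gens_carrier])

lemma mop_generate:
  assumes "\<And>M. M \<in> H \<Longrightarrow> M \<in> carrier_mat N N \<and> mop N M \<in> A"
  shows "M \<in> generate_ring MS H \<Longrightarrow> M \<in> carrier_mat N N \<and> mop N M \<in> A"
proof (induction rule: generate_ring.induct)
  case one
  show ?case by (simp add: ring_mat_simps mop_one A_1)
next
  case (incl h)
  then show ?case by (rule assms)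
next
  case (a_inv h)
  have "- h = (- 1) \<cdot>\<^sub>m h" by auto
  then show ?case using a_inv by (simp add: ring_mat_uminus mop_smult A_mult A_sc)
next
  case (eng_add h1 h2)
  then show ?case by (simp add: ring_mat_simps mop_add A_add)
next
  case (eng_mult h1 h2)
  then show ?case by (auto simp: ring_mat_simps mop_mult A_mult intro: mult_carrier_mat)
qed

lemma mop_S: "M \<in> carrier S \<Longrightarrow> mop N M \<in> A"
proof -
  have "M \<in> carrier_mat N N \<and> mop N M \<in> A" if "M \<in> little_schur \<epsilon> r" for M
    by (rule mop_generate[OF _ that[unfolded little_schur_generated[OF eps0]]])
       (use mop_zeta_gen[OF eps0] in \<open>auto simp: mop_scal gop_A A_sc\<close>)
  then have "M \<in> carrier_mat N N \<and> mop N M \<in> A" if "M \<in> carrier S" for M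
    by (intro mop_generate[OF _ that[unfolded carrier_S_eq]])
       (use mop_zeta_Kbinom[OF eps0] in \<open>auto simp: dg_A\<close>)
  then show "M \<in> carrier S \<Longrightarrow> mop N M \<in> A" by blast
qed

lemma S_closed: "M \<in> carrier S \<Longrightarrow> M' \<in> carrier S \<Longrightarrow> M * M' \<in> carrier S"
    "M \<in> carrier S \<Longrightarrow> M' \<in> carrier S \<Longrightarrow> M + M' \<in> carrier S" "1\<^sub>m N \<in> carrier S" "0\<^sub>m N N \<in> carrier S"
  using ring.ring_simprules[OF S_ring] by (auto simp: S_simps)

lemma scal_S: "c \<cdot>\<^sub>m 1\<^sub>m N \<in> carrier S" and zeta_gen_S: "zeta_gen \<epsilon> r g \<in> carrier S"
  and zeta_Kbinom_S: "zeta_Kbinom \<epsilon> r i t \<in> carrier S"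
proof -
  have "c \<cdot>\<^sub>m 1\<^sub>m N \<in> little_schur \<epsilon> r" "zeta_gen \<epsilon> r g \<in> little_schur \<epsilon> r"
    unfolding little_schur_generated[OF eps0] by (rule generate_ring.incl, blast)+
  then show "c \<cdot>\<^sub>m 1\<^sub>m N \<in> carrier S" "zeta_gen \<epsilon> r g \<in> carrier S"
    unfolding carrier_S_eq by (auto intro: generate_ring.incl)
  show "zeta_Kbinom \<epsilon> r i t \<in> carrier S"
    unfolding carrier_S_eq by (rule generate_ring.incl) blast
qed

lemma smult_S: "M \<in> carrier S \<Longrightarrow> c \<cdot>\<^sub>m M \<in> carrier S"
  using S_closed(1)[OF scal_S[of c], of M] carrier_S_mat[of M] by (simp add: mult_smult_assoc_mat[of _ N N _ N])

text \<open>The functions \<open>m \<mapsto> [m; t]\<close> form a unitriangular family, so they span all functions of the weight.\<close>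

lemma dgmat_induct:
  assumes zero: "Q (\<lambda>_. 0)"
    and step: "\<And>g c t. t \<le> r \<Longrightarrow> Q g \<Longrightarrow> Q (\<lambda>m. c * spec \<epsilon> (qbinom m t) + g m)"
    and cong: "\<And>g h. (\<And>m. m \<le> r \<Longrightarrow> g m = h m) \<Longrightarrow> Q g \<Longrightarrow> Q h"
  shows "Q g"
proof -
  have "Q g" if "\<And>m. m < t \<Longrightarrow> g m = 0" "t \<le> Suc r" for g t
    using that
  proof (induction "Suc r - t" arbitrary: t g)
    case 0
    then have "m \<le> r \<Longrightarrow> g m = 0" for m by simp
    then show ?case using cong[OF _ zero, of g] by simp
  next
    case (Suc n)
    \<comment> \<open>Since \<open>[t; t] = 1\<close> and \<open>[m; t] = 0\<close> for
      \<open>m < t\<close>, the difference also vanishes at \<open>t\<close>.\<close>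
    define h where "h m = g m - g t * spec \<epsilon> (qbinom m t)" for m
    have t: "t \<le> r" using Suc by simp
    have "Q h"
    proof (rule Suc.hyps(1))
      show "n = Suc r - Suc t" using Suc by simp
      show "h m = 0" if "m < Suc t" for m
        using that Suc.prems(1)[of m]
        by (cases "m = t") (auto simp: h_def qbinom_self qbinom_eq_0 spec_const[OF eps0])
    qed (use t in simp)
    from step[OF t this, of "g t"] show ?case by (simp add: h_def)
  qed
  from this[of 0 g] show ?thesis by simp
qed

lemma dgmat_add: "dgmat r (\<lambda>m. g m + h m) = dgmat r g + dgmat r (h :: nat \<Rightarrow> 'k)"
  by (rule eq_matI) (auto simp: dgmat_def)

lemma dgmat_smult: "dgmat r (\<lambda>m. c * g m) = c \<cdot>\<^sub>m dgmat r (g :: nat \<Rightarrow> 'k)"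
  by (rule eq_matI) (auto simp: dgmat_def)

lemma zeta_Kbinom_dgmat: "zeta_Kbinom \<epsilon> r i t = dgmat r (\<lambda>m. spec \<epsilon> (qbinom (wcomp r i m) t))"
  using mop_zeta_Kbinom[OF eps0] by (intro mop_inj[of _ N]) (simp_all add: mop_dgmat)

lemma zeta_K_dgmat: "zeta_gen \<epsilon> r (GK i) = dgmat r (\<lambda>m. \<epsilon> ^ wcomp r i m)"
  using mop_zeta_gen[OF eps0] by (intro mop_inj[of _ N]) (simp_all add: mop_dgmat gop_K del: gop.simps)

lemma dgmat_zero: "dgmat r (\<lambda>_. 0 :: 'k) = 0\<^sub>m N N"
  by (rule eq_matI) (auto simp: dgmat_def)

lemma dgmat_S: "dgmat r g \<in> carrier S"
proof (induction g rule: dgmat_induct)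
  case 1
  show ?case by (simp add: dgmat_zero S_closed)
next
  case (2 g c t)
  have "dgmat r (\<lambda>m. spec \<epsilon> (qbinom m t)) \<in> carrier S"
    using zeta_Kbinom_S[of I1 t] by (simp add: zeta_Kbinom_dgmat)
  then show ?case using 2 by (simp add: dgmat_add dgmat_smult S_closed smult_S)
next
  case (3 g h)
  have "dgmat r g = dgmat r h"
    by (rule mop_inj[of _ N]) (simp_all add: mop_dgmat, rule dg_cong, rule 3)
  then show ?case using 3 by simp
qed

text \<open>With \<open>mop_S\<close> this identifies the infinitesimal algebra with
  \<open>A\<close>. The projections \<open>P m\<close> are the point: they arise from the quantum
  binomials through \<open>dgmat_S\<close>.\<close>

lemma A_S: "x \<in> A \<Longrightarrow> \<exists>M\<in>carrier S. mop N M = x"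
proof (induction rule: A.induct)
  case (A_sc c)
  show ?case by (rule bexI[OF _ scal_S[of c]]) (simp add: mop_scal)
next
  case A_E
  show ?case by (rule bexI[OF _ zeta_gen_S[of GE]]) (simp add: mop_zeta_gen eps0)
next
  case A_F
  show ?case by (rule bexI[OF _ zeta_gen_S[of GF]]) (simp add: mop_zeta_gen eps0)
next
  case (A_P m)
  show ?case by (rule bexI[OF _ dgmat_S]) (simp add: mop_dgmat Pop_def)
next
  case (A_add x y)
  then obtain M M' where "M \<in> carrier S" "mop N M = x" "M' \<in> carrier S" "mop N M' = y" by blast
  then show ?case by (intro bexI[of _ "M + M'"]) (simp_all add: mop_add carrier_S_mat S_closed)
next
  case (A_mult x y)
  then obtain M M' where "M \<in> carrier S" "mop N M = x" "M' \<in> carrier S" "mop N M' = y" by blast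
  then show ?case by (intro bexI[of _ "M * M'"]) (simp_all add: mop_mult carrier_S_mat S_closed)
qed

text \<open>The inverse of \<open>mop N\<close> on \<open>A\<close>. The choice is unique because
  \<open>mop\<close> is injective on matrices of size \<open>N\<close>.\<close>

definition mo :: "'k op \<Rightarrow> 'k mat" where
  "mo x = (SOME M. M \<in> carrier S \<and> mop N M = x)"

lemma mo: assumes "x \<in> A" shows "mo x \<in> carrier S" "mop N (mo x) = x"
proof -
  have "mo x \<in> carrier S \<and> mop N (mo x) = x"
    unfolding mo_def by (rule someI_ex) (use A_S[OF assms] in blast)
  then show "mo x \<in> carrier S" "mop N (mo x) = x" by auto
qed

lemma mo_eqI: "M \<in> carrier S \<Longrightarrow> mop N M = x \<Longrightarrow> mo x = M"
  using mo[OF mop_S[of M]] by (intro mop_inj[of _ N]) (auto simp: carrier_S_mat)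

lemma mo_mop: "M \<in> carrier S \<Longrightarrow> mo (mop N M) = M"
  by (rule mo_eqI) auto

lemma mo_mult: "x \<in> A \<Longrightarrow> y \<in> A \<Longrightarrow> mo (x * y) = mo x * mo y"
  by (rule mo_eqI) (simp_all add: mo S_closed mop_mult carrier_S_mat)

lemma mo_add: "x \<in> A \<Longrightarrow> y \<in> A \<Longrightarrow> mo (x + y) = mo x + mo y"
  by (rule mo_eqI) (simp_all add: mo S_closed mop_add carrier_S_mat)

lemma mo_zero: "mo 0 = 0\<^sub>m N N"
  by (rule mo_eqI) (simp_all add: S_closed mop_zero)

lemma mo_E: "mo EE = zeta_gen \<epsilon> r GE"
  by (rule mo_eqI) (simp_all add: zeta_gen_S mop_zeta_gen eps0)

lemma mo_dg: "mo (dg r g) = dgmat r g"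
  by (rule mo_eqI) (simp_all add: dgmat_S mop_dgmat)

section \<open>Blocks\<close>

definition cidem :: "'k op \<Rightarrow> bool" where
  "cidem e \<longleftrightarrow> e \<in> A \<and> e * e = e \<and> (\<forall>x\<in>A. e * x = x * e)"

definition bidem :: "'k op \<Rightarrow> bool" where
  "bidem e \<longleftrightarrow> cidem e \<and> e \<noteq> 0 \<and> (\<forall>f. cidem f \<and> e * f = f \<longrightarrow> f = 0 \<or> f = e)"

lemma central_idempotent_iff: "M \<in> carrier S \<Longrightarrow> central_idempotent S M \<longleftrightarrow> cidem (mop N M)"
proof -
  assume M: "M \<in> carrier S"
  have inj: "M1 = M2 \<longleftrightarrow> mop N M1 = mop N M2" if "M1 \<in> carrier S" "M2 \<in> carrier S" for M1 M2
    using mop_inj[of M1 N M2] that carrier_S_mat by blast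
  have "(\<forall>a\<in>carrier S. M * a = a * M) \<longleftrightarrow> (\<forall>x\<in>A. mop N M * x = x * mop N M)"
  proof (intro iffI ballI)
    fix x assume "\<forall>a\<in>carrier S. M * a = a * M" "x \<in> A"
    then have "M * mo x = mo x * M" using mo by blast
    then have "mop N (M * mo x) = mop N (mo x * M)" by simp
    then show "mop N M * x = x * mop N M"
      using M mo[OF \<open>x \<in> A\<close>] by (simp add: mop_mult carrier_S_mat)
  next
    fix a assume a: "\<forall>x\<in>A. mop N M * x = x * mop N M" "a \<in> carrier S"
    then have "mop N M * mop N a = mop N a * mop N M" using mop_S by blast
    then show "M * a = a * M" using M a(2) by (subst inj) (auto simp: S_closed mop_mult carrier_S_mat)
  qed
  moreover have "M * M = M \<longleftrightarrow> mop N M * mop N M = mop N M"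
    using M inj[of "M * M" M] by (simp add: S_closed mop_mult carrier_S_mat)
  ultimately show ?thesis using M mop_S[OF M] by (simp add: central_idempotent_def cidem_def S_simps)
qed

lemma block_idempotent_iff: "M \<in> carrier S \<Longrightarrow> block_idempotent S M \<longleftrightarrow> bidem (mop N M)"
proof -
  assume M: "M \<in> carrier S"
  have inj: "M1 = M2 \<longleftrightarrow> mop N M1 = mop N M2" if "M1 \<in> carrier S" "M2 \<in> carrier S" for M1 M2
    using mop_inj[of M1 N M2] that carrier_S_mat by blast
  have 0: "M' = 0\<^sub>m N N \<longleftrightarrow> mop N M' = 0" if "M' \<in> carrier S" for M'
    using inj[OF that S_closed(4)] by (simp add: mop_zero)
  have "(\<forall>f. central_idempotent S f \<and> M * f = f \<longrightarrow> f = 0\<^sub>m N N \<or> f = M) \<longleftrightarrow>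
     (\<forall>f. cidem f \<and> mop N M * f = f \<longrightarrow> f = 0 \<or> f = mop N M)"
  proof (intro iffI allI impI)
    fix f assume h: "\<forall>f. central_idempotent S f \<and> M * f = f \<longrightarrow> f = 0\<^sub>m N N \<or> f = M"
      and f: "cidem f \<and> mop N M * f = f"
    then have fA: "f \<in> A" by (simp add: cidem_def)
    have "central_idempotent S (mo f)" using f mo[OF fA] by (simp add: central_idempotent_iff)
    moreover have "M * mo f = mo f" using M f mo[OF fA] by (subst inj) (auto simp: S_closed mop_mult carrier_S_mat)
    ultimately have "mo f = 0\<^sub>m N N \<or> mo f = M" using h by blast
    then show "f = 0 \<or> f = mop N M" using mo[OF fA] 0[of "mo f"] by auto
  next
    fix f assume h: "\<forall>f. cidem f \<and> mop N M * f = f \<longrightarrow> f = 0 \<or> f = mop N M"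
      and f: "central_idempotent S f \<and> M * f = f"
    then have fS: "f \<in> carrier S" by (simp add: central_idempotent_def)
    have "mop N M * mop N f = mop N (M * f)" using M fS by (simp add: mop_mult carrier_S_mat)
    then have "mop N f = 0 \<or> mop N f = mop N M" using h f fS by (auto simp: central_idempotent_iff)
    then show "f = 0\<^sub>m N N \<or> f = M" using 0[OF fS] inj[OF fS M] by auto
  qed
  then show ?thesis using M 0[OF M] by (simp add: block_idempotent_def bidem_def central_idempotent_iff S_simps)
qed

definition blk :: "'k op \<Rightarrow> 'k mat set" where
  "blk e = (\<lambda>a. mo e * a) ` carrier S"

lemma cidem_A: "cidem e \<Longrightarrow> e \<in> A" and cidem_idem: "cidem e \<Longrightarrow> e * e = e"
  and cidem_comm: "cidem e \<Longrightarrow> x \<in> A \<Longrightarrow> e * x = x * e"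
  unfolding cidem_def by blast+

lemma bidem_cidem: "bidem e \<Longrightarrow> cidem e" and bidem_nonzero: "bidem e \<Longrightarrow> e \<noteq> 0"
  unfolding bidem_def by blast+

lemmas bidem_A = cidem_A[OF bidem_cidem]
lemmas bidem_idem = cidem_idem[OF bidem_cidem]
lemmas bidem_comm = cidem_comm[OF bidem_cidem]

lemma block_idempotent_ex_iff:
  "block_idempotent S M \<longleftrightarrow> (\<exists>e. bidem e \<and> M = mo e)"
proof
  assume h: "block_idempotent S M"
  then have "M \<in> carrier S" by (simp add: block_idempotent_def central_idempotent_def)
  then show "\<exists>e. bidem e \<and> M = mo e" using h by (intro exI[of _ "mop N M"]) (simp add: block_idempotent_iff mo_mop)
next
  assume "\<exists>e. bidem e \<and> M = mo e"
  then show "block_idempotent S M" using mo[OF cidem_A[OF bidem_cidem]] by (auto simp: block_idempotent_iff)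
qed

lemma bidemD: "bidem e \<Longrightarrow> cidem f \<Longrightarrow> e * f = f \<Longrightarrow> f = 0 \<or> f = e"
  by (simp add: bidem_def)

lemma cidem_diff:
  assumes "cidem e" "cidem f" "e * f = f"
  shows "cidem (e - f)"
proof -
  have e: "e \<in> A" "e * e = e" "\<And>x. x \<in> A \<Longrightarrow> e * x = x * e" and f: "f \<in> A" "f * f = f" "\<And>x. x \<in> A \<Longrightarrow> f * x = x * f"
    using assms by (blast intro: cidem_A cidem_idem cidem_comm)+
  have fe: "f * e = f" using e(3)[OF f(1)] assms(3) by simp
  have 1: "(e - f) * (e - f) = e - f"
    by (simp add: left_diff_distrib right_diff_distrib e(2) f(2) assms(3) fe)
  have "(e - f) * x = x * (e - f)" if "x \<in> A" for x
    by (simp only: left_diff_distrib right_diff_distrib e(3)[OF that] f(3)[OF that])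
  then show ?thesis using 1 A_diff[OF e(1) f(1)] unfolding cidem_def by blast
qed

lemma cidem_mult: assumes "cidem e" "cidem f" shows "cidem (e * f)"
proof -
  have e: "e \<in> A" "e * e = e" "\<And>x. x \<in> A \<Longrightarrow> e * x = x * e" and f: "f \<in> A" "f * f = f" "\<And>x. x \<in> A \<Longrightarrow> f * x = x * f"
    using assms by (blast intro: cidem_A cidem_idem cidem_comm)+
  have "e * f * (e * f) = e * (f * e) * f" by (simp only: mult.assoc)
  also have "\<dots> = (e * e) * (f * f)" unfolding e(3)[OF f(1), symmetric] by (simp only: mult.assoc)
  finally have 1: "e * f * (e * f) = e * f" by (simp only: e(2) f(2))
  have "e * f * x = x * (e * f)" if "x \<in> A" for x
  proof -
    have "e * f * x = e * x * f" unfolding mult.assoc f(3)[OF that] ..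
    also have "\<dots> = x * (e * f)" unfolding e(3)[OF that] mult.assoc ..
    finally show ?thesis .
  qed
  then show ?thesis using 1 A_mult[OF e(1) f(1)] unfolding cidem_def by blast
qed

text \<open>The product is a nonzero central idempotent below both factors, so primitivity equates
  it with each of them.\<close>

lemma bidem_eq: "bidem e \<Longrightarrow> bidem f \<Longrightarrow> e * f \<noteq> 0 \<Longrightarrow> e = f"
proof -
  assume e: "bidem e" and f: "bidem f" and nz: "e * f \<noteq> 0"
  have c: "cidem (e * f)" using e f by (intro cidem_mult bidem_cidem)
  have "e * (e * f) = e * f" using bidem_idem[OF e] by (simp add: mult.assoc[symmetric])
  then have 1: "e * f = e" using bidemD[OF e c] nz by blast
  have "e * f = f * e" by (rule bidem_comm[OF e bidem_A[OF f]])
  then have "f * (e * f) = e * f" using bidem_idem[OF f] by (simp add: mult.assoc[symmetric])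
  then have "e * f = f" using bidemD[OF f c] nz by blast
  then show "e = f" by (rule trans[OF 1[symmetric]])
qed

text \<open>A block is recorded as a set of matrices. As \<open>e\<close> lies in
  \<open>blk f\<close>, one has \<open>f e = e\<close>, which is nonzero, so primitivity
  applies.\<close>

lemma blk_inj: assumes "bidem e" "bidem f" "blk e = blk f" shows "e = f"
proof -
  have e: "e \<in> A" "e * e = e" "\<And>x. x \<in> A \<Longrightarrow> e * x = x * e" and f: "f \<in> A" "f * f = f"
    using assms(1,2) by (blast intro: bidem_A bidem_idem bidem_comm)+
  have "mo e = mo e * mo e" using mo_mult[OF e(1) e(1)] unfolding e(2) .
  then have "mo e \<in> blk e" unfolding blk_def by (rule image_eqI[OF _ mo(1)[OF e(1)]])
  then have "mo e \<in> blk f" by (simp only: assms(3))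
  then obtain M where M: "M \<in> carrier S" "mo e = mo f * M" unfolding blk_def by blast
  have "e = mop N (mo f * M)" using mo(2)[OF e(1)] M by simp
  also have "\<dots> = f * mop N M" using M mo[OF f(1)] by (simp add: mop_mult carrier_S_mat)
  finally have e': "e = f * mop N M" .
  have "f * (f * mop N M) = f * mop N M" by (simp only: mult.assoc[symmetric] f(2))
  then have fe: "f * e = e" unfolding e'[symmetric] .
  then have "f * e \<noteq> 0" using bidem_nonzero[OF assms(1)] by (rule ssubst)
  then show ?thesis using bidem_eq[OF assms(2,1)] by blast
qed

section \<open>Highest weight vectors and blocks\<close>

definition HW :: "int \<Rightarrow> (nat \<Rightarrow> 'k) \<Rightarrow> bool" where
  "HW a x \<longleftrightarrow> x \<noteq> (\<lambda>_. 0) \<and> act (PP a) x = x \<and> act EE x = (\<lambda>_. 0)"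

lemma HW_range: assumes "HW a x" shows "a \<in> {0..int r}"
proof (rule ccontr)
  assume "a \<notin> {0..int r}"
  then have "PP a = 0" by (intro P_out) auto
  then have "act (PP a) x = (\<lambda>_. 0)" by simp
  moreover have "act (PP a) x = x" "x \<noteq> (\<lambda>_. 0)" using assms by (auto simp: HW_def)
  ultimately show False by (elim notE) (simp only:)
qed

lemma cidem_weight_part:
  assumes "cidem e"
  shows "\<exists>c. \<exists>y\<in>A. e * PP a = scal c * PP a + FF * y * EE"
proof -
  have "e * PP a = PP a * e * PP a"
    using cidem_comm[OF assms A_P[of a]] by (simp add: mult.assoc P_P_left)
  then show ?thesis using A_weight_part[OF cidem_A[OF assms], of a] by (simp only:)
qed

lemma cidem_HW:
  assumes "e * PP a = scal c * PP a + FF * y * EE" "HW a x"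
  shows "act e x = (\<lambda>i. c * x i)"
proof -
  have "act e x = act (e * PP a) x" using assms(2) by (simp add: HW_def)
  then show ?thesis using assms(2) unfolding assms(1) by (simp add: HW_def act_zero)
qed

lemma cidem_HW_eq:
  assumes e: "cidem e" and x: "HW a x" and x': "HW a x'" and ex: "act e x = x"
  shows "act e x' = x'"
proof -
  obtain c y where c: "e * PP a = scal c * PP a + FF * y * EE" using cidem_weight_part[OF e] by blast
  obtain i where "x i \<noteq> 0" using x by (auto simp: HW_def fun_eq_iff)
  moreover have "x i = c * x i" using cidem_HW[OF c x] ex by (metis (mono_tags))
  ultimately have "c = 1" by simp
  then show ?thesis using cidem_HW[OF c x'] by simp
qed

lemma cidem_HW_cases:
  assumes e: "cidem e" and x: "HW a x"
  shows "act e x = x \<or> act e x = (\<lambda>_. 0)"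
proof -
  obtain c y where c: "e * PP a = scal c * PP a + FF * y * EE" using cidem_weight_part[OF e] by blast
  note ex = cidem_HW[OF c x]
  obtain i where i: "x i \<noteq> 0" using x by (auto simp: HW_def fun_eq_iff)
  have "act (e * e) x = act e x" by (simp only: cidem_idem[OF e])
  then have "(\<lambda>i. c * (c * x i)) = (\<lambda>i. c * x i)" by (simp add: ex act_cmult)
  then have "c * (c * x i) = c * x i" by (rule fun_cong)
  then have "c = 0 \<or> c = 1" using i by simp
  then show ?thesis using ex by auto
qed

text \<open>Its cardinality is the measure that makes the search for a primitive central idempotent
  end.\<close>

definition HWs :: "'k op \<Rightarrow> int set" where
  "HWs e = {a. \<exists>x. HW a x \<and> act e x = x}"

lemma HWs_finite: "finite (HWs e)"
  by (rule finite_subset[of _ "{0..int r}"]) (auto simp: HWs_def dest: HW_range)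

text \<open>The image of \<open>e\<close> is stable under the \<open>P m\<close> and
  \<open>E\<close>, since \<open>e\<close> commutes with them; a vector of maximal weight in it is
  killed by \<open>E\<close>.\<close>

lemma HWs_nonempty:
  assumes e: "cidem e" and nz: "e \<noteq> 0"
  shows "HWs e \<noteq> {}"
proof -
  define T where "T = {m. \<exists>y. y \<noteq> (\<lambda>_. 0) \<and> act e y = y \<and> act (PP m) y = y}"
  have "T \<subseteq> {0..int r}"
  proof
    fix m assume "m \<in> T"
    then show "m \<in> {0..int r}" using P_out[of m] by (auto simp: T_def)
  qed
  then have fin: "finite T" by (rule finite_subset) simp
  obtain x where x: "act e x \<noteq> (\<lambda>_. 0)"
  proof -
    have "\<exists>x. act e x \<noteq> (\<lambda>_. 0)"
    proof (rule ccontr)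
      assume "\<nexists>x. act e x \<noteq> (\<lambda>_. 0)"
      then have "e = 0" by (intro op_eqI) simp
      then show False using nz by contradiction
    qed
    then show ?thesis using that by blast
  qed
  define y where "y = act e x"
  have "y = act (\<Sum>m\<in>{0..int r}. PP m) y" by (simp only: P_sum) simp
  then have "y = (\<lambda>i. \<Sum>m\<in>{0..int r}. act (PP m) y i)" by (simp only: act_sum)
  then have "\<exists>m. act (PP m) y \<noteq> (\<lambda>_. 0)"
    using x unfolding y_def[symmetric] by (metis (no_types, lifting) sum.neutral)
  then obtain m where m: "act (PP m) y \<noteq> (\<lambda>_. 0)" by blast
  have comm: "act e (act p v) = act p (act e v)" if "p \<in> A" for p v
    using arg_cong[OF cidem_comm[OF e that], of "\<lambda>T. act T v"] by simp
  have ee: "act e (act e v) = act e v" for v using arg_cong[OF cidem_idem[OF e], of "\<lambda>T. act T v"] by simp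
  have pp: "act (PP m) (act (PP m) v) = act (PP m) v" for m v
    using arg_cong[OF P_mult[of m m], of "\<lambda>T. act T v"] by simp
  have "m \<in> T" unfolding T_def using m pp comm[OF A_P] ee by (auto simp: y_def intro!: exI[of _ "act (PP m) y"])
  then have ne: "T \<noteq> {}" by blast
  define M where "M = Max T"
  have "M \<in> T" unfolding M_def using fin ne by (rule Max_in)
  then obtain w where w: "w \<noteq> (\<lambda>_. 0)" "act e w = w" "act (PP M) w = w" by (auto simp: T_def)
  have "act EE w = (\<lambda>_. 0)"
  proof (rule ccontr)
    assume n: "act EE w \<noteq> (\<lambda>_. 0)"
    have "act (PP (M + 1)) (act EE w) = act EE w"
      using arg_cong[OF E_P[of M], of "\<lambda>T. act T w"] w(3) by simp
    moreover have "act e (act EE w) = act EE w" using comm[OF A_E] w(2) by simp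
    ultimately have "M + 1 \<in> T" using n unfolding T_def by blast
    then have "M + 1 \<le> M" unfolding M_def using fin by (intro Max_ge)
    then show False by simp
  qed
  then have "HW M w" using w by (simp add: HW_def)
  then show ?thesis using w(2) by (auto simp: HWs_def)
qed

text \<open>The complement \<open>e - f\<close> has a highest weight of its own. It belongs to
  \<open>e\<close> but not to \<open>f\<close>, because \<open>f\<close> acts by the same scalar on
  all highest weight vectors of that weight and kills one of them.\<close>

lemma HWs_diff:
  assumes e: "cidem e" and f: "cidem f" and ef: "e * f = f" and ne: "e \<noteq> f"
  shows "card (HWs f) < card (HWs e)"
proof -
  let ?g = "e - f"
  have g: "cidem ?g" by (rule cidem_diff[OF e f ef])
  have sub: "HWs h \<subseteq> HWs e" if "e * h = h" for h
  proof
    fix a assume "a \<in> HWs h"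
    then obtain x where x: "HW a x" "act h x = x" by (auto simp: HWs_def)
    have "act e x = act (e * h) x" using x by simp
    then have "act e x = x" using x that by simp
    then show "a \<in> HWs e" using x by (auto simp: HWs_def)
  qed
  have eg: "e * ?g = ?g" by (simp add: right_diff_distrib ef cidem_idem[OF e])
  have "HWs ?g \<noteq> {}" using HWs_nonempty[OF g] ne by simp
  then obtain a x where a: "a \<in> HWs ?g" "HW a x" "act ?g x = x" by (auto simp: HWs_def)
  have "a \<notin> HWs f"
  proof
    assume "a \<in> HWs f"
    then obtain x' where x': "HW a x'" "act f x' = x'" by (auto simp: HWs_def)
    have "act f x = x" by (rule cidem_HW_eq[OF f x'(1) a(2) x'(2)])
    moreover have "act e x = x"
      using arg_cong[OF eg, of "\<lambda>T. act T x"] a(3) by simp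
    ultimately have "act ?g x = (\<lambda>_. 0)" by simp
    then show False using a by (simp add: HW_def)
  qed
  moreover have "a \<in> HWs e" using a(1) sub[OF eg] by blast
  ultimately have "HWs f \<subset> HWs e" using sub[OF ef] by blast
  then show ?thesis using HWs_finite by (rule psubset_card_mono[rotated])
qed

text \<open>Among the central idempotents fixing \<open>x\<close>, one with the fewest highest
  weights is primitive: if it split, one of the two parts would still fix \<open>x\<close> and have
  fewer.\<close>

lemma block_of_HW_ex:
  assumes x: "HW a x"
  shows "\<exists>e. bidem e \<and> act e x = x"
proof -
  define Q where "Q e \<longleftrightarrow> cidem e \<and> act e x = x" for e
  have "cidem 1" by (simp add: cidem_def A_1)
  then have "Q 1" by (simp add: Q_def)
  then obtain e where e: "Q e" and min: "\<And>f. Q f \<Longrightarrow> card (HWs e) \<le> card (HWs f)"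
    using ex_has_least_nat[of Q 1 "\<lambda>e. card (HWs e)"] by blast
  have ce: "cidem e" "act e x = x" using e by (auto simp: Q_def)
  have "f = 0 \<or> f = e" if f: "cidem f" "e * f = f" for f
  proof (rule ccontr)
    assume n: "\<not> (f = 0 \<or> f = e)"
    have g: "cidem (e - f)" by (rule cidem_diff[OF ce(1) f])
    from cidem_HW_cases[OF f(1) x] show False
    proof
      assume "act f x = x"
      then have "Q f" using f by (simp add: Q_def)
      then show False using min[of f] HWs_diff[OF ce(1) f] n by fastforce
    next
      assume "act f x = (\<lambda>_. 0)"
      then have "Q (e - f)" using g ce by (simp add: Q_def)
      moreover have "e * (e - f) = e - f" by (simp add: right_diff_distrib f(2) cidem_idem[OF ce(1)])
      ultimately show False using min[of "e - f"] HWs_diff[OF ce(1) g] n by fastforce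
    qed
  qed
  moreover have "e \<noteq> 0" using ce(2) x by (auto simp: HW_def)
  ultimately show ?thesis using ce by (auto simp: bidem_def)
qed

section \<open>Simple modules\<close>

lemma smult_mat_mult_vec:
  assumes "M \<in> carrier_mat n n" "v \<in> carrier_vec n"
  shows "(c \<cdot>\<^sub>m M) *\<^sub>v v = c \<cdot>\<^sub>v (M *\<^sub>v v :: 'k vec)"
  by (rule eq_vecI) (use assms in \<open>auto simp: scalar_prod_def sum_distrib_left mult.assoc\<close>)

lemma mult_mat_zero_vec: "M \<in> carrier_mat n n \<Longrightarrow> M *\<^sub>v 0\<^sub>v n = (0\<^sub>v n :: 'k vec)"
  by (rule eq_vecI) (auto simp: scalar_prod_def)

lemma rep_simps:
  assumes "is_rep \<epsilon> r n \<rho>"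
  shows "M \<in> carrier S \<Longrightarrow> \<rho> M \<in> carrier_mat n n"
    "M \<in> carrier S \<Longrightarrow> M' \<in> carrier S \<Longrightarrow> \<rho> (M * M') = \<rho> M * \<rho> M'"
    "M \<in> carrier S \<Longrightarrow> M' \<in> carrier S \<Longrightarrow> \<rho> (M + M') = \<rho> M + \<rho> M'"
    "\<rho> (c \<cdot>\<^sub>m 1\<^sub>m N) = c \<cdot>\<^sub>m 1\<^sub>m n"
    "M \<in> carrier S \<Longrightarrow> \<rho> (c \<cdot>\<^sub>m M) = c \<cdot>\<^sub>m \<rho> M"
    "\<rho> (0\<^sub>m N N) = 0\<^sub>m n n"
proof -
  have h: "\<rho> \<in> ring_hom S (ring_mat TYPE('k) n ())" and c: "\<And>c. \<rho> (c \<cdot>\<^sub>m 1\<^sub>m N) = c \<cdot>\<^sub>m 1\<^sub>m n"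
    using assms by (auto simp: is_rep_def)
  show 1: "M \<in> carrier S \<Longrightarrow> \<rho> M \<in> carrier_mat n n" for M
    using ring_hom_closed[OF h, of M] by (simp add: ring_mat_simps)
  show 2: "M \<in> carrier S \<Longrightarrow> M' \<in> carrier S \<Longrightarrow> \<rho> (M * M') = \<rho> M * \<rho> M'" for M M'
    using ring_hom_mult[OF h, of M M'] by (simp add: ring_mat_simps S_simps)
  show "M \<in> carrier S \<Longrightarrow> M' \<in> carrier S \<Longrightarrow> \<rho> (M + M') = \<rho> M + \<rho> M'"
    using ring_hom_add[OF h, of M M'] by (simp add: ring_mat_simps S_simps)
  show "\<rho> (c \<cdot>\<^sub>m 1\<^sub>m N) = c \<cdot>\<^sub>m 1\<^sub>m n" by (rule c)
  show "\<rho> (c \<cdot>\<^sub>m M) = c \<cdot>\<^sub>m \<rho> M" if M: "M \<in> carrier S"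
  proof -
    have "c \<cdot>\<^sub>m M = (c \<cdot>\<^sub>m 1\<^sub>m N) * M" using carrier_S_mat[OF M] by (simp add: mult_smult_assoc_mat[of _ N N _ N])
    then have "\<rho> (c \<cdot>\<^sub>m M) = (c \<cdot>\<^sub>m 1\<^sub>m n) * \<rho> M" using 2[OF scal_S M] c by simp
    then show ?thesis using 1[OF M] by (simp add: mult_smult_assoc_mat[of _ n n _ n])
  qed
  have "0 \<cdot>\<^sub>m 1\<^sub>m N = (0\<^sub>m N N :: 'k mat)" "0 \<cdot>\<^sub>m 1\<^sub>m n = (0\<^sub>m n n :: 'k mat)" by auto
  then show "\<rho> (0\<^sub>m N N) = 0\<^sub>m n n" using c[of 0] by simp
qed

text \<open>The definition of a highest weight vector prescribes only the action of
  \<open>K_i\<close> and of the binomials. The unitriangular family extends this to all functions of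
  the weight, in particular to the projection onto the weight \<open>a\<close>.\<close>

lemma hw_dgmat:
  assumes rep: "is_rep \<epsilon> r n \<rho>" and v: "highest_weight_vector \<epsilon> r (a, b) n \<rho> v" and ab: "a + b = r"
  shows "\<rho> (dgmat r g) *\<^sub>v v = g a \<cdot>\<^sub>v v"
proof (induction g rule: dgmat_induct)
  case 1
  have "v \<in> carrier_vec n" using v by (simp add: highest_weight_vector_def)
  then show ?case by (auto simp: dgmat_zero rep_simps(6)[OF rep])
next
  case (2 g c t)
  have vc: "v \<in> carrier_vec n" and K: "\<rho> (zeta_Kbinom \<epsilon> r I1 t) *\<^sub>v v = spec \<epsilon> (qbinom a t) \<cdot>\<^sub>v v"
    using v by (auto simp: highest_weight_vector_def)
  have K': "\<rho> (dgmat r (\<lambda>m. spec \<epsilon> (qbinom m t))) *\<^sub>v v = spec \<epsilon> (qbinom a t) \<cdot>\<^sub>v v"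
    using K by (simp add: zeta_Kbinom_dgmat)
  have "\<rho> (dgmat r (\<lambda>m. c * spec \<epsilon> (qbinom m t) + g m)) = c \<cdot>\<^sub>m \<rho> (dgmat r (\<lambda>m. spec \<epsilon> (qbinom m t))) + \<rho> (dgmat r g)"
    unfolding dgmat_add dgmat_smult by (simp add: rep_simps[OF rep] dgmat_S smult_S)
  moreover have "\<rho> (dgmat r (\<lambda>m. spec \<epsilon> (qbinom m t))) \<in> carrier_mat n n" "\<rho> (dgmat r g) \<in> carrier_mat n n"
    by (simp_all add: rep_simps[OF rep] dgmat_S)
  ultimately show ?case using 2(2) vc K'
    by (simp add: add_mult_distrib_mat_vec[of _ n n] smult_mat_mult_vec[of _ n] smult_smult_assoc add_smult_distrib_vec)
next
  case (3 g h)
  have "dgmat r g = dgmat r h"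
    by (rule mop_inj[of _ N]) (simp_all add: mop_dgmat, rule dg_cong, rule 3)
  then show ?case using 3(1)[of a] 3(2) ab by simp
qed

lemma cidem_on_hw:
  assumes rep: "is_rep \<epsilon> r n \<rho>" and v: "highest_weight_vector \<epsilon> r (a, b) n \<rho> v" and ab: "a + b = r"
    and e: "cidem e" "y \<in> A" "e * PP (int a) = scal c * PP (int a) + FF * y * EE"
  shows "\<rho> (mo e) *\<^sub>v v = c \<cdot>\<^sub>v v"
proof -
  have vc: "v \<in> carrier_vec n" and Ev: "\<rho> (mo EE) *\<^sub>v v = 0\<^sub>v n" using v by (auto simp: highest_weight_vector_def mo_E)
  have Pv: "\<rho> (mo (PP (int a))) *\<^sub>v v = v"
    using hw_dgmat[OF rep v ab, of "\<lambda>n. if int n = int a then 1 else 0"] by (simp add: Pop_def mo_dg)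
  have eA: "e \<in> A" by (rule cidem_A[OF e(1)])
  note c = rep_simps(1)[OF rep mo(1)]
  have "\<rho> (mo e) *\<^sub>v v = \<rho> (mo e) *\<^sub>v (\<rho> (mo (PP (int a))) *\<^sub>v v)" by (simp add: Pv)
  also have "\<dots> = \<rho> (mo (e * PP (int a))) *\<^sub>v v"
    using vc by (simp add: mo_mult eA A_P rep_simps[OF rep] mo c assoc_mult_mat_vec[of _ n n _ n])
  also have "\<dots> = (c \<cdot>\<^sub>m \<rho> (mo (PP (int a))) + \<rho> (mo FF) * \<rho> (mo y) * \<rho> (mo EE)) *\<^sub>v v"
  proof -
    have "mo (scal c * PP (int a)) = c \<cdot>\<^sub>m mo (PP (int a))"
      by (rule mo_eqI) (simp_all add: smult_S mo A_P mop_smult carrier_S_mat)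
    then show ?thesis unfolding e(3)
      by (simp add: mo_add mo_mult e(2) A_intros rep_simps[OF rep] mo S_closed smult_S)
  qed
  also have "\<dots> = c \<cdot>\<^sub>v (\<rho> (mo (PP (int a))) *\<^sub>v v) + (\<rho> (mo FF) * \<rho> (mo y)) *\<^sub>v (\<rho> (mo EE) *\<^sub>v v)"
    using vc c[OF A_P] c[OF A_E] c[OF A_F] c[OF e(2)]
    by (simp add: add_mult_distrib_mat_vec[of _ n n] smult_mat_mult_vec[of _ n] assoc_mult_mat_vec[of _ n n _ n])
  also have "\<dots> = c \<cdot>\<^sub>v v"
  proof -
    have "(\<rho> (mo FF) * \<rho> (mo y)) \<in> carrier_mat n n" using c[OF A_F] c[OF e(2)] by (rule mult_carrier_mat)
    then have "(\<rho> (mo FF) * \<rho> (mo y)) *\<^sub>v 0\<^sub>v n = 0\<^sub>v n" by (rule mult_mat_zero_vec)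
    then show ?thesis unfolding Pv Ev using vc by simp
  qed
  finally show ?thesis .
qed

lemma rep_in_block_iff:
  "rep_in_block \<epsilon> r n \<rho> B \<longleftrightarrow> (\<exists>e. bidem e \<and> B = blk e \<and> \<rho> (mo e) = 1\<^sub>m n)"
  unfolding rep_in_block_def block_idempotent_ex_iff blk_def S_simps by auto

text \<open>
  A central idempotent acts on all highest weight vectors of a given weight, in whatever module, by the
  same scalar. Hence the block of a simple module only depends on its highest weight.
\<close>

lemma block_of_eq:
  assumes L: "is_L1hat \<epsilon> r (a, b) n \<rho>" and ab: "a + b = r" and e: "bidem e" and x: "HW (int a) x" "act e x = x"
  shows "block_of \<epsilon> r (a, b) = blk e"
proof -
  have coeff: "\<exists>y\<in>A. e * PP (int a) = scal 1 * PP (int a) + FF * y * EE" if h: "cidem e" "HW (int a) x" "act e x = x" for e x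
  proof -
    obtain c y where c: "y \<in> A" "e * PP (int a) = scal c * PP (int a) + FF * y * EE" using cidem_weight_part[OF h(1)] by blast
    obtain i where "x i \<noteq> 0" using h(2) by (auto simp: HW_def fun_eq_iff)
    moreover have "x i = c * x i" using cidem_HW[OF c(2) h(2)] h(3) by (metis (mono_tags))
    ultimately show ?thesis using c by auto
  qed
  \<comment> \<open>An idempotent with coefficient 1 fixes the generator \<open>v\<close>; being
    central, it fixes every \<open>\<rho>' M v\<close>, that is the whole module.\<close>
  have ins: "\<rho>' (mo f) = 1\<^sub>m n'"
    if L': "is_L1hat \<epsilon> r (a, b) n' \<rho>'" and f: "cidem f" and fy: "y \<in> A" "f * PP (int a) = scal 1 * PP (int a) + FF * y * EE" for n' \<rho>' f y
  proof -
    obtain v where v: "highest_weight_vector \<epsilon> r (a, b) n' \<rho>' v" and gen: "carrier_vec n' = {\<rho>' a *\<^sub>v v | a. a \<in> carrier S}"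
      and rep: "is_rep \<epsilon> r n' \<rho>'" using L' unfolding is_L1hat_def simple_rep_def by blast
    have vc: "v \<in> carrier_vec n'" using v by (simp add: highest_weight_vector_def)
    have fv: "\<rho>' (mo f) *\<^sub>v v = v" using cidem_on_hw[OF rep v ab f fy] by simp
    have fA: "f \<in> A" by (rule cidem_A[OF f])
    have id: "\<rho>' (mo f) *\<^sub>v w = w" if wc: "w \<in> carrier_vec n'" for w
    proof -
      obtain M where M: "M \<in> carrier S" "w = \<rho>' M *\<^sub>v v" using wc unfolding gen by blast
      have "mo f * M = M * mo f"
        using mo_mult[OF fA mop_S[OF M(1)]] mo_mult[OF mop_S[OF M(1)] fA] cidem_comm[OF f mop_S[OF M(1)]] by (simp add: mo_mop M(1))
      then have "\<rho>' (mo f) * \<rho>' M = \<rho>' M * \<rho>' (mo f)"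
        using rep_simps(2)[OF rep mo(1)[OF fA] M(1)] rep_simps(2)[OF rep M(1) mo(1)[OF fA]] by simp
      then have "\<rho>' (mo f) *\<^sub>v (\<rho>' M *\<^sub>v v) = \<rho>' M *\<^sub>v (\<rho>' (mo f) *\<^sub>v v)"
        using vc rep_simps(1)[OF rep M(1)] rep_simps(1)[OF rep mo(1)[OF fA]]
        by (metis assoc_mult_mat_vec)
      then show ?thesis using fv M by simp
    qed
    have car: "\<rho>' (mo f) \<in> carrier_mat n' n'" by (rule rep_simps(1)[OF rep mo(1)[OF fA]])
    show ?thesis
    proof (rule eq_matI)
      fix i j assume ij: "i < dim_row (1\<^sub>m n' :: 'k mat)" "j < dim_col (1\<^sub>m n' :: 'k mat)"
      have "\<rho>' (mo f) $$ (i, j) = (\<rho>' (mo f) *\<^sub>v unit_vec n' j) $ i" using car ij by simp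
      also have "\<dots> = 1\<^sub>m n' $$ (i, j)" using id[of "unit_vec n' j"] ij by simp
      finally show "\<rho>' (mo f) $$ (i, j) = 1\<^sub>m n' $$ (i, j)" .
    qed (use car in auto)
  qed
  obtain y where y: "y \<in> A" "e * PP (int a) = scal 1 * PP (int a) + FF * y * EE"
    using coeff[OF bidem_cidem[OF e] x] by blast
  show ?thesis
    unfolding block_of_def
  proof (rule the_equality)
    show "\<exists>n \<rho>. is_L1hat \<epsilon> r (a, b) n \<rho> \<and> rep_in_block \<epsilon> r n \<rho> (blk e)"
      using L ins[OF L bidem_cidem[OF e] y] e unfolding rep_in_block_iff by blast
  next
    fix B assume "\<exists>n \<rho>. is_L1hat \<epsilon> r (a, b) n \<rho> \<and> rep_in_block \<epsilon> r n \<rho> B"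
    then obtain n' \<rho>' f where L': "is_L1hat \<epsilon> r (a, b) n' \<rho>'" and f: "bidem f" "B = blk f" "\<rho>' (mo f) = 1\<^sub>m n'"
      unfolding rep_in_block_iff by blast
    have rep: "is_rep \<epsilon> r n' \<rho>'" and n': "n' > 0" using L' unfolding is_L1hat_def simple_rep_def by blast+
    \<comment> \<open>Both idempotents act as the identity on the same nonzero module, so their
      product cannot vanish.\<close>
    have "\<rho>' (mo (e * f)) = 1\<^sub>m n'"
      using ins[OF L' bidem_cidem[OF e] y] f(3) rep_simps(2)[OF rep mo(1)[OF bidem_A[OF e]] mo(1)[OF bidem_A[OF f(1)]]]
      by (simp add: mo_mult bidem_A[OF e] bidem_A[OF f(1)])
    moreover have "1\<^sub>m n' \<noteq> (0\<^sub>m n' n' :: 'k mat)"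
    proof
      assume "1\<^sub>m n' = (0\<^sub>m n' n' :: 'k mat)"
      then have "1\<^sub>m n' $$ (0, 0) = (0\<^sub>m n' n' :: 'k mat) $$ (0, 0)" by simp
      then show False using n' by simp
    qed
    ultimately have "e * f \<noteq> 0" using rep_simps(6)[OF rep] mo_zero by auto
    then have "e = f" by (rule bidem_eq[OF e f(1)])
    then show "B = blk e" using f(2) by simp
  qed
qed

end

section \<open>Spans of families of functions\<close>

definition lincomb :: "('i \<Rightarrow> nat \<Rightarrow> 'k::field) \<Rightarrow> 'i set \<Rightarrow> ('i \<Rightarrow> 'k) \<Rightarrow> nat \<Rightarrow> 'k" where
  "lincomb V I R = (\<lambda>k. \<Sum>i\<in>I. R i * V i k)"

definition lspan :: "('i \<Rightarrow> nat \<Rightarrow> 'k::field) \<Rightarrow> 'i set \<Rightarrow> (nat \<Rightarrow> 'k) set" where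
  "lspan V I = range (lincomb V I)"

lemma lspanI: assumes "w = (\<lambda>k. \<Sum>i\<in>I. R i * V i k)" shows "w \<in> lspan V I"
proof -
  have "w = lincomb V I R" unfolding lincomb_def by (rule assms)
  then show ?thesis unfolding lspan_def by blast
qed

lemma lspanE: assumes "w \<in> lspan V I" obtains R where "w = (\<lambda>k. \<Sum>i\<in>I. R i * V i k)"
proof -
  obtain R where "w = lincomb V I R" using assms unfolding lspan_def by blast
  then show thesis by (intro that) (simp only: lincomb_def)
qed

lemma act_lincomb: "act T (\<lambda>k. \<Sum>i\<in>I. R i * V i k) = (\<lambda>k. \<Sum>i\<in>I. R i * act T (V i) k)"
proof (induction I rule: infinite_finite_induct)
  case (insert i I)
  then show ?case by (simp only: sum.insert act_add act_cmult not_False_eq_True)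
qed (simp_all add: act_zero)

lemma lspan_zero: "(\<lambda>_. 0) \<in> lspan V I"
  by (rule lspanI[where R = "\<lambda>_. 0"]) simp

lemma lspan_add: assumes "u \<in> lspan V I" "v \<in> lspan V I" shows "(\<lambda>k. u k + v k) \<in> lspan V I"
proof -
  obtain R R' where "u = (\<lambda>k. \<Sum>i\<in>I. R i * V i k)" "v = (\<lambda>k. \<Sum>i\<in>I. R' i * V i k)"
    using assms by (elim lspanE)
  then show ?thesis by (intro lspanI[where R = "\<lambda>i. R i + R' i"]) (simp add: distrib_right sum.distrib)
qed

lemma lspan_cmult: assumes "u \<in> lspan V I" shows "(\<lambda>k. c * u k) \<in> lspan V I"
proof -
  obtain R where "u = (\<lambda>k. \<Sum>i\<in>I. R i * V i k)" using assms by (rule lspanE)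
  then show ?thesis by (intro lspanI[where R = "\<lambda>i. c * R i"]) (simp add: sum_distrib_left mult.assoc)
qed

lemma lspan_base: assumes "finite I" "i \<in> I" shows "V i \<in> lspan V I"
proof (rule lspanI[where R = "\<lambda>j. if j = i then 1 else 0"])
  have "(\<Sum>j\<in>I. (if j = i then 1 else 0) * V j k) = (\<Sum>j\<in>I. if j = i then V j k else 0)" for k
    by (intro sum.cong) auto
  then show "V i = (\<lambda>k. \<Sum>j\<in>I. (if j = i then 1 else 0) * V j k)" using assms by simp
qed

lemma lspan_sum:
  assumes "\<And>i. i \<in> J \<Longrightarrow> f i \<in> lspan V I" shows "(\<lambda>k. \<Sum>i\<in>J. R i * f i k) \<in> lspan V I"
  using assms
proof (induction J rule: infinite_finite_induct)
  case (insert i J)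
  have "(\<lambda>k. R i * f i k + (\<Sum>i\<in>J. R i * f i k)) \<in> lspan V I"
    by (intro lspan_add lspan_cmult insert.IH insert.prems) auto
  then show ?case using insert.hyps by simp
qed (simp_all add: lspan_zero)

context root_of_unity_schur
begin

lemma A_lspan:
  assumes gen: "\<And>i. i \<in> I \<Longrightarrow> act EE (V i) \<in> lspan V I" "\<And>i. i \<in> I \<Longrightarrow> act FF (V i) \<in> lspan V I"
      "\<And>i m. i \<in> I \<Longrightarrow> act (PP m) (V i) \<in> lspan V I"
    and T: "T \<in> A"
  shows "w \<in> lspan V I \<Longrightarrow> act T w \<in> lspan V I"
  using T
proof (induction arbitrary: w rule: A.induct)
  case (A_sc c)
  then show ?case by (simp add: lspan_cmult)
next
  case A_E
  from A_E obtain R where "w = (\<lambda>k. \<Sum>i\<in>I. R i * V i k)" by (rule lspanE)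
  then show ?case using gen(1) by (simp only: act_lincomb) (rule lspan_sum)
next
  case A_F
  from A_F obtain R where "w = (\<lambda>k. \<Sum>i\<in>I. R i * V i k)" by (rule lspanE)
  then show ?case using gen(2) by (simp only: act_lincomb) (rule lspan_sum)
next
  case (A_P m)
  from A_P obtain R where "w = (\<lambda>k. \<Sum>i\<in>I. R i * V i k)" by (rule lspanE)
  then show ?case using gen(3) by (simp only: act_lincomb) (rule lspan_sum)
next
  case (A_add x y)
  have "(\<lambda>k. act x w k + act y w k) \<in> lspan V I" using A_add by (intro lspan_add) blast+
  then show ?case by simp
next
  case (A_mult x y)
  then show ?case by simp
qed

section \<open>Construction of simple modules\<close>

text \<open>It supplies the module that the description \<open>block_of\<close> refers to: the span
  of the \<open>F^i x\<close> with \<open>i \<le> s\<close> in the tensor space. The hypothesis on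
  \<open>F\<close> bounds the ladder; the nonzero norms let \<open>E^i\<close> return from
  \<open>F^i x\<close> to a nonzero multiple of \<open>x\<close>, whence simplicity.\<close>

lemma L1_exists:
  assumes x: "HW (int a) x" and ab: "a + b = r" and F0: "act (FF ^ Suc s) x = (\<lambda>_. 0)"
    and nz: "\<And>i. i \<le> s \<Longrightarrow> qnorm \<epsilon> i (int a - int b) \<noteq> 0"
  shows "\<exists>n \<rho>. is_L1hat \<epsilon> r (a, b) n \<rho>"
proof -
  define xi where "xi i = act (FF ^ i) x" for i
  have xP: "act (PP (int a)) x = x" and xE: "act EE x = (\<lambda>_. 0)" and x0: "x \<noteq> (\<lambda>_. 0)" using x by (auto simp: HW_def)
  have h: "2 * int a - int r = int a - int b" using ab by simp
  have xi0: "xi 0 = x" by (simp add: xi_def)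
  have Nx: "act (EE ^ i) (xi i) = (\<lambda>k. qnorm \<epsilon> i (int a - int b) * x k)" for i
  proof -
    obtain y where y: "EE ^ i * FF ^ i * PP (int a) = scal (qnorm \<epsilon> i (int a - int b)) * PP (int a) + FF * y * EE"
      using E_pow_F_pow[of i "int a"] unfolding h by blast
    have "act (EE ^ i) (xi i) = act (EE ^ i * FF ^ i * PP (int a)) x" by (simp add: xi_def xP)
    then show ?thesis unfolding y by (simp add: xP xE act_zero)
  qed
  have Pxi: "act (PP m) (xi i) = (if m = int a - int i then xi i else (\<lambda>_. 0))" for m i
  proof -
    have "xi i = act (FF ^ i * PP (int a)) x" by (simp add: xi_def xP)
    then have "act (PP m) (xi i) = act (PP m * PP (int a - int i) * FF ^ i) x" unfolding F_pow_P by simp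
    also have "\<dots> = (if m = int a - int i then act (PP (int a - int i) * FF ^ i) x else (\<lambda>_. 0))" by (simp add: P_mult)
    finally show ?thesis using \<open>xi i = act (FF ^ i * PP (int a)) x\<close> unfolding F_pow_P by simp
  qed
  have Exi: "act EE (xi (Suc i)) = (\<lambda>k. (br (int i + 1) * br (int a - int b - int i)) * xi i k)" for i
  proof -
    have "act EE (xi (Suc i)) = act (EE * FF ^ Suc i * PP (int a)) x" by (simp add: xi_def xP)
    also have "\<dots> = (\<lambda>k. (br (int i + 1) * br (int a - int b - int i)) * xi i k)"
      unfolding E_F_pow h by (simp add: xP xE act_zero xi_def)
    finally show ?thesis .
  qed
  have Fxi: "act FF (xi i) = xi (Suc i)" for i by (simp add: xi_def)
  have xis: "xi (Suc s) = (\<lambda>_. 0)" using F0 by (simp only: xi_def)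
  have xi_nz: "xi i \<noteq> (\<lambda>_. 0)" if "i \<le> s" for i
  proof
    assume "xi i = (\<lambda>_. 0)"
    then have "(\<lambda>k. qnorm \<epsilon> i (int a - int b) * x k) = (\<lambda>_. 0)" using Nx[of i] by (simp add: act_zero)
    then have "x = (\<lambda>_. 0)" using nz[OF that] by (auto simp: fun_eq_iff)
    then show False using x0 by contradiction
  qed
  \<comment> \<open>The \<open>xi i\<close> have distinct weights, hence disjoint supports, so a
    coordinate in the support of \<open>xi i\<close> reads off the coefficient of
    \<open>xi i\<close> in any combination.\<close>
  define kp where "kp i = (SOME k. xi i k \<noteq> 0)" for i
  have kp: "xi i (kp i) \<noteq> 0" if "i \<le> s" for i
    unfolding kp_def by (rule someI_ex) (use xi_nz[OF that] in \<open>auto simp: fun_eq_iff\<close>)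
  have wt_xi: "int (wt r k) = int a - int i" if "xi i k \<noteq> 0" for i k
    using Pxi[of "int a - int i" i] that by (auto simp: act_Pop fun_eq_iff) metis
  have kp_other: "xi j (kp i) = 0" if "i \<le> s" "i \<noteq> j" for i j
    using wt_xi[OF kp[OF that(1)]] wt_xi[of j "kp i"] that(2) by linarith
  define I where "I = {..s}"
  have fin: "finite I" by (simp add: I_def)
  have spn: "act T w \<in> lspan xi I" if "T \<in> A" "w \<in> lspan xi I" for T w
  proof (rule A_lspan[OF _ _ _ that])
    fix i assume i: "i \<in> I"
    show "act EE (xi i) \<in> lspan xi I"
      using i by (cases i) (auto simp: xi0 xE Exi I_def intro!: lspan_zero lspan_cmult lspan_base)
    show "act FF (xi i) \<in> lspan xi I"
    proof (cases "i = s")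
      case True
      then show ?thesis by (simp add: Fxi xis lspan_zero)
    next
      case False
      then show ?thesis using i unfolding Fxi by (intro lspan_base) (auto simp: I_def)
    qed
    show "act (PP m) (xi i) \<in> lspan xi I" for m
      unfolding Pxi using i fin by (auto intro: lspan_zero lspan_base)
  qed
  define cf where "cf T i j = act T (xi j) (kp i) / xi i (kp i)" for T i j
  have cf: "act T (xi j) = (\<lambda>k. \<Sum>i\<in>I. cf T i j * xi i k)" if "T \<in> A" "j \<le> s" for T j
  proof -
    have "act T (xi j) \<in> lspan xi I" using that fin by (intro spn lspan_base) (auto simp: I_def)
    then obtain R where R: "act T (xi j) = (\<lambda>k. \<Sum>i\<in>I. R i * xi i k)" by (rule lspanE)
    have "cf T i j = R i" if i: "i \<in> I" for i
    proof -
      have "act T (xi j) (kp i) = (\<Sum>i'\<in>I. if i = i' then R i * xi i (kp i) else 0)"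
        unfolding R using i by (intro sum.cong refl) (auto simp: kp_other I_def)
      also have "\<dots> = R i * xi i (kp i)" using fin i by simp
      finally show ?thesis using kp[of i] i by (simp add: cf_def I_def)
    qed
    then show ?thesis unfolding R by simp
  qed
  have cf_unique: "cf T i j = R i" if "act T (xi j) = (\<lambda>k. \<Sum>i\<in>I. R i * xi i k)" "i \<le> s" for T i j R
  proof -
    have "act T (xi j) (kp i) = (\<Sum>i'\<in>I. if i = i' then R i * xi i (kp i) else 0)"
      unfolding that(1) using that(2) by (intro sum.cong refl) (auto simp: kp_other I_def)
    also have "\<dots> = R i * xi i (kp i)" using fin that(2) by (simp add: I_def)
    finally show ?thesis using kp[of i] that(2) by (simp add: cf_def)
  qed
  define n where "n = Suc s"
  define \<rho> where "\<rho> M = mat n n (\<lambda>(i, j). cf (mop N M) i j)" for M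
  have \<rho>c: "\<rho> M \<in> carrier_mat n n" for M by (simp add: \<rho>_def)
  have cf_scal: "cf (scal c) i j = (if i = j then c else 0)" if "i \<le> s" "j \<le> s" for c i j
    using kp[OF that(1)] kp_other[OF that(1), of j] by (cases "i = j") (auto simp: cf_def)
  have rep: "is_rep \<epsilon> r n \<rho>"
    unfolding is_rep_def
  proof (intro conjI allI)
    show "\<rho> (c \<cdot>\<^sub>m 1\<^sub>m (2 ^ r)) = c \<cdot>\<^sub>m 1\<^sub>m n" for c
      by (rule eq_matI) (auto simp: \<rho>_def mop_scal cf_scal n_def)
    show "\<rho> \<in> ring_hom S (ring_mat TYPE('k) n ())"
    proof (rule ring_hom_memI)
      fix M M' assume M: "M \<in> carrier S" and M': "M' \<in> carrier S"
      show "\<rho> M \<in> carrier (ring_mat TYPE('k) n ())" using \<rho>c by (simp add: ring_mat_simps)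
      have "\<rho> (M + M') = \<rho> M + \<rho> M'"
        using M M' by (intro eq_matI) (auto simp: \<rho>_def mop_add carrier_S_mat cf_def add_divide_distrib)
      then show "\<rho> (M \<oplus>\<^bsub>S\<^esub> M') = \<rho> M \<oplus>\<^bsub>ring_mat TYPE('k) n ()\<^esub> \<rho> M'" by (simp add: ring_mat_simps S_simps)
      have "\<rho> (M * M') = \<rho> M * \<rho> M'"
      proof (rule eq_matI)
        fix i j assume "i < dim_row (\<rho> M * \<rho> M')" "j < dim_col (\<rho> M * \<rho> M')"
        then have ij: "i \<le> s" "j \<le> s" by (auto simp: \<rho>_def n_def)
        have "act (mop N (M * M')) (xi j) = act (mop N M) (\<lambda>k. \<Sum>i\<in>I. cf (mop N M') i j * xi i k)"
          using M M' cf[OF mop_S[OF M'] ij(2)] by (simp add: mop_mult carrier_S_mat)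
        then have "act (mop N (M * M')) (xi j) (kp i) = (\<Sum>k\<in>I. cf (mop N M') k j * act (mop N M) (xi k) (kp i))"
          by (simp only: act_lincomb)
        then have "cf (mop N (M * M')) i j = (\<Sum>k\<in>I. cf (mop N M) i k * cf (mop N M') k j)"
          by (simp add: cf_def[of "mop N (M * M')"] cf_def[of "mop N M"] sum_divide_distrib mult.commute)
        also have "I = {0..<n}" by (auto simp: I_def n_def)
        finally show "\<rho> (M * M') $$ (i, j) = (\<rho> M * \<rho> M') $$ (i, j)"
          using ij by (simp add: \<rho>_def n_def scalar_prod_def)
      qed (auto simp: \<rho>_def)
      then show "\<rho> (M \<otimes>\<^bsub>S\<^esub> M') = \<rho> M \<otimes>\<^bsub>ring_mat TYPE('k) n ()\<^esub> \<rho> M'" by (simp add: ring_mat_simps S_simps)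
    next
      have "\<rho> (1\<^sub>m N) = 1\<^sub>m n"
        using cf_scal[of _ _ 1] by (intro eq_matI) (auto simp: \<rho>_def mop_one n_def scal_one)
      then show "\<rho> \<one>\<^bsub>S\<^esub> = \<one>\<^bsub>ring_mat TYPE('k) n ()\<^esub>" by (simp add: ring_mat_simps S_simps)
    qed
  qed
  have transitive: "\<exists>M\<in>carrier S. \<rho> M *\<^sub>v y = w" if y: "y \<in> carrier_vec n" "y \<noteq> 0\<^sub>v n" and w: "w \<in> carrier_vec n" for y w
  proof -
    obtain j where j: "j < n" "y $ j \<noteq> 0" using y by (metis carrier_vecD eq_vecI index_zero_vec)
    then have js: "j \<le> s" by (simp add: n_def)
    \<comment> \<open>The projection isolates the component with index \<open>j\<close>,
      \<open>E ^ j\<close> leads it back to a multiple of \<open>x\<close>, and the powers of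
      \<open>F\<close> distribute the prescribed coordinates of \<open>w\<close>.\<close>
    define T where "T = (\<Sum>i\<in>I. scal (w $ i / (y $ j * qnorm \<epsilon> j (int a - int b))) * (FF ^ i * EE ^ j * PP (int a - int j)))"
    have TA: "T \<in> A" unfolding T_def by (intro A_intros)
    have T: "act T (xi k) = (\<lambda>q. \<Sum>i\<in>I. (if k = j then w $ i / y $ j else 0) * xi i q)" for k
    proof (cases "k = j")
      case True
      have "act (FF ^ i * EE ^ j * PP (int a - int j)) (xi j) = (\<lambda>q. qnorm \<epsilon> j (int a - int b) * xi i q)" for i
        by (simp add: Pxi Nx act_cmult xi_def[of i])
      then show ?thesis using True nz[OF js] j unfolding T_def act_sum by (simp add: field_simps)
    next
      case False
      then have "act (FF ^ i * EE ^ j * PP (int a - int j)) (xi k) = (\<lambda>_. 0)" for i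
        by (simp add: Pxi act_zero)
      then show ?thesis using False unfolding T_def act_sum by simp
    qed
    have "\<rho> (mo T) *\<^sub>v y = w"
    proof (rule eq_vecI)
      fix i assume "i < dim_vec w"
      then have i: "i < n" "i \<le> s" using w by (auto simp: n_def)
      have "(\<rho> (mo T) *\<^sub>v y) $ i = (\<Sum>k\<in>{0..<n}. cf T i k * y $ k)"
        using i y by (simp add: \<rho>_def scalar_prod_def mo[OF TA])
      also have "\<dots> = (\<Sum>k\<in>{0..<n}. if k = j then w $ i else 0)"
        using cf_unique[OF T i(2)] j by (intro sum.cong) auto
      finally show "(\<rho> (mo T) *\<^sub>v y) $ i = w $ i" using j by simp
    qed (use w in \<open>simp add: \<rho>_def\<close>)
    then show ?thesis using mo(1)[OF TA] by blast
  qed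
  let ?v = "unit_vec n 0 :: 'k vec"
  have n0: "n > 0" by (simp add: n_def)
  have vc: "?v \<in> carrier_vec n" "?v \<noteq> 0\<^sub>v n"
  proof -
    have "?v $ 0 \<noteq> (0\<^sub>v n :: 'k vec) $ 0" using n0 by simp
    then show "?v \<noteq> 0\<^sub>v n" by metis
  qed simp
  have hwd: "\<rho> (dgmat r g) *\<^sub>v ?v = g a \<cdot>\<^sub>v ?v" for g
  proof (rule eq_vecI)
    fix i assume "i < dim_vec (g a \<cdot>\<^sub>v ?v)"
    then have i: "i < n" "i \<le> s" by (auto simp: n_def)
    have gx: "act (dg r g) x = (\<lambda>k. g a * x k)"
      using wt_xi[of 0] by (auto simp: dg.rep_eq fun_eq_iff xi0)
    have "(\<rho> (dgmat r g) *\<^sub>v ?v) $ i = cf (dg r g) i 0" using i n0 by (simp add: \<rho>_def mop_dgmat)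
    also have "\<dots> = (if i = 0 then g a else 0)"
      using kp[OF i(2)] kp_other[OF i(2), of 0] by (cases "i = 0") (auto simp: cf_def xi0 gx)
    finally show "(\<rho> (dgmat r g) *\<^sub>v ?v) $ i = (g a \<cdot>\<^sub>v ?v) $ i" using i n0 by auto
  qed (simp add: \<rho>_def)
  have hwv: "highest_weight_vector \<epsilon> r (a, b) n \<rho> ?v"
    unfolding highest_weight_vector_def
  proof (intro conjI allI)
    show "\<rho> (zeta_gen \<epsilon> r GE) *\<^sub>v ?v = 0\<^sub>v n"
    proof (rule eq_vecI)
      fix i assume "i < dim_vec (0\<^sub>v n :: 'k vec)"
      then have i: "i < n" by simp
      then have "(\<rho> (zeta_gen \<epsilon> r GE) *\<^sub>v ?v) $ i = cf EE i 0" using n0 by (simp add: \<rho>_def mop_zeta_gen[OF eps0])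
      then show "(\<rho> (zeta_gen \<epsilon> r GE) *\<^sub>v ?v) $ i = 0\<^sub>v n $ i" using i by (simp add: cf_def xi0 xE)
    qed (simp add: \<rho>_def)
    have wc: "wcomp r i a = weight_comp (a, b) i" for i using ab by (cases i) auto
    show "\<rho> (zeta_gen \<epsilon> r (GK i)) *\<^sub>v ?v = \<epsilon> ^ weight_comp (a, b) i \<cdot>\<^sub>v ?v" for i
      unfolding zeta_K_dgmat hwd wc ..
    show "\<rho> (zeta_Kbinom \<epsilon> r i t) *\<^sub>v ?v = spec \<epsilon> (qbinom (weight_comp (a, b) i) t) \<cdot>\<^sub>v ?v" for i t
      unfolding zeta_Kbinom_dgmat hwd wc ..
  qed (use vc in auto)
  have gen: "carrier_vec n = {\<rho> M *\<^sub>v ?v | M. M \<in> carrier S}"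
  proof
    show "carrier_vec n \<subseteq> {\<rho> M *\<^sub>v ?v | M. M \<in> carrier S}"
    proof
      fix w :: "'k vec" assume "w \<in> carrier_vec n"
      then have "\<exists>M\<in>carrier S. \<rho> M *\<^sub>v ?v = w" by (rule transitive[OF vc])
      then obtain M where "M \<in> carrier S" "\<rho> M *\<^sub>v ?v = w" by (elim bexE)
      then show "w \<in> {\<rho> M *\<^sub>v ?v | M. M \<in> carrier S}" by (intro CollectI exI[of _ M]) simp
    qed
    show "{\<rho> M *\<^sub>v ?v | M. M \<in> carrier S} \<subseteq> carrier_vec n"
    proof
      fix w assume "w \<in> {\<rho> M *\<^sub>v ?v | M. M \<in> carrier S}"
      then obtain M where "w = \<rho> M *\<^sub>v ?v" by (elim CollectE exE conjE)
      then show "w \<in> carrier_vec n" using mult_mat_vec_carrier[OF \<rho>c vc(1)] by simp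
    qed
  qed
  have "simple_rep \<epsilon> r n \<rho>"
    unfolding simple_rep_def
  proof (intro conjI allI impI)
    fix W assume W: "submodule_of_rep \<epsilon> r n \<rho> W"
    show "W = {0\<^sub>v n} \<or> W = carrier_vec n"
    proof (rule disjCI)
      assume nW: "W \<noteq> carrier_vec n"
      have W': "W \<subseteq> carrier_vec n" "0\<^sub>v n \<in> W" "\<And>M y. M \<in> carrier S \<Longrightarrow> y \<in> W \<Longrightarrow> \<rho> M *\<^sub>v y \<in> W"
        using W by (simp_all add: submodule_of_rep_def)
      have "y = 0\<^sub>v n" if "y \<in> W" for y
      proof (rule ccontr)
        assume "y \<noteq> 0\<^sub>v n"
        have "carrier_vec n \<subseteq> W"
        proof
          fix w :: "'k vec" assume w: "w \<in> carrier_vec n"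
          have yc: "y \<in> carrier_vec n" using W'(1) that by (rule subsetD)
          obtain M where M: "M \<in> carrier S" "\<rho> M *\<^sub>v y = w" using transitive[OF yc \<open>y \<noteq> 0\<^sub>v n\<close> w] by (elim bexE)
          show "w \<in> W" using W'(3)[OF M(1) that] by (simp only: M(2))
        qed
        then show False using nW W'(1) by blast
      qed
      then have "W \<subseteq> {0\<^sub>v n}" by (intro subsetI) (simp only: singleton_iff)
      then show "W = {0\<^sub>v n}" using W'(2) by (intro equalityI) simp_all
    qed
  qed (use rep n0 in auto)
  then have "is_L1hat \<epsilon> r (a, b) n \<rho>" unfolding is_L1hat_def
    by (intro conjI exI[of _ ?v] hwv gen)
  then show ?thesis by (intro exI)
qed

section \<open>Non-semisimple and semisimple blocks\<close>

text \<open>\<open>E\<close> and \<open>F\<close> move the index by one, so an index set spans a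
  submodule as soon as every step leaving it has coefficient zero or ends outside
  \<open>0..n\<close>.\<close>

lemma wv_lspan_invariant:
  assumes r: "r = 2 * b + n" and I: "I \<subseteq> {0..int n}"
    and E: "\<And>i. i \<in> I \<Longrightarrow> i = 0 \<or> i - 1 \<in> I \<or> br (int n - i + 1) = 0"
    and F: "\<And>i. i \<in> I \<Longrightarrow> i = int n \<or> i + 1 \<in> I \<or> br (i + 1) = 0"
    and T: "T \<in> A" and u: "u \<in> lspan (wv \<epsilon> b n) I"
  shows "act T u \<in> lspan (wv \<epsilon> b n) I"
proof (rule A_lspan[OF _ _ _ T u])
  have fin: "finite I" using I by (rule finite_subset) simp
  fix i assume i: "i \<in> I"
  have z: "wv \<epsilon> b n (- 1) = (\<lambda>_. 0)" "wv \<epsilon> b n (int n + 1) = (\<lambda>_. 0)" by (simp_all add: wv_eq_0)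
  have "(\<lambda>k. br (int n - i + 1) * wv \<epsilon> b n (i - 1) k) \<in> lspan (wv \<epsilon> b n) I"
  proof (cases "i - 1 \<in> I")
    case True
    then show ?thesis using fin by (intro lspan_cmult lspan_base)
  next
    case False
    then have "(\<lambda>k. br (int n - i + 1) * wv \<epsilon> b n (i - 1) k) = (\<lambda>_. 0)" using E[OF i] z by auto
    then show ?thesis by (simp only: lspan_zero)
  qed
  then show "act EE (wv \<epsilon> b n i) \<in> lspan (wv \<epsilon> b n) I"
    unfolding Eop_wv[OF eps0 eps2, of b n i, folded r] .
  have "(\<lambda>k. br (i + 1) * wv \<epsilon> b n (i + 1) k) \<in> lspan (wv \<epsilon> b n) I"
  proof (cases "i + 1 \<in> I")
    case True
    then show ?thesis using fin by (intro lspan_cmult lspan_base)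
  next
    case False
    then have "(\<lambda>k. br (i + 1) * wv \<epsilon> b n (i + 1) k) = (\<lambda>_. 0)" using F[OF i] z by auto
    then show ?thesis by (simp only: lspan_zero)
  qed
  then show "act FF (wv \<epsilon> b n i) \<in> lspan (wv \<epsilon> b n) I"
    unfolding Fop_wv[OF eps0 eps2, of b n i, folded r] .
  have "i \<le> int n" using i I by auto
  then show "act (PP m) (wv \<epsilon> b n i) \<in> lspan (wv \<epsilon> b n) I" for m
    using i fin by (auto simp: Pop_wv[of i n b, folded r] lspan_zero intro!: lspan_base)
qed

lemma P_lspan_wv:
  assumes r: "r = 2 * b + n" and I: "I \<subseteq> {0..int n}" and u: "u \<in> lspan (wv \<epsilon> b n) I"
  shows "\<exists>c. act (PP (int b + int n - j)) u = (\<lambda>k. c * wv \<epsilon> b n j k)"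
    and "j \<notin> I \<Longrightarrow> act (PP (int b + int n - j)) u = (\<lambda>_. 0)"
proof -
  obtain R where R: "u = (\<lambda>k. \<Sum>i\<in>I. R i * wv \<epsilon> b n i k)" using u by (rule lspanE)
  have fin: "finite I" using I by (rule finite_subset) simp
  have "act (PP (int b + int n - j)) u k = (\<Sum>i\<in>I. if i = j then R i * wv \<epsilon> b n i k else 0)" for k
    unfolding R act_lincomb
  proof (intro sum.cong refl)
    fix i assume "i \<in> I"
    then have "i \<le> int n" using I by auto
    then show "R i * act (PP (int b + int n - j)) (wv \<epsilon> b n i) k = (if i = j then R i * wv \<epsilon> b n i k else 0)"
      by (simp add: Pop_wv[of i n b, folded r])
  qed
  also have "\<dots>k = (if j \<in> I then R j else 0) * wv \<epsilon> b n j k" for k using fin by simp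
  finally have P: "act (PP (int b + int n - j)) u = (\<lambda>k. (if j \<in> I then R j else 0) * wv \<epsilon> b n j k)" by (rule ext)
  then show "\<exists>c. act (PP (int b + int n - j)) u = (\<lambda>k. c * wv \<epsilon> b n j k)" by (rule exI)
  show "j \<notin> I \<Longrightarrow> act (PP (int b + int n - j)) u = (\<lambda>_. 0)" unfolding P by simp
qed

text \<open>
  The weight spaces of the span of the \<open>wv \<epsilon> b n i\<close> are one-dimensional. Hence, in a semisimple block,
  \<open>w\<^sub>j\<close> is recovered from any of its nonzero images \<open>T w\<^sub>j\<close>, which is impossible inside a submodule
  not containing \<open>w\<^sub>j\<close>.
\<close>

lemma not_semisimple:
  assumes r: "r = 2 * b + n" and e: "cidem e"
    and ss: "semisimple_ring (S\<lparr>carrier := blk e, one := mo e\<rparr>)"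
    and j: "0 \<le> j" "j \<le> int n" and ew: "act e (wv \<epsilon> b n j) = wv \<epsilon> b n j"
    and T: "T \<in> A" "act T (wv \<epsilon> b n j) \<noteq> (\<lambda>_. 0)" "act T (wv \<epsilon> b n j) \<in> lspan (wv \<epsilon> b n) I"
    and I: "I \<subseteq> {0..int n}" "j \<notin> I"
    and cl: "\<And>i. i \<in> I \<Longrightarrow> i = 0 \<or> i - 1 \<in> I \<or> br (int n - i + 1) = 0"
      "\<And>i. i \<in> I \<Longrightarrow> i = int n \<or> i + 1 \<in> I \<or> br (i + 1) = 0"
  shows False
proof -
  define w where "w = wv \<epsilon> b n j"
  define m where "m = int b + int n - j"
  \<comment> \<open>The elements \<open>M\<close> for which \<open>M w\<close> has no component
    along \<open>w\<close>; the idempotent \<open>e\<close> fixes \<open>w\<close> and is not among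
    them.\<close>
  define K where "K = {M \<in> carrier S. act (PP m) (act (mop N M) w) = (\<lambda>_. 0)}"
  have w0: "w \<noteq> (\<lambda>_. 0)" unfolding w_def by (rule wv_nonzero[OF eps0 j])
  have Pw: "act (PP m) w = w" using j(2) by (simp add: w_def m_def Pop_wv[of j n b, folded r])
  have eA: "e \<in> A" by (rule cidem_A[OF e])
  interpret SR: ring S by (rule S_ring)
  have ce: "central_idempotent S (mo e)" using e mo[OF eA] by (simp add: central_idempotent_iff)
  have corner: "(\<lambda>a. mo e \<otimes>\<^bsub>S\<^esub> a) ` carrier S = blk e" by (simp add: blk_def S_simps)
  have "\<exists>y\<in>carrier S. y \<notin> K \<and> (\<forall>a\<in>carrier S. a \<otimes>\<^bsub>S\<^esub> y \<noteq> \<zero>\<^bsub>S\<^esub> \<longrightarrow> (\<exists>x\<in>carrier S. x \<otimes>\<^bsub>S\<^esub> (a \<otimes>\<^bsub>S\<^esub> y) = y))"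
  proof (rule SR.semisimple_blockD[OF ce])
    show "semisimple_ring (SR.corner_ring (mo e))" unfolding corner by (rule ss)
    show "\<zero>\<^bsub>S\<^esub> \<in> K" by (simp add: K_def S_simps S_closed mop_zero act_zero)
    have add: "act (PP m) (act (mop N (x + y)) w) = (\<lambda>k. act (PP m) (act (mop N x) w) k + act (PP m) (act (mop N y) w) k)"
      if "x \<in> carrier S" "y \<in> carrier S" for x y
      using that by (simp add: mop_add carrier_S_mat act_add)
    then show "x \<oplus>\<^bsub>S\<^esub> y \<in> K" if "x \<in> K" "y \<in> K" for x y
      using that by (simp add: K_def S_simps S_closed)
    show "\<ominus>\<^bsub>S\<^esub> x \<in> K" if "x \<in> K" for x
    proof -
      have x: "x \<in> carrier S" "\<ominus>\<^bsub>S\<^esub> x \<in> carrier S" using that by (simp_all add: K_def)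
      have "x + \<ominus>\<^bsub>S\<^esub> x = 0\<^sub>m N N" using SR.r_neg[OF x(1)] by (simp add: S_simps)
      then have "act (PP m) (act (mop N (\<ominus>\<^bsub>S\<^esub> x)) w) = (\<lambda>_. 0)"
        using add[OF x] that by (simp add: K_def mop_zero act_zero fun_eq_iff)
      then show ?thesis using x by (simp add: K_def)
    qed
    show "mo e \<notin> K" using w0 Pw ew by (simp add: K_def mo[OF eA] w_def[symmetric])
  qed
  then obtain y where y: "y \<in> carrier S" "y \<notin> K"
    and recover: "\<And>a. a \<in> carrier S \<Longrightarrow> a * y \<noteq> 0\<^sub>m N N \<Longrightarrow> \<exists>x\<in>carrier S. x * (a * y) = y"
    unfolding S_simps by metis
  let ?Y = "mop N y"
  have full: "act X u \<in> lspan (wv \<epsilon> b n) {0..int n}" if "X \<in> A" "u \<in> lspan (wv \<epsilon> b n) {0..int n}" for X u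
    using that by (intro wv_lspan_invariant[OF r]) auto
  have wl: "w \<in> lspan (wv \<epsilon> b n) {0..int n}" unfolding w_def using j by (intro lspan_base) auto
  obtain c where c: "act (PP m) (act ?Y w) = (\<lambda>k. c * w k)"
    using P_lspan_wv(1)[OF r order_refl full[OF mop_S[OF y(1)] wl], of j] unfolding m_def w_def by blast
  have c0: "c \<noteq> 0" using y c by (auto simp: K_def)
  \<comment> \<open>The element \<open>T P m\<close> sends \<open>y w\<close> to a nonzero multiple
    of \<open>T w\<close>. So \<open>a y\<close> is nonzero and some \<open>x\<close> recovers
    \<open>y\<close> from it, although no \<open>x\<close> leads out of the submodule containing
    \<open>T w\<close>.\<close>
  define a where "a = mo (T * PP m)"
  have TP: "T * PP m \<in> A" using T(1) A_P by (rule A_mult)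
  have a: "a \<in> carrier S" "mop N a = T * PP m" using mo[OF TP] by (simp_all add: a_def)
  have ay: "act (mop N (a * y)) w = (\<lambda>k. c * act T w k)"
    using a y by (simp add: mop_mult carrier_S_mat c act_cmult)
  have "a * y \<noteq> 0\<^sub>m N N"
  proof
    assume "a * y = 0\<^sub>m N N"
    then have "(\<lambda>k. c * act T w k) = (\<lambda>_. 0)" using ay by (simp add: mop_zero)
    then have "act T w = (\<lambda>_. 0)" using c0 by (simp add: fun_eq_iff)
    then show False using T(2) by (simp add: w_def)
  qed
  then obtain x where x: "x \<in> carrier S" "x * (a * y) = y" using recover[OF a(1)] by blast
  have "act ?Y w = act (mop N (x * (a * y))) w" by (simp only: x(2))
  also have "\<dots> = (\<lambda>k. c * act (mop N x) (act T w) k)"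
    using x(1) S_closed(1)[OF a(1) y(1)] by (simp add: mop_mult carrier_S_mat ay act_cmult)
  finally have "act (PP m) (act ?Y w) = (\<lambda>k. c * act (PP m) (act (mop N x) (act T w)) k)"
    by (simp add: act_cmult)
  also have "act (PP m) (act (mop N x) (act T w)) = (\<lambda>_. 0)"
    unfolding m_def w_def
    by (rule P_lspan_wv(2)[OF r I(1) wv_lspan_invariant[OF r I(1) cl mop_S[OF x(1)] T(3)] I(2)])
  finally show False using c c0 w0 by (simp add: fun_eq_iff)
qed

lemma interior_block:
  assumes r: "r = a + b" and ba: "b \<le> a" and al: "a + 2 \<le> l" and x0: "HW (int a) x0"
  shows "\<exists>e. bidem e \<and> semisimple_ring (S\<lparr>carrier := blk e, one := mo e\<rparr>)
    \<and> (\<forall>x. HW (int a) x \<longrightarrow> act e x = x \<and> act (FF ^ Suc (a - b)) x = (\<lambda>_. 0))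
    \<and> (\<forall>m x. HW m x \<and> act e x = x \<longrightarrow> m = int a)"
proof -
  interpret I: interior_weight scal EE FF PP \<epsilon> r a b
  proof
    show "br k \<noteq> 0" if "1 \<le> k" "k \<le> int a + 1" for k using that al by (intro qbr_nonzero) auto
  qed (use r ba in auto)
  interpret SR: ring S by (rule S_ring)
  let ?e = I.e and ?z = I.z
  have zx: "act ?z x = x" if "HW (int a) x" for x
  proof -
    obtain y where "?z = PP (int a) + FF * y * EE" using I.z_form by blast
    then show ?thesis using that by (simp add: HW_def act_zero)
  qed
  have ex: "act ?e x = x" if "HW (int a) x" for x
    using arg_cong[OF I.e_z, of "\<lambda>T. act T x"] zx[OF that] by simp
  have Fx: "act (FF ^ Suc (a - b)) x = (\<lambda>_. 0)" if "HW (int a) x" for x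
    using arg_cong[OF I.F_pow_z_0, of "\<lambda>T. act T x"] zx[OF that] by simp
  \<comment> \<open>At any other weight all summands of \<open>e\<close> kill a highest weight
    vector \<open>x\<close>: \<open>E^i x = 0\<close> for \<open>i > 0\<close>, and
    \<open>z x = z P m x = 0\<close>.\<close>
  have uniq: "m = int a" if "HW m x" "act ?e x = x" for m x
  proof (rule ccontr)
    assume "m \<noteq> int a"
    have x: "act (PP m) x = x" "act EE x = (\<lambda>_. 0)" "x \<noteq> (\<lambda>_. 0)" using that(1) by (auto simp: HW_def)
    have "?z * PP m = 0" using \<open>m \<noteq> int a\<close> I.z_P(1) P_mult[of "int a" m]
      by (metis mult.assoc mult_zero_right)
    have "act ?z x = act (?z * PP m) x" using x(1) by simp
    then have "act ?z x = (\<lambda>_. 0)" unfolding \<open>?z * PP m = 0\<close> by simp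
    moreover have "act (EE ^ i) x = (if i = 0 then x else (\<lambda>_. 0))" for i
      by (induction i) (simp_all add: x(2) act_zero)
    ultimately have "act (scal (I.nu i) * (FF ^ i * ?z * EE ^ i)) x = (\<lambda>_. 0)" for i
      by (cases i) (simp_all add: act_zero x(2))
    then have "act ?e x = (\<lambda>_. 0)" unfolding I.e_def act_sum by simp
    then show False using that(2) x(3) by simp
  qed
  have ce: "cidem ?e" unfolding cidem_def using I.e_A I.e_idem I.e_central by blast
  have be: "bidem ?e" unfolding bidem_def
  proof (intro conjI allI impI ce)
    show "?e \<noteq> 0" using ex[OF x0] x0 by (auto simp: HW_def)
    show "f = 0 \<or> f = ?e" if "cidem f \<and> ?e * f = f" for f
      using that by (intro I.e_primitive) (auto intro: cidem_A cidem_idem cidem_comm)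
  qed
  have corner: "(\<lambda>a. mo ?e \<otimes>\<^bsub>S\<^esub> a) ` carrier S = blk ?e" by (simp add: blk_def S_simps)
  have "semisimple_ring (SR.corner_ring (mo ?e))"
  proof (rule SR.semisimple_blockI[where z = "mo ?z"])
    show "central_idempotent S (mo ?e)" using ce mo[OF I.e_A] by (simp add: central_idempotent_iff)
    show zS: "mo ?z \<in> carrier S" by (rule mo[OF I.z_A])
    show "mo ?e \<otimes>\<^bsub>S\<^esub> mo ?z = mo ?z" by (simp add: S_simps mo_mult[OF I.e_A I.z_A, symmetric] I.e_z)
    show "\<exists>y\<in>carrier S. y \<otimes>\<^bsub>S\<^esub> (x \<otimes>\<^bsub>S\<^esub> mo ?z) = mo ?z" if x: "x \<in> carrier S" "x \<otimes>\<^bsub>S\<^esub> mo ?z \<noteq> \<zero>\<^bsub>S\<^esub>" for x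
    proof -
      have xz: "mo (mop N x * ?z) = x * mo ?z" using x(1) by (simp add: mo_mult mop_S I.z_A mo_mop)
      have "mop N x * ?z \<noteq> 0" using x(2) xz by (auto simp: S_simps mo_zero)
      then obtain y where y: "y \<in> A" "y * mop N x * ?z = ?z" using I.z_simple_module mop_S[OF x(1)] by blast
      have "mo ?z = mo (y * (mop N x * ?z))" using y(2) by (simp add: mult.assoc)
      also have "\<dots> = mo y * (x * mo ?z)" using y(1) x(1) by (simp add: mo_mult A_mult mop_S I.z_A xz)
      finally show ?thesis using mo(1)[OF y(1)] by (intro bexI[of _ "mo y"]) (simp_all add: S_simps)
    qed
    let ?G = "generate (add_monoid S) {f \<otimes>\<^bsub>S\<^esub> mo ?z \<otimes>\<^bsub>S\<^esub> g | f g. f \<in> carrier S \<and> g \<in> carrier S}"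
    let ?t = "\<lambda>i. scal (I.nu i) * (FF ^ i * ?z * EE ^ i)"
    have t: "mo (?t i) \<in> ?G" for i
    proof (rule generate.incl)
      have "?t i = (scal (I.nu i) * FF ^ i) * ?z * EE ^ i" by (simp only: mult.assoc)
      then have "mo (?t i) = mo (scal (I.nu i) * FF ^ i) \<otimes>\<^bsub>S\<^esub> mo ?z \<otimes>\<^bsub>S\<^esub> mo (EE ^ i)"
        by (simp add: mo_mult A_intros I.z_A S_simps)
      moreover have "mo (scal (I.nu i) * FF ^ i) \<in> carrier S" "mo (EE ^ i) \<in> carrier S"
        by (intro mo A_intros)+
      ultimately show "mo (?t i) \<in> {f \<otimes>\<^bsub>S\<^esub> mo ?z \<otimes>\<^bsub>S\<^esub> g | f g. f \<in> carrier S \<and> g \<in> carrier S}"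
        by blast
    qed
    have tA: "?t i \<in> A" for i by (intro A_intros I.z_A)
    have "mo (\<Sum>i<n. ?t i) \<in> ?G" for n
    proof (induction n)
      case 0
      have "mo (\<Sum>i<0. ?t i) = \<one>\<^bsub>add_monoid S\<^esub>" by (simp add: mo_zero S_simps)
      then show ?case by (simp only: generate.one)
    next
      case (Suc n)
      have "mo (\<Sum>i<Suc n. ?t i) = mo (\<Sum>i<n. ?t i) + mo (?t n)"
        unfolding sum.lessThan_Suc by (intro mo_add A_sum tA)
      also have "\<dots> = mo (\<Sum>i<n. ?t i) \<otimes>\<^bsub>add_monoid S\<^esub> mo (?t n)" by (simp add: S_simps)
      finally show ?case by (simp only: generate.eng[OF Suc t])
    qed
    then show "mo ?e \<in> ?G" unfolding I.e_def lessThan_Suc_atMost[symmetric] .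
  qed
  then show ?thesis unfolding corner using be ex Fx uniq by (intro exI[of _ ?e]) blast
qed

section \<open>Weights\<close>

lemma br_add_l: "br (k + int l * x) = 0 \<longleftrightarrow> br k = 0"
  unfolding qbr_eq_0_iff by (simp only: dvd_add_left_iff dvd_triv_left)

lemma br_l_mult: "br (int l * x) = 0"
  unfolding qbr_eq_0_iff by simp

lemma P_wv: "r = 2 * b + n \<Longrightarrow> j \<le> int n \<Longrightarrow> act (PP (int b + int n - j)) (wv \<epsilon> b n j) = wv \<epsilon> b n j"
  by (simp add: Pop_wv)

lemma HW_wv:
  assumes r: "r = 2 * b + n" and j: "0 \<le> j" "j \<le> int n" "j = 0 \<or> br (int n - j + 1) = 0"
  shows "HW (int b + int n - j) (wv \<epsilon> b n j)"
proof -
  have "(\<lambda>i. br (int n - j + 1) * wv \<epsilon> b n (j - 1) i) = (\<lambda>_. 0)"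
    using j(3) by (auto simp: wv_eq_0)
  then show ?thesis
    using wv_nonzero[OF eps0 j(1,2)] P_wv[OF r j(2)]
    by (simp add: HW_def Eop_wv[OF eps0 eps2, of b n j, folded r])
qed

lemma F_pow_wv:
  assumes r: "r = 2 * b + n"
  shows "act (FF ^ k) (wv \<epsilon> b n j) = (\<lambda>i. (\<Prod>t<k. br (j + 1 + int t)) * wv \<epsilon> b n (j + int k) i)"
proof (induction k)
  case (Suc k)
  have "act (FF ^ Suc k) (wv \<epsilon> b n j) = act FF (act (FF ^ k) (wv \<epsilon> b n j))" by simp
  also have "\<dots> = (\<lambda>i. (\<Prod>t<k. br (j + 1 + int t)) * (br (j + int k + 1) * wv \<epsilon> b n (j + int k + 1) i))"
    unfolding Suc act_cmult Eop_wv Fop_wv[OF eps0 eps2, of b n "j + int k", folded r] ..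
  finally show ?case by (simp add: mult.assoc add.commute add.left_commute)
qed simp

text \<open>The weight spaces of the span are lines, and a central idempotent preserves both the
  span and the weight.\<close>

lemma cidem_wv:
  assumes r: "r = 2 * b + n" and j: "0 \<le> j" "j \<le> int n" and e: "cidem e"
  shows "\<exists>c. act e (wv \<epsilon> b n j) = (\<lambda>k. c * wv \<epsilon> b n j k)"
proof -
  have "wv \<epsilon> b n j \<in> lspan (wv \<epsilon> b n) {0..int n}" using j by (intro lspan_base) auto
  then have "act e (wv \<epsilon> b n j) \<in> lspan (wv \<epsilon> b n) {0..int n}"
    using cidem_A[OF e] by (intro wv_lspan_invariant[OF r]) auto
  then obtain c where c: "act (PP (int b + int n - j)) (act e (wv \<epsilon> b n j)) = (\<lambda>k. c * wv \<epsilon> b n j k)"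
    using P_lspan_wv(1)[OF r order_refl] by blast
  have "act e (act (PP (int b + int n - j)) (wv \<epsilon> b n j)) = act (PP (int b + int n - j)) (act e (wv \<epsilon> b n j))"
    using arg_cong[OF cidem_comm[OF e A_P], of "\<lambda>T. act T (wv \<epsilon> b n j)"] by simp
  then show ?thesis using c unfolding P_wv[OF r j(2)] by auto
qed

text \<open>The vector \<open>wv \<epsilon> b n j\<close> need not be killed by \<open>E\<close>.
  But \<open>e P m = P m + F y E\<close>, and the last term contributes only a multiple of
  \<open>F\<close> applied to the vector with index \<open>j - 1\<close>, which is zero because of
  the factor \<open>[j]\<close>.\<close>

lemma cidem_wv_fixed:
  assumes r: "r = 2 * b + n" and j: "0 \<le> j" "j \<le> int n" "br j = 0" and e: "cidem e"
    and x: "HW (int b + int n - j) x" "act e x = x"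
  shows "act e (wv \<epsilon> b n j) = wv \<epsilon> b n j"
proof -
  let ?m = "int b + int n - j" and ?w = "wv \<epsilon> b n"
  obtain c y where c: "y \<in> A" "e * PP ?m = scal c * PP ?m + FF * y * EE" using cidem_weight_part[OF e] by blast
  obtain i where "x i \<noteq> 0" using x by (auto simp: HW_def fun_eq_iff)
  moreover have "x i = c * x i" using cidem_HW[OF c(2) x(1)] x(2) by (metis (mono_tags))
  ultimately have c1: "c = 1" by simp
  have Pw: "act (PP ?m) (?w j) = ?w j" by (rule P_wv[OF r j(2)])
  have "act (y * EE) (?w j) \<in> lspan ?w {0..int n}"
    using j by (intro wv_lspan_invariant[OF r] A_mult c(1) A_E lspan_base) auto
  then obtain d where d: "act (PP (int b + int n - (j - 1))) (act (y * EE) (?w j)) = (\<lambda>k. d * ?w (j - 1) k)"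
    using P_lspan_wv(1)[OF r order_refl] by blast
  have PF: "act (PP ?m) (act FF u) = act FF (act (PP (int b + int n - (j - 1))) u)" for u
    using arg_cong[OF F_P[of "int b + int n - (j - 1)"], of "\<lambda>T. act T u"] by (simp add: algebra_simps)
  have comm: "act e (act (PP ?m) u) = act (PP ?m) (act e u)" for u
    using arg_cong[OF cidem_comm[OF e A_P], of "\<lambda>T. act T u"] by simp
  have "act e (?w j) = act (e * PP ?m) (?w j)" by (simp add: Pw)
  also have "\<dots> = (\<lambda>k. ?w j k + act FF (act (y * EE) (?w j)) k)" unfolding c(2) c1 by (simp add: Pw)
  finally have "act (PP ?m) (act e (?w j)) = (\<lambda>k. ?w j k + act FF (\<lambda>k. d * ?w (j - 1) k) k)"
    using d by (simp add: act_add Pw PF)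
  then show ?thesis
    using comm[of "?w j"] j(3) Fop_wv[OF eps0 eps2, of b n "j - 1", folded r] by (simp add: Pw act_cmult)
qed

text \<open>If the remainder \<open>\<beta>\<close> exceeded \<open>m\<close>, the indices
  \<open>2 * m - r - t\<close> with \<open>t \<le> m\<close> would be congruent modulo
  \<open>l\<close> to \<open>-(\<beta> + t - m)\<close>, where
  \<open>0 < \<beta> + t - m < l\<close>; then \<open>P_factor\<close> would exclude highest weight
  vectors of weight \<open>m\<close>.\<close>

lemma HW_weight_mod:
  assumes x: "HW (int m) x" and mr: "m \<le> r"
  shows "(r - m) mod l \<le> m"
proof (rule ccontr)
  assume "\<not> (r - m) mod l \<le> m"
  then have m: "m < (r - m) mod l" by simp
  define \<beta> d where "\<beta> = (r - m) mod l" and "d = (r - m) div l"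
  have "r - m = \<beta> + l * d" by (simp add: \<beta>_def d_def)
  then have rm: "int r = int m + int \<beta> + int l * int d" using mr
    by (metis le_add_diff_inverse of_nat_add of_nat_mult add.assoc)
  have \<beta>: "m < \<beta>" "\<beta> < l" using m l3 by (auto simp: \<beta>_def)
  have "qnorm \<epsilon> (m + 1) (2 * int m - int r) \<noteq> 0"
  proof (rule qnorm_nonzero)
    fix t assume t: "t < m + 1"
    show "br (int t + 1) \<noteq> 0" using t \<beta> by (intro qbr_nonzero) auto
    have "br (int l - (int \<beta> + int t - int m)) \<noteq> 0" using t \<beta> by (intro qbr_nonzero) auto
    moreover have "2 * int m - int r - int t = int l - (int \<beta> + int t - int m) + int l * (- int d - 1)"
      unfolding rm by (simp add: algebra_simps)
    ultimately show "br (2 * int m - int r - int t) \<noteq> 0" by (simp only: br_add_l) simp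
  qed
  then have "\<exists>y\<in>A. PP (int m) = FF * y * EE" by (intro P_factor) (simp add: nat_add_distrib)
  then obtain y where "PP (int m) = FF * y * EE" by blast
  then have "act (PP (int m)) x = act (FF * y * EE) x" by (simp only:)
  moreover have "act (FF * y * EE) x = (\<lambda>_. 0)" using x by (simp add: HW_def act_zero)
  moreover have "act (PP (int m)) x = x" "x \<noteq> (\<lambda>_. 0)" using x by (simp_all add: HW_def)
  ultimately show False by metis
qed

lemma bidem_HW_unique:
  assumes "bidem e" "bidem e'" "HW m x" "act e x = x" "HW m x'" "act e' x' = x'"
  shows "e = e'"
proof (rule bidem_eq[OF assms(1,2)])
  have "act e x' = x'" by (rule cidem_HW_eq[OF bidem_cidem[OF assms(1)] assms(3,5,4)])
  then have "act (e * e') x' = x'" using assms(6) by simp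
  moreover have "x' \<noteq> (\<lambda>_. 0)" using assms(5) by (simp add: HW_def)
  ultimately show "e * e' \<noteq> 0" by (metis zero_op.rep_eq)
qed

text \<open>The length \<open>n = l - 1 + l (c + d)\<close> and the index \<open>j = l d\<close> are
  chosen to give the right weight, and \<open>n - j + 1 = l (c + 1)\<close> makes the coefficient of
  \<open>E\<close> vanish.\<close>

lemma HW_exists_Steinberg:
  assumes "r = (b + l - 1 + l * c) + (b + l * d)"
  shows "HW (int (b + l - 1 + l * c)) (wv \<epsilon> b (l - 1 + l * (c + d)) (int l * int d))"
proof -
  have l: "int (l - 1) = int l - 1" using l3 by simp
  have r: "r = 2 * b + (l - 1 + l * (c + d))" using assms l3 by (simp add: algebra_simps)
  have "HW (int b + int (l - 1 + l * (c + d)) - int l * int d) (wv \<epsilon> b (l - 1 + l * (c + d)) (int l * int d))"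
  proof (rule HW_wv[OF r])
    have "int (l - 1 + l * (c + d)) - int l * int d + 1 = int l * (int c + 1)"
      unfolding of_nat_add l by (simp add: algebra_simps)
    then show "int l * int d = 0 \<or> br (int (l - 1 + l * (c + d)) - int l * int d + 1) = 0"
      by (simp only: br_l_mult simp_thms)
  qed (auto simp: l algebra_simps)
  moreover have "int b + int (l - 1 + l * (c + d)) - int l * int d = int (b + l - 1 + l * c)"
    using l3 by (simp add: l algebra_simps)
  ultimately show ?thesis by simp
qed

text \<open>The ladder stops because \<open>F ^ l = 0\<close>, a consequence of
  \<open>[l] = 0\<close>. Up to multiples of \<open>l\<close>, the indices in the norms are
  \<open>t + 1\<close> and \<open>l - 1 - t\<close> with \<open>t < l - 1\<close>, so the norms are
  nonzero.\<close>

lemma block_of_Steinberg: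
  assumes r: "r = (b + l - 1 + l * c) + (b + l * d)"
  shows "\<exists>e x. bidem e \<and> HW (int (b + l - 1 + l * c)) x \<and> act e x = x
    \<and> block_of \<epsilon> r (b + l - 1 + l * c, b + l * d) = blk e"
proof -
  obtain x where x: "HW (int (b + l - 1 + l * c)) x" using HW_exists_Steinberg[OF r] by blast
  obtain e where e: "bidem e" "act e x = x" using block_of_HW_ex[OF x] by blast
  have "br (int l) = 0" using br_l_mult[of 1] by simp
  then have "FF ^ Suc (l - 1) = 0" using Fop_pow_0[OF eps0 eps2, of "Suc (l - 1)" r] l3 by simp
  then have F0: "act (FF ^ Suc (l - 1)) x = (\<lambda>_. 0)" by (simp only:) simp
  have "\<exists>n \<rho>. is_L1hat \<epsilon> r (b + l - 1 + l * c, b + l * d) n \<rho>"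
  proof (rule L1_exists[OF x r[symmetric] F0])
    fix i assume i: "i \<le> l - 1"
    show "qnorm \<epsilon> i (int (b + l - 1 + l * c) - int (b + l * d)) \<noteq> 0"
    proof (rule qnorm_nonzero)
      fix t assume t: "t < i"
      show "br (int t + 1) \<noteq> 0" using t i l3 by (intro qbr_nonzero) auto
      have "br (int l - 1 - int t) \<noteq> 0" using t i l3 by (intro qbr_nonzero) auto
      moreover have "int (b + l - 1 + l * c) - int (b + l * d) - int t = int l - 1 - int t + int l * (int c - int d)"
        using l3 by (simp add: algebra_simps of_nat_diff)
      ultimately show "br (int (b + l - 1 + l * c) - int (b + l * d) - int t) \<noteq> 0" by (simp only: br_add_l) simp
    qed
  qed
  then show ?thesis using block_of_eq[OF _ r[symmetric] e(1) x e(2)] e x by blast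
qed

lemma block_of_interior:
  assumes r: "a + b = r" and ba: "b \<le> a" and al: "a + 2 \<le> l"
  shows "\<exists>e x. bidem e \<and> HW (int a) x \<and> act e x = x \<and> block_of \<epsilon> r (a, b) = blk e
    \<and> semisimple_ring (S\<lparr>carrier := blk e, one := mo e\<rparr>) \<and> (\<forall>m x. HW m x \<and> act e x = x \<longrightarrow> m = int a)"
proof -
  have r': "r = 2 * b + (a - b)" using r ba by simp
  have "HW (int b + int (a - b) - 0) (wv \<epsilon> b (a - b) 0)" by (rule HW_wv[OF r']) auto
  then have x: "HW (int a) (wv \<epsilon> b (a - b) 0)" using ba by (simp add: of_nat_diff)
  define x0 where "x0 = wv \<epsilon> b (a - b) 0"
  note x = x[folded x0_def]
  obtain e where e: "bidem e" "semisimple_ring (S\<lparr>carrier := blk e, one := mo e\<rparr>)"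
     "act e x0 = x0" "act (FF ^ Suc (a - b)) x0 = (\<lambda>_. 0)" "\<And>m x. HW m x \<Longrightarrow> act e x = x \<Longrightarrow> m = int a"
    using interior_block[OF r[symmetric] ba al x] x by blast
  have "\<exists>n \<rho>. is_L1hat \<epsilon> r (a, b) n \<rho>"
  proof (rule L1_exists[OF x r e(4)])
    fix i assume i: "i \<le> a - b"
    show "qnorm \<epsilon> i (int a - int b) \<noteq> 0"
      using i al ba by (intro qnorm_nonzero qbr_nonzero) auto
  qed
  then have "block_of \<epsilon> r (a, b) = blk e" using block_of_eq[OF _ r e(1) x e(3)] by blast
  then show ?thesis using e x by blast
qed

text \<open>The Weyl module with \<open>n = s + l (c + d)\<close>, where \<open>s = a - b\<close>,
  contains the weight \<open>a + l c\<close> at the index \<open>j = l d\<close>. As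
  \<open>[j] = 0\<close>, \<open>cidem_wv_fixed\<close> places this vector in the block even if
  \<open>E\<close> does not kill it.\<close>

lemma not_semisimple_outer:
  assumes r: "r = (a + l * c) + (b + l * d)" and ba: "b \<le> a" and al: "a - b + 2 \<le> l" and cd: "c \<ge> 1 \<or> d \<ge> 1"
    and e: "cidem e" and ss: "semisimple_ring (S\<lparr>carrier := blk e, one := mo e\<rparr>)"
    and x: "HW (int (a + l * c)) x" "act e x = x"
  shows False
proof -
  define s where "s = a - b"
  define n where "n = s + l * (c + d)"
  define j where "j = int l * int d"
  have r': "r = 2 * b + n" using r ba by (simp add: n_def s_def algebra_simps)
  have nj: "int n = int s + int l * int c + j" by (simp add: n_def j_def algebra_simps)
  have lc: "int l * int c \<ge> 0" "c \<ge> 1 \<Longrightarrow> int l * int c \<ge> int l" and j0: "j \<ge> 0" "d \<ge> 1 \<Longrightarrow> j \<ge> int l"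
    using mult_left_mono[of 1 "int c" "int l"] mult_left_mono[of 1 "int d" "int l"] by (simp_all add: j_def)
  have jn: "j \<le> int n" using nj lc by simp
  have sl: "int s + 2 \<le> int l" using al by (simp add: s_def)
  have brj: "br j = 0" unfolding j_def by (rule br_l_mult)
  have "int b + int n - j = int (a + l * c)" using ba by (simp add: nj s_def of_nat_diff)
  then have ew: "act e (wv \<epsilon> b n j) = wv \<epsilon> b n j"
    using x by (intro cidem_wv_fixed[OF r' j0(1) jn brj e]) simp_all
  note ns = not_semisimple[OF r' e ss j0(1) jn ew]
  from cd show False
  proof
    assume c: "c \<ge> 1"
    \<comment> \<open>At the lower end of this range \<open>E\<close> has the coefficient
      \<open>[l c] = 0\<close>, so the range spans a submodule. The power \<open>F ^ Suc s\<close>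
      reaches it from index \<open>j\<close> with the coefficients \<open>[l d + 1]\<close> up to
      \<open>[l d + s + 1]\<close>, all nonzero since \<open>s + 1 < l\<close>.\<close>
    let ?I = "{j + int (Suc s)..int n}"
    have le: "j + int (Suc s) \<le> int n" unfolding of_nat_Suc using lc(2)[OF c] nj sl by linarith
    have p: "(\<Prod>t<Suc s. br (j + 1 + int t)) \<noteq> 0"
    proof (unfold prod_zero_iff[OF finite_lessThan], safe)
      fix t assume t: "t < Suc s" "br (j + 1 + int t) = 0"
      have "br (int t + 1) \<noteq> 0" using t sl by (intro qbr_nonzero) auto
      moreover have "j + 1 + int t = int t + 1 + int l * int d" by (simp add: j_def)
      ultimately show False using t(2) by (simp only: br_add_l)
    qed
    have w: "wv \<epsilon> b n (j + int (Suc s)) \<noteq> (\<lambda>_. 0)" using le j0 by (intro wv_nonzero eps0) auto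
    show False
    proof (rule ns[where T = "FF ^ Suc s" and I = ?I])
      show "FF ^ Suc s \<in> A" by (intro A_intros)
      show "act (FF ^ Suc s) (wv \<epsilon> b n j) \<noteq> (\<lambda>_. 0)"
        unfolding F_pow_wv[OF r'] using p w by (auto simp: fun_eq_iff simp del: prod.lessThan_Suc)
      show "act (FF ^ Suc s) (wv \<epsilon> b n j) \<in> lspan (wv \<epsilon> b n) ?I"
        unfolding F_pow_wv[OF r'] using le by (intro lspan_cmult lspan_base) auto
      show "?I \<subseteq> {0..int n}" "j \<notin> ?I" using j0 by auto
      show "i = int n \<or> i + 1 \<in> ?I \<or> br (i + 1) = 0" if "i \<in> ?I" for i using that by auto
      show "i = 0 \<or> i - 1 \<in> ?I \<or> br (int n - i + 1) = 0" if "i \<in> ?I" for i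
      proof (cases "i = j + int (Suc s)")
        case True
        then have "int n - i + 1 = int l * int c" using nj by simp
        then show ?thesis by (simp only: br_l_mult) simp
      qed (use that in auto)
    qed
  next
    assume d: "d \<ge> 1"
    \<comment> \<open>Here \<open>F\<close> cannot leave the range because \<open>[j] = 0\<close>,
      while \<open>E\<close> enters it from index \<open>j\<close> with the nonzero coefficient
      \<open>[s + 1 + l c]\<close>.\<close>
    let ?I = "{0..j - 1}"
    have "br (int s + 1) \<noteq> 0" using sl by (intro qbr_nonzero) auto
    moreover have "int n - j + 1 = int s + 1 + int l * int c" by (simp add: nj)
    ultimately have p: "br (int n - j + 1) \<noteq> 0" by (simp only: br_add_l) simp
    have w: "wv \<epsilon> b n (j - 1) \<noteq> (\<lambda>_. 0)" using jn j0(2)[OF d] l3 by (intro wv_nonzero eps0) auto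
    note Ew = Eop_wv[OF eps0 eps2, of b n j, folded r']
    show False
    proof (rule ns[where T = EE and I = ?I])
      show "EE \<in> A" by (rule A_E)
      show "act EE (wv \<epsilon> b n j) \<noteq> (\<lambda>_. 0)" unfolding Ew using p w by (auto simp: fun_eq_iff)
      show "act EE (wv \<epsilon> b n j) \<in> lspan (wv \<epsilon> b n) ?I"
        unfolding Ew using j0(2)[OF d] l3 by (intro lspan_cmult lspan_base) auto
      show "?I \<subseteq> {0..int n}" "j \<notin> ?I" using jn by auto
      show "i = 0 \<or> i - 1 \<in> ?I \<or> br (int n - i + 1) = 0" if "i \<in> ?I" for i using that by auto
      show "i = int n \<or> i + 1 \<in> ?I \<or> br (i + 1) = 0" if "i \<in> ?I" for i
        using that brj by (cases "i = j - 1") auto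
    qed
  qed
qed

text \<open>The Weyl module of the mirror weight \<open>(b + l - 1, a + 1 - l)\<close> is used, with
  sl2-weight \<open>2l - 2 - s\<close>. At \<open>j = l - 1 - s\<close> it contains a highest weight
  vector of weight \<open>a\<close>, since \<open>n - j + 1 = l\<close>. The contradiction arises
  one step above, at \<open>j - 1\<close>, where \<open>F\<close> maps into the submodule generated
  there.\<close>

lemma not_semisimple_boundary:
  assumes r: "r = a + b" and bl: "b < l" and ba: "b \<le> a" and al: "a - b + 2 \<le> l" "l \<le> a + 1"
    and e: "cidem e" and ss: "semisimple_ring (S\<lparr>carrier := blk e, one := mo e\<rparr>)"
    and x: "HW (int a) x" "act e x = x"
  shows False
proof -
  define b' where "b' = a + 1 - l"
  define s where "s = a - b"
  define n where "n = 2 * l - 2 - s"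
  define j where "j = int l - 1 - int s"
  have b': "int b' = int a + 1 - int l" using al(2) by (simp add: b'_def of_nat_diff)
  have s: "int s = int a - int b" "int s + 2 \<le> int l" using ba al by (simp_all add: s_def of_nat_diff)
  have n: "int n = 2 * int l - 2 - int s" using s(2) by (simp add: n_def)
  have "int r = 2 * int b' + int n" using r s b' n by simp
  then have r': "r = 2 * b' + n" by linarith
  have j: "1 \<le> j" "j < int l" "j \<le> int n" "int n - j + 1 = int l" using s n by (auto simp: j_def)
  have brl: "br (int l) = 0" using br_l_mult[of 1] by simp
  have "HW (int b' + int n - j) (wv \<epsilon> b' n j)" using j brl by (intro HW_wv[OF r']) simp_all
  moreover have "int b' + int n - j = int a" using b' n by (simp add: j_def)
  ultimately have "HW (int a) (wv \<epsilon> b' n j)" by simp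
  then have ew: "act e (wv \<epsilon> b' n j) = wv \<epsilon> b' n j" by (rule cidem_HW_eq[OF e x(1) _ x(2)])
  have w: "wv \<epsilon> b' n j \<noteq> (\<lambda>_. 0)" using j by (intro wv_nonzero eps0) auto
  have p: "br j \<noteq> 0" using j by (intro qbr_nonzero) auto
  have Fw: "act FF (wv \<epsilon> b' n (j - 1)) = (\<lambda>i. br j * wv \<epsilon> b' n j i)"
    using Fop_wv[OF eps0 eps2, of b' n "j - 1", folded r'] by simp
  obtain c where c: "act e (wv \<epsilon> b' n (j - 1)) = (\<lambda>k. c * wv \<epsilon> b' n (j - 1) k)"
    using cidem_wv[OF r' _ _ e, of "j - 1"] j by auto
  \<comment> \<open>The vector with index \<open>j\<close> is fixed by \<open>e\<close> and is, up
    to a nonzero factor, \<open>F\<close> of the one with index \<open>j - 1\<close>; so the scalar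
    of \<open>e\<close> on the latter must be 1.\<close>
  have "act e (act FF (wv \<epsilon> b' n (j - 1))) = act FF (act e (wv \<epsilon> b' n (j - 1)))"
    using arg_cong[OF cidem_comm[OF e A_F], of "\<lambda>T. act T (wv \<epsilon> b' n (j - 1))"] by simp
  then have eq: "(\<lambda>i. br j * wv \<epsilon> b' n j i) = (\<lambda>i. c * (br j * wv \<epsilon> b' n j i))"
    unfolding Fw c act_cmult ew .
  obtain i where "wv \<epsilon> b' n j i \<noteq> 0" using w by (auto simp: fun_eq_iff)
  then have "c = 1" using fun_cong[OF eq, of i] p by simp
  then have ew': "act e (wv \<epsilon> b' n (j - 1)) = wv \<epsilon> b' n (j - 1)" using c by simp
  let ?I = "{j..int n}"
  show False
  proof (rule not_semisimple[OF r' e ss _ _ ew', where T = FF and I = ?I])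
    show "0 \<le> j - 1" "j - 1 \<le> int n" using j by auto
    show "FF \<in> A" by (rule A_F)
    show "act FF (wv \<epsilon> b' n (j - 1)) \<noteq> (\<lambda>_. 0)" unfolding Fw using p w by (auto simp: fun_eq_iff)
    show "act FF (wv \<epsilon> b' n (j - 1)) \<in> lspan (wv \<epsilon> b' n) ?I"
      unfolding Fw using j by (intro lspan_cmult lspan_base) auto
    show "?I \<subseteq> {0..int n}" "j - 1 \<notin> ?I" using j by auto
    show "i = int n \<or> i + 1 \<in> ?I \<or> br (i + 1) = 0" if "i \<in> ?I" for i using that by auto
    show "i = 0 \<or> i - 1 \<in> ?I \<or> br (int n - i + 1) = 0" if "i \<in> ?I" for i
      using that brl j(4) by (cases "i = j") auto
  qed
qed

text \<open>With \<open>i = a - b\<close> one has \<open>r + i = 2a\<close>, so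
  \<open>i < 2l - r - 2\<close> turns into \<open>a \<le> l - 2\<close>.\<close>

lemma I_weights_iff: "(a, b) \<in> I_weights l r \<longleftrightarrow> a + b = r \<and> b \<le> a \<and> a + 2 \<le> l"
proof
  assume "(a, b) \<in> I_weights l r"
  then obtain i where i: "a = (r + i) div 2" "b = (r - i) div 2" "int i < 2 * int l - int r - 2" "i \<le> r" "even (r - i)"
    unfolding I_weights_def by blast
  then obtain k where "r = i + 2 * k" by (metis evenE le_add_diff_inverse)
  then have "a = i + k" "b = k" using i by auto
  then show "a + b = r \<and> b \<le> a \<and> a + 2 \<le> l" using i \<open>r = i + 2 * k\<close> by auto
next
  assume h: "a + b = r \<and> b \<le> a \<and> a + 2 \<le> l"
  then have "(r + (a - b)) div 2 = a" "(r - (a - b)) div 2 = b" "even (r - (a - b))" by auto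
  then show "(a, b) \<in> I_weights l r"
    using h unfolding I_weights_def by (intro CollectI exI[of _ "a - b"]) auto
qed

text \<open>For \<open>(a, b)\<close> in \<open>P1 l\<close> the number \<open>a - b + 1\<close>
  lies between 1 and \<open>l\<close>, so divisibility by \<open>l\<close> forces
  \<open>a = b + l - 1\<close>.\<close>

lemma Steinberg_weights_iff:
  "(m, m') \<in> Steinberg_weights l r \<longleftrightarrow> (\<exists>b c d. m = b + l - 1 + l * c \<and> m' = b + l * d \<and> b \<le> l - 1 \<and> m + m' = r)"
proof
  assume h: "(m, m') \<in> Steinberg_weights l r"
  then have "(m, m') \<in> Gamma1 l r" by (simp add: Steinberg_weights_def)
  then obtain a b c d where g: "m = a + l * c" "m' = b + l * d" "b \<le> a" "a - b \<le> l - 1" "b \<le> l - 1" "m + m' = r"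
    unfolding Gamma1_def P1_def by blast
  obtain k :: int where "int m - int m' + 1 = k * int l" using h by (auto simp: Steinberg_weights_def)
  then have "int a - int b + 1 = int l * (k + int d - int c)" using g by (simp add: algebra_simps)
  then have "int l dvd int a - int b + 1" by simp
  moreover have "0 < int a - int b + 1" "int a - int b + 1 \<le> int l" using g l3 by auto
  ultimately have "int a - int b + 1 = int l" using zdvd_imp_le by fastforce
  then have "a = b + l - 1" by linarith
  then show "\<exists>b c d. m = b + l - 1 + l * c \<and> m' = b + l * d \<and> b \<le> l - 1 \<and> m + m' = r" using g by blast
next
  assume "\<exists>b c d. m = b + l - 1 + l * c \<and> m' = b + l * d \<and> b \<le> l - 1 \<and> m + m' = r"
  then obtain b c d where g: "m = b + l - 1 + l * c" "m' = b + l * d" "b \<le> l - 1" "m + m' = r" by blast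
  have "(b + l - 1, b) \<in> P1 l" using g l3 by (auto simp: P1_def)
  then have "(m, m') \<in> Gamma1 l r" using g unfolding Gamma1_def by blast
  moreover have "int m - int m' + 1 = (int c - int d + 1) * int l" using g l3 by (simp add: algebra_simps of_nat_diff)
  ultimately show "(m, m') \<in> Steinberg_weights l r" unfolding Steinberg_weights_def by auto
qed

section \<open>Classification\<close>

lemma is_block_iff: "is_block S B \<longleftrightarrow> (\<exists>e. bidem e \<and> B = blk e)"
  unfolding is_block_def block_idempotent_ex_iff S_simps blk_def by auto

lemma semisimple_block_iff:
  "semisimple_block S B \<longleftrightarrow> (\<exists>e. bidem e \<and> B = blk e \<and> semisimple_ring (S\<lparr>carrier := blk e, one := mo e\<rparr>))"
  unfolding semisimple_block_def block_idempotent_ex_iff S_simps blk_def by auto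

text \<open>A Steinberg block has a highest weight with first entry at least \<open>l - 1\<close>,
  whereas the only highest weight of this block has first entry
  \<open>a \<le> l - 2\<close>.\<close>

lemma interior_blocks:
  assumes "\<mu> \<in> I_weights l r"
  shows "is_block S (block_of \<epsilon> r \<mu>) \<and> semisimple_block S (block_of \<epsilon> r \<mu>) \<and> \<not> Steinberg_block \<epsilon> l r (block_of \<epsilon> r \<mu>)"
proof -
  obtain a b where \<mu>: "\<mu> = (a, b)" by (cases \<mu>)
  have h: "a + b = r" "b \<le> a" "a + 2 \<le> l" using assms by (simp_all add: \<mu> I_weights_iff)
  obtain e where e: "bidem e" "block_of \<epsilon> r (a, b) = blk e"
      "semisimple_ring (S\<lparr>carrier := blk e, one := mo e\<rparr>)" "\<And>m x. HW m x \<Longrightarrow> act e x = x \<Longrightarrow> m = int a"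
    using block_of_interior[OF h] by blast
  have "\<not> Steinberg_block \<epsilon> l r (blk e)"
  proof
    assume "Steinberg_block \<epsilon> l r (blk e)"
    then obtain \<nu> where \<nu>: "\<nu> \<in> Steinberg_weights l r" "blk e = block_of \<epsilon> r \<nu>" unfolding Steinberg_block_def by blast
    obtain m m' where mm: "\<nu> = (m, m')" by (cases \<nu>)
    obtain b' c d where g: "m = b' + l - 1 + l * c" "m' = b' + l * d" "m + m' = r"
      using \<nu>(1) unfolding mm Steinberg_weights_iff by blast
    then have r: "r = (b' + l - 1 + l * c) + (b' + l * d)" by simp
    obtain e' x where e': "bidem e'" "HW (int m) x" "act e' x = x" "block_of \<epsilon> r \<nu> = blk e'"
      using block_of_Steinberg[OF r] unfolding mm g by blast
    have "e = e'" using blk_inj[OF e(1) e'(1)] \<nu>(2) e'(4) by simp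
    then have "m = a" using e(4)[OF e'(2)] e'(3) by simp
    then show False using g(1) h(3) l3 by simp
  qed
  then show ?thesis unfolding \<mu> e(2) is_block_iff semisimple_block_iff using e by blast
qed

text \<open>Any highest weight of the block is brought into the form
  \<open>(a + l c, b + l d)\<close> with \<open>b \<le> a \<le> b + l - 1\<close> by two divisions
  with remainder; the second one needs \<open>b \<le> m\<close>, which is
  \<open>HW_weight_mod\<close>. The case \<open>a - b = l - 1\<close> is Steinberg, and the two
  non-semisimplicity results leave only \<open>c = d = 0\<close> with
  \<open>a \<le> l - 2\<close>.\<close>

lemma semisimple_non_Steinberg:
  assumes ss: "semisimple_block S B" and ns: "\<not> Steinberg_block \<epsilon> l r B"
  shows "\<exists>\<mu>\<in>I_weights l r. B = block_of \<epsilon> r \<mu>"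
proof -
  obtain e where e: "bidem e" "B = blk e" "semisimple_ring (S\<lparr>carrier := blk e, one := mo e\<rparr>)"
    using ss unfolding semisimple_block_iff by blast
  note ce = bidem_cidem[OF e(1)]
  obtain k x where k: "HW k x" "act e x = x" using HWs_nonempty[OF ce bidem_nonzero[OF e(1)]] by (auto simp: HWs_def)
  obtain m where m: "k = int m" "m \<le> r" using HW_range[OF k(1)] by (metis atLeastAtMost_iff of_nat_le_iff zero_le_imp_eq_int)
  note x = k[unfolded m]
  define b d where "b = (r - m) mod l" and "d = (r - m) div l"
  have bm: "b \<le> m" unfolding b_def by (rule HW_weight_mod[OF x(1) m(2)])
  define c where "c = (m - b) div l"
  define a where "a = b + (m - b) mod l"
  have bl: "b < l" using l3 by (simp add: b_def)
  have rm: "r - m = b + l * d" by (simp add: b_def d_def)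
  have ma: "m = a + l * c" using bm by (simp add: a_def c_def)
  have r: "r = (a + l * c) + (b + l * d)" using rm ma m(2) by simp
  have ba: "b \<le> a" by (simp add: a_def)
  have ab: "a - b < l" using l3 by (simp add: a_def)
  show ?thesis
  proof (cases "a - b = l - 1")
    case True
    then have a: "a = b + l - 1" using ba l3 by simp
    have r': "r = (b + l - 1 + l * c) + (b + l * d)" using r a by simp
    obtain e' x' where e': "bidem e'" "HW (int m) x'" "act e' x' = x'" "block_of \<epsilon> r (m, b + l * d) = blk e'"
      using block_of_Steinberg[OF r'] unfolding ma a by blast
    have "e = e'" by (rule bidem_HW_unique[OF e(1) e'(1) x e'(2,3)])
    then have "B = block_of \<epsilon> r (m, b + l * d)" using e(2) e'(4) by simp
    moreover have "(m, b + l * d) \<in> Steinberg_weights l r"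
      unfolding Steinberg_weights_iff using bl r ma a by (intro exI[of _ b] exI[of _ c] exI[of _ d]) auto
    ultimately show ?thesis using ns unfolding Steinberg_block_def by blast
  next
    case False
    then have al: "a - b + 2 \<le> l" using ab by simp
    have "\<not> (c \<ge> 1 \<or> d \<ge> 1)" using not_semisimple_outer[OF r ba al _ ce e(3)] x ma by blast
    then have cd: "c = 0" "d = 0" by auto
    then have r': "r = a + b" and am: "m = a" using r ma by simp_all
    have "\<not> l \<le> a + 1" using not_semisimple_boundary[OF r' bl ba al _ ce e(3)] x am by blast
    then have al': "a + 2 \<le> l" by simp
    obtain e' x' where e': "bidem e'" "HW (int a) x'" "act e' x' = x'" "block_of \<epsilon> r (a, b) = blk e'"
      using block_of_interior[OF r'[symmetric] ba al'] by blast
    have "e = e'" by (rule bidem_HW_unique[OF e(1) e'(1) x[unfolded am] e'(2,3)])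
    then have "B = block_of \<epsilon> r (a, b)" using e(2) e'(4) by simp
    moreover have "(a, b) \<in> I_weights l r" unfolding I_weights_iff using r' ba al' by simp
    ultimately show ?thesis by blast
  qed
qed

end

theorem proposition4p4:
  fixes \<epsilon> :: "'k::field" and l r :: nat
  assumes "l \<ge> 3" and "odd l" and "r \<ge> 1"
    and "primitive_root_of_unity l \<epsilon>"
  shows "(\<forall>\<mu>\<in>I_weights l r.
            is_block (inf_schur \<epsilon> r) (block_of \<epsilon> r \<mu>) \<and>
            semisimple_block (inf_schur \<epsilon> r) (block_of \<epsilon> r \<mu>) \<and>
            \<not> Steinberg_block \<epsilon> l r (block_of \<epsilon> r \<mu>)) \<and>
         (\<forall>B. is_block (inf_schur \<epsilon> r) B \<and> semisimple_block (inf_schur \<epsilon> r) B \<and>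
              \<not> Steinberg_block \<epsilon> l r B \<longrightarrow>
            (\<exists>\<mu>\<in>I_weights l r. B = block_of \<epsilon> r \<mu>))"
proof -
  interpret root_of_unity_schur \<epsilon> l r by unfold_locales (use assms in auto)
  show ?thesis using interior_blocks semisimple_non_Steinberg by blast
qed

end
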